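(* Let $E$ be an elliptic curve over $\mathbb{Q}_2$ with additive reduction and $j$-invariant $j$ satisfying $v_2(j)\geq 0$. Let $c_4,c_6,\Delta$ be the standard invariants of a minimal Weierstrass model of $E/\mathbb{Q}_2$ and write $\Delta=2^{v_2(\Delta)}\widetilde{\Delta}$. Put $L=\mathbb{Q}_2(E[2])$ and let $F$ be the maximal unramified subextension of $L/\mathbb{Q}_2$. (1) Suppose that $v_2(\Delta)$ is odd. (1.1) Then $L=FL_i$ for some $i\in\{3,4,5,6\}$, and $u_{L/\mathbb{Q}_2}=3$. (2) Suppose that $v_2(\Delta)$ is even. (2.1) If $\widetilde{\Delta}\equiv -1\pmod 4$, then $L=FL_i$ for some $i\in\{1,2\}$, and $u_{L/\mathbb{Q}_2}=2$. (2.2) If $v_2(\Delta)\in\{6,8,12,14\}$ and $3v_2(c_4)\geq 8+v_2(\Delta)$, then $L\simeq F[X]/(X^3+2)$ and $u_{L/\mathbb{Q}_2}=1$. (2.3) Otherwise, $L=F$ and $u_{L/\mathbb{Q}_2}=0$.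
   Context: $\mathbb{Q}_2(E[2])$ is the field generated over $\mathbb{Q}_2$ by the coordinates of the $2$-torsion points of $E(\overline{\mathbb{Q}}_2)$. $v_2$ is normalized by $v_2(\mathbb{Q}_2^\times)=\mathbb{Z}$, with $v_2(0)=\infty$. The ramified quadratic extensions $L_1,\dots,L_6$ of $\mathbb{Q}_2$ are those generated by a root of, respectively, $X^2+2X+2$, $X^2+2X+6$, $X^2+2$, $X^2+10$, $X^2+4X+2$, $X^2+4X+10$. Maximal upper ramification break $u_{L/K}$: for a finite extension $L/K$ of finite extensions of $\mathbb{Q}_p$, let $\Gamma(L/K)=\mathrm{Hom}_K(L,\overline{K})$, let $v_L$ be the valuation on $\overline{K}$ with $v_L(L^\times)=\mathbb{Z}$, put $\mathbf{i}_{L/K}(\sigma)=\inf_{a\in\mathcal{O}_L}v_L(\sigma(a)-a)$, and for real $m\geq -1$ put $\Gamma(L/K)_m=\{\sigma\in\Gamma(L/K):\mathbf{i}_{L/K}(\sigma)\geq m+1\}$. Let $\varphi_{L/K}(m)=\frac{1}{e_{L/K}}\int_0^m\#\Gamma(L/K)_y\,dy$ for $m>0$ (with $e_{L/K}$ the ramification index) and $\varphi_{L/K}(m)=m$ for $-1\le m\le 0$; let $\psi_{L/K}$ be its inverse. Put $\Gamma(L/K)^m=\Gamma(L/K)_{\psi_{L/K}(m)}$ and $\Gamma(L/K)^{(m)}=\Gamma(L/K)^{m-1}$ for $m\geq 0$ (shift by one from Serre's numbering). Then $u_{L/K}=\sup\{m\in\mathbb{R}_{\geq 0}:\Gamma(L/K)^{(m)}\neq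 1\}$, with $u_{K/K}=0$. *)

theory Defs
  imports
    "HOL-Analysis.Analysis"
    "HOL-Library.Z2"
    "HOL-Algebra.Algebra"
    "HOL-Algebra.Algebraic_Closure_Type"
begin

section \<open>The 2-adic numbers\<close>

text \<open>\<open>\<int>\<^sub>2\<close> is the inverse limit of the rings \<open>\<int>/2\<^sup>n\<int>\<close>: a 2-adic integer is a compatible
  sequence whose \<open>n\<close>-th entry is the canonical representative of its class modulo \<open>2\<^sup>n\<close>.
  \<open>\<rat>\<^sub>2\<close> is its fraction field.\<close>

typedef zadic2 = "{f :: nat \<Rightarrow> int. \<forall>n. f n \<in> {0..<2 ^ n} \<and> f (Suc n) mod 2 ^ n = f n}"
  morphisms residue_seq Abs_zadic2
  by (rule exI[of _ "\<lambda>_. 0"]) simp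

setup_lifting type_definition_zadic2

lemma mod_Suc_pow2:
  fixes x :: int
  shows "x mod 2 ^ Suc n mod 2 ^ n = x mod 2 ^ n"
  by (rule mod_mod_cancel) simp

lemma zadic2_compat:
  fixes f :: "nat \<Rightarrow> int"
  assumes "\<forall>n. f n \<in> {0..<2 ^ n} \<and> f (Suc n) mod 2 ^ n = f n"
  shows "f (n + k) mod 2 ^ n = f n"
proof (induction k)
  case 0
  then show ?case using assms by simp
next
  case (Suc k)
  have "f (n + Suc k) mod 2 ^ n = f (Suc (n + k)) mod 2 ^ (n + k) mod 2 ^ n"
    by (simp add: mod_mod_cancel le_imp_power_dvd)
  also have "\<dots> = f (n + k) mod 2 ^ n" using assms by simp
  finally show ?case using Suc by simp
qed

instantiation zadic2 :: comm_ring_1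
begin

lift_definition zero_zadic2 :: zadic2 is "\<lambda>_. 0" by simp

lift_definition one_zadic2 :: zadic2 is "\<lambda>n. 1 mod 2 ^ n"
  by (simp add: mod_mod_cancel)

lift_definition plus_zadic2 :: "zadic2 \<Rightarrow> zadic2 \<Rightarrow> zadic2" is "\<lambda>f g n. (f n + g n) mod 2 ^ n"
  by (metis (no_types, lifting) atLeastLessThan_iff mod_Suc_pow2 mod_add_eq
      pos_mod_bound pos_mod_sign zero_less_numeral zero_less_power)

lift_definition uminus_zadic2 :: "zadic2 \<Rightarrow> zadic2" is "\<lambda>f n. (- f n) mod 2 ^ n"
  by (metis (no_types, lifting) atLeastLessThan_iff mod_Suc_pow2 mod_minus_eq
      pos_mod_bound pos_mod_sign zero_less_numeral zero_less_power)

lift_definition minus_zadic2 :: "zadic2 \<Rightarrow> zadic2 \<Rightarrow> zadic2" is "\<lambda>f g n. (f n - g n) mod 2 ^ n"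
  by (metis (no_types, lifting) atLeastLessThan_iff mod_Suc_pow2 mod_diff_eq
      pos_mod_bound pos_mod_sign zero_less_numeral zero_less_power)

lift_definition times_zadic2 :: "zadic2 \<Rightarrow> zadic2 \<Rightarrow> zadic2" is "\<lambda>f g n. (f n * g n) mod 2 ^ n"
  by (metis (no_types, lifting) atLeastLessThan_iff mod_Suc_pow2 mod_mult_eq
      pos_mod_bound pos_mod_sign zero_less_numeral zero_less_power)

instance
proof
  fix a b c :: zadic2
  show "a * b * c = a * (b * c)"
    by transfer (simp add: mod_simps algebra_simps)
  show "a * b = b * a" by transfer (simp add: mult.commute)
  show "1 * a = a"
  proof transfer
    fix f :: "nat \<Rightarrow> int"
    assume f: "\<forall>n. f n \<in> {0..<2 ^ n} \<and> f (Suc n) mod 2 ^ n = f n"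
    show "(\<lambda>n. 1 mod 2 ^ n * f n mod 2 ^ n) = f"
    proof
      fix n
      have "f n mod 2 ^ n = f n" using f by simp
      then show "1 mod 2 ^ n * f n mod 2 ^ n = f n" by (metis mod_mult_left_eq mult_1)
    qed
  qed
  show "a + b + c = a + (b + c)"
    by transfer (simp add: mod_simps algebra_simps)
  show "a + b = b + a" by transfer (simp add: add.commute)
  show "0 + a = a" by transfer (auto simp: fun_eq_iff)
  show "- a + a = 0" by transfer (simp add: mod_simps)
  show "a - b = a + - b" by transfer (simp add: mod_simps)
  show "(a + b) * c = a * c + b * c"
    by transfer (simp add: mod_simps algebra_simps)
  show "(0 :: zadic2) \<noteq> 1"
  proof transfer
    have "(0 :: int) \<noteq> 1 mod 2 ^ 1" by simp
    then show "(\<lambda>_. 0 :: int) \<noteq> (\<lambda>n. 1 mod 2 ^ n)" by metis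
  qed
qed

end

instance zadic2 :: idom
proof
  fix a b :: zadic2
  assume "a \<noteq> 0" "b \<noteq> 0"
  then show "a * b \<noteq> 0"
  proof transfer
    fix f g :: "nat \<Rightarrow> int"
    assume f: "\<forall>n. f n \<in> {0..<2 ^ n} \<and> f (Suc n) mod 2 ^ n = f n"
      and g: "\<forall>n. g n \<in> {0..<2 ^ n} \<and> g (Suc n) mod 2 ^ n = g n"
      and "f \<noteq> (\<lambda>_. 0)" "g \<noteq> (\<lambda>_. 0)"
    then obtain m n where m: "f m \<noteq> 0" and n: "g n \<noteq> 0" by (meson ext)
    have "\<not> 2 ^ m dvd f (m + n)"
      using zadic2_compat[OF f, of m n] m by (simp add: dvd_eq_mod_eq_0)
    moreover have "\<not> 2 ^ n dvd g (m + n)"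
      using zadic2_compat[OF g, of n m] n by (simp add: dvd_eq_mod_eq_0 add.commute)
    moreover have "m > 0"
      using f[rule_format, of 0] m by (cases m) auto
    ultimately have "\<not> 2 ^ (m + n - 1) dvd f (m + n) * g (m + n)"
      using prime_elem_power_dvd_cases[of "2 :: int" "m + n - 1" "f (m + n)" "g (m + n)" m n] by auto
    then have "\<not> 2 ^ (m + n) dvd f (m + n) * g (m + n)"
      by (meson diff_le_self dvd_trans le_imp_power_dvd)
    then show "(\<lambda>n. f n * g n mod 2 ^ n) \<noteq> (\<lambda>_. 0)"
      by (metis dvd_eq_mod_eq_0)
  qed
qed

type_synonym q2 = "zadic2 fract"
type_synonym q2bar = "q2 alg_closure"

text \<open>For \<open>x \<noteq> 0\<close>, the integer \<open>k\<close> with \<open>x = 2\<^sup>k u\<close>, \<open>u \<in> \<int>\<^sub>2\<^sup>\<times>\<close>; unspecified at \<open>0\<close>.\<close>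

definition ord2 :: "q2 \<Rightarrow> int" where
  "ord2 x = (THE k. \<exists>u. u dvd 1 \<and> x = 2 powi k * to_fract u)"

definition val2 :: "q2 \<Rightarrow> ereal" where
  "val2 x = (if x = 0 then \<infinity> else ereal (of_int (ord2 x)))"

definition integral2 :: "q2 \<Rightarrow> bool" where
  "integral2 x \<longleftrightarrow> x \<in> range to_fract"

definition cong2 :: "q2 \<Rightarrow> q2 \<Rightarrow> nat \<Rightarrow> bool" where
  "cong2 x y m \<longleftrightarrow> (\<exists>z. x - y = of_nat m * to_fract z)"

text \<open>The residue map \<open>\<int>\<^sub>2 \<rightarrow> \<int>\<^sub>2/2\<int>\<^sub>2 = \<bbbF>\<^sub>2\<close>; meaningful only on \<open>\<int>\<^sub>2\<close>.\<close>

definition reduction2 :: "q2 \<Rightarrow> bit" where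
  "reduction2 x = (if cong2 x 0 2 then 0 else 1)"


section \<open>Subfields of the algebraic closure of \<open>\<rat>\<^sub>2\<close>\<close>

abbreviation Q2bar :: "q2bar ring" where
  "Q2bar \<equiv> ring_of_type_algebra"

abbreviation Q2 :: "q2bar set" where
  "Q2 \<equiv> range to_ac"

definition adjoin :: "q2bar set \<Rightarrow> q2bar set \<Rightarrow> q2bar set" where
  "adjoin K S = generate_field Q2bar (K \<union> S)"

definition compositum :: "q2bar set \<Rightarrow> q2bar set \<Rightarrow> q2bar set" where
  "compositum K L = generate_field Q2bar (K \<union> L)"

definition is_valuation :: "('a::field \<Rightarrow> ereal) \<Rightarrow> bool" where
  "is_valuation w \<longleftrightarrow>
     (\<forall>x. w x \<noteq> -\<infinity>) \<and> (\<forall>x. w x = \<infinity> \<longleftrightarrow> x = 0) \<and>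
     (\<forall>x y. w (x * y) = w x + w y) \<and> (\<forall>x y. min (w x) (w y) \<le> w (x + y))"

text \<open>The valuation \<open>v\<^sub>L\<close> on the algebraic closure, prolonging (up to scaling) the 2-adic one and
  normalised by \<open>v\<^sub>L(L\<^sup>\<times>) = \<int>\<close>. It exists and is unique for every finite extension \<open>L\<close> of \<open>\<rat>\<^sub>2\<close>.\<close>

definition normalized_val :: "q2bar set \<Rightarrow> q2bar \<Rightarrow> ereal" where
  "normalized_val L = (THE w. is_valuation w \<and>
     (\<exists>c>0. \<forall>x. w (to_ac x) = ereal c * val2 x) \<and>
     w ` (L - {0}) = range (\<lambda>n::int. ereal (of_int n)))"

definition ram_index :: "q2bar set \<Rightarrow> q2bar set \<Rightarrow> nat" where
  "ram_index K L = (THE e. e > 0 \<and>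
     normalized_val L ` (K - {0}) = range (\<lambda>n::int. ereal (of_int (int e * n))))"

text \<open>Residue fields are finite, hence perfect, so that being unramified amounts to
  ramification index one.\<close>

definition unramified_ext :: "q2bar set \<Rightarrow> q2bar set \<Rightarrow> bool" where
  "unramified_ext K F \<longleftrightarrow>
     subfield F Q2bar \<and> K \<subseteq> F \<and> ring.finite_dimension Q2bar K F \<and> ram_index K F = 1"

definition max_unramified_subext :: "q2bar set \<Rightarrow> q2bar set \<Rightarrow> q2bar set \<Rightarrow> bool" where
  "max_unramified_subext K L F \<longleftrightarrow>
     unramified_ext K F \<and> F \<subseteq> L \<and> (\<forall>F'. unramified_ext K F' \<and> F' \<subseteq> L \<longrightarrow> F' \<subseteq> F)"

text \<open>\<open>L\<close> and \<open>F[X]/(p)\<close> are isomorphic over \<open>F\<close>; polynomials over a carrier set are lists of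
  coefficients, the leading one first.\<close>

definition iso_rupture :: "q2bar set \<Rightarrow> q2bar set \<Rightarrow> q2bar list \<Rightarrow> bool" where
  "iso_rupture L F p \<longleftrightarrow>
     (\<exists>h \<in> ring_iso (Q2bar\<lparr>carrier := L\<rparr>) (Rupt\<^bsub>Q2bar\<^esub> F p).
        \<forall>a\<in>F. h a = ring.rupture_surj Q2bar F p (ring.poly_of_const Q2bar a))"

definition ram_quadratic_poly :: "nat \<Rightarrow> q2bar poly" where
  "ram_quadratic_poly i =
     [[:2, 2, 1:], [:6, 2, 1:], [:2, 0, 1:], [:10, 0, 1:], [:2, 4, 1:], [:10, 4, 1:]] ! (i - 1)"

text \<open>The field \<open>L\<^sub>i\<close>, for \<open>i \<in> {1..6}\<close>. The two roots of a quadratic polynomial generate the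
  same field, so the choice of the root is immaterial.\<close>

definition ram_quadratic :: "nat \<Rightarrow> q2bar set" where
  "ram_quadratic i = adjoin Q2 {SOME \<alpha>. poly (ram_quadratic_poly i) \<alpha> = 0}"


section \<open>Upper ramification breaks\<close>

text \<open>Field embeddings of \<open>L\<close> into the algebraic closure over \<open>K\<close>; they are made extensional so that each embedding is counted once.\<close>

definition embeddings :: "q2bar set \<Rightarrow> q2bar set \<Rightarrow> (q2bar \<Rightarrow> q2bar) set" where
  "embeddings K L =
     {\<sigma> \<in> extensional L. \<sigma> \<in> ring_hom (Q2bar\<lparr>carrier := L\<rparr>) Q2bar \<and> (\<forall>x\<in>K. \<sigma> x = x)}"

definition ram_number :: "q2bar set \<Rightarrow> (q2bar \<Rightarrow> q2bar) \<Rightarrow> ereal" where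
  "ram_number L \<sigma> = (INF a\<in>{a \<in> L. normalized_val L a \<ge> 0}. normalized_val L (\<sigma> a - a))"

definition lower_ram :: "q2bar set \<Rightarrow> q2bar set \<Rightarrow> real \<Rightarrow> (q2bar \<Rightarrow> q2bar) set" where
  "lower_ram K L m = {\<sigma> \<in> embeddings K L. ram_number L \<sigma> \<ge> ereal (m + 1)}"

definition herbrand_phi :: "q2bar set \<Rightarrow> q2bar set \<Rightarrow> real \<Rightarrow> real" where
  "herbrand_phi K L m =
     (if m \<le> 0 then m
      else integral {0..m} (\<lambda>y. real (card (lower_ram K L y))) / real (ram_index K L))"

definition herbrand_psi :: "q2bar set \<Rightarrow> q2bar set \<Rightarrow> real \<Rightarrow> real" where
  "herbrand_psi K L = the_inv_into {-1..} (herbrand_phi K L)"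

definition upper_ram :: "q2bar set \<Rightarrow> q2bar set \<Rightarrow> real \<Rightarrow> (q2bar \<Rightarrow> q2bar) set" where
  "upper_ram K L m = lower_ram K L (herbrand_psi K L m)"

definition upper_ram_shifted :: "q2bar set \<Rightarrow> q2bar set \<Rightarrow> real \<Rightarrow> (q2bar \<Rightarrow> q2bar) set" where
  "upper_ram_shifted K L m = upper_ram K L (m - 1)"

text \<open>The inclusion of \<open>L\<close> plays the role of the trivial element of \<open>\<Gamma>(L/K)\<close>.\<close>

definition max_upper_break :: "q2bar set \<Rightarrow> q2bar set \<Rightarrow> ereal" where
  "max_upper_break K L =
     (if L = K then 0
      else Sup (ereal ` {m. m \<ge> 0 \<and> upper_ram_shifted K L m \<noteq> {restrict id L}}))"


section \<open>Weierstrass curves\<close>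

datatype 'a weierstrass =
  Weierstrass (coeff_a1: 'a) (coeff_a2: 'a) (coeff_a3: 'a) (coeff_a4: 'a) (coeff_a6: 'a)

context
  fixes W :: "'a::comm_ring_1 weierstrass"
begin

definition b2 :: 'a where "b2 = coeff_a1 W ^ 2 + 4 * coeff_a2 W"
definition b4 :: 'a where "b4 = 2 * coeff_a4 W + coeff_a1 W * coeff_a3 W"
definition b6 :: 'a where "b6 = coeff_a3 W ^ 2 + 4 * coeff_a6 W"
definition b8 :: 'a where
  "b8 = coeff_a1 W ^ 2 * coeff_a6 W + 4 * coeff_a2 W * coeff_a6 W
      - coeff_a1 W * coeff_a3 W * coeff_a4 W + coeff_a2 W * coeff_a3 W ^ 2 - coeff_a4 W ^ 2"
definition c4 :: 'a where "c4 = b2 ^ 2 - 24 * b4"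
definition c6 :: 'a where "c6 = - (b2 ^ 3) + 36 * b2 * b4 - 216 * b6"
definition disc :: 'a where
  "disc = - (b2 ^ 2) * b8 - 8 * b4 ^ 3 - 27 * b6 ^ 2 + 9 * b2 * b4 * b6"

definition weierstrass_eqn :: "'a \<Rightarrow> 'a \<Rightarrow> 'a" where
  "weierstrass_eqn x y = y ^ 2 + coeff_a1 W * x * y + coeff_a3 W * y
     - (x ^ 3 + coeff_a2 W * x ^ 2 + coeff_a4 W * x + coeff_a6 W)"

end

definition elliptic :: "'a::field weierstrass \<Rightarrow> bool" where
  "elliptic W \<longleftrightarrow> disc W \<noteq> 0"

definition j_invariant :: "'a::field weierstrass \<Rightarrow> 'a" where
  "j_invariant W = c4 W ^ 3 / disc W"

text \<open>\<open>W'\<close> arises from \<open>W\<close> by the substitution \<open>x = u\<^sup>2 x' + r\<close>, \<open>y = u\<^sup>3 y' + s u\<^sup>2 x' + t\<close>.\<close>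

definition weierstrass_iso :: "'a::field weierstrass \<Rightarrow> 'a weierstrass \<Rightarrow> bool" where
  "weierstrass_iso W W' \<longleftrightarrow> (\<exists>u r s t. u \<noteq> 0 \<and>
     u * coeff_a1 W' = coeff_a1 W + 2 * s \<and>
     u ^ 2 * coeff_a2 W' = coeff_a2 W - s * coeff_a1 W + 3 * r - s ^ 2 \<and>
     u ^ 3 * coeff_a3 W' = coeff_a3 W + r * coeff_a1 W + 2 * t \<and>
     u ^ 4 * coeff_a4 W' = coeff_a4 W - s * coeff_a3 W + 2 * r * coeff_a2 W
        - (t + r * s) * coeff_a1 W + 3 * r ^ 2 - 2 * s * t \<and>
     u ^ 6 * coeff_a6 W' = coeff_a6 W + r * coeff_a4 W + r ^ 2 * coeff_a2 W + r ^ 3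
        - t * coeff_a3 W - t ^ 2 - r * t * coeff_a1 W)"

definition integral_model :: "q2 weierstrass \<Rightarrow> q2 weierstrass \<Rightarrow> bool" where
  "integral_model E M \<longleftrightarrow> weierstrass_iso E M \<and> (\<forall>a\<in>set_weierstrass M. integral2 a)"

definition minimal_model :: "q2 weierstrass \<Rightarrow> q2 weierstrass \<Rightarrow> bool" where
  "minimal_model E M \<longleftrightarrow> integral_model E M \<and>
     (\<forall>M'. integral_model E M' \<longrightarrow> val2 (disc M) \<le> val2 (disc M'))"

definition singular_point :: "'a::field weierstrass \<Rightarrow> 'a \<Rightarrow> 'a \<Rightarrow> bool" where
  "singular_point W x y \<longleftrightarrow> weierstrass_eqn W x y = 0 \<and>
     coeff_a1 W * y - (3 * x ^ 2 + 2 * coeff_a2 W * x + coeff_a4 W) = 0 \<and>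
     2 * y + coeff_a1 W * x + coeff_a3 W = 0"

text \<open>A cusp is a singular point whose two tangent lines coincide, with common slope \<open>\<alpha>\<close> below.
  The ground field is infinite, so that the identity of functions is one of polynomials.\<close>

definition has_cusp :: "'a::alg_closed_field weierstrass \<Rightarrow> bool" where
  "has_cusp W \<longleftrightarrow> (\<exists>x0 y0. singular_point W x0 y0 \<and>
     (\<exists>\<alpha>. \<forall>x y. weierstrass_eqn W x y = ((y - y0) - \<alpha> * (x - x0)) ^ 2 - (x - x0) ^ 3))"

definition additive_reduction :: "q2 weierstrass \<Rightarrow> bool" where
  "additive_reduction E \<longleftrightarrow>
     (\<exists>M. minimal_model E M \<and> has_cusp (map_weierstrass (to_ac \<circ> reduction2) M))"

datatype 'a point = Infinity | Affine 'a 'a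

definition curve_points :: "'a::field weierstrass \<Rightarrow> 'a point set" where
  "curve_points W = insert Infinity {Affine x y |x y. weierstrass_eqn W x y = 0}"

fun point_add :: "'a::field weierstrass \<Rightarrow> 'a point \<Rightarrow> 'a point \<Rightarrow> 'a point" where
  "point_add W Infinity Q = Q"
| "point_add W P Infinity = P"
| "point_add W (Affine x1 y1) (Affine x2 y2) =
     (if x1 = x2 \<and> y1 + y2 + coeff_a1 W * x2 + coeff_a3 W = 0 then Infinity
      else
        let l = (if x1 = x2
                 then (3 * x1 ^ 2 + 2 * coeff_a2 W * x1 + coeff_a4 W - coeff_a1 W * y1)
                      / (2 * y1 + coeff_a1 W * x1 + coeff_a3 W)
                 else (y2 - y1) / (x2 - x1));
            n = y1 - l * x1;
            x3 = l ^ 2 + coeff_a1 W * l - coeff_a2 W - x1 - x2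
        in Affine x3 (- (l + coeff_a1 W) * x3 - n - coeff_a3 W))"

definition two_torsion :: "'a::field weierstrass \<Rightarrow> 'a point set" where
  "two_torsion W = {P \<in> curve_points W. point_add W P P = Infinity}"

definition two_torsion_field :: "q2 weierstrass \<Rightarrow> q2bar set" where
  "two_torsion_field E = adjoin Q2 (\<Union>P \<in> two_torsion (map_weierstrass to_ac E). set_point P)"

end

theory Submission
  imports Defs
begin

text \<open>
  The abscissae of the 2-torsion points generate the same field as the roots of
  \<open>Z ^ 3 = 3 * c4 * Z + 2 * c6\<close>, whose discriminant is a square multiple of \<open>\<Delta>\<close>. If its Newton polygon
  is broken, the cubic has a rational root and \<open>L = \<rat>\<^sub>2(\<surd>\<Delta>)\<close>, so that \<open>L\<close> is read off from the
  square class of \<open>\<Delta>\<close>. If it is straight, that is if \<open>3 v(c4) \<ge> 8 + v(\<Delta>)\<close>, then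
  \<open>c4 ^ 3 - c6\<^sup>2 = 1728 * \<Delta>\<close> forces \<open>v(\<Delta>)\<close> to be even and the odd part of \<open>\<Delta>\<close> to be \<open>1\<close> modulo \<open>4\<close>;
  minimality and additive reduction leave \<open>4 \<le> v(\<Delta>) \<le> 14\<close>. For \<open>v(\<Delta>) \<in> {4, 10}\<close> a rescaling has
  unit discriminant, so \<open>L\<close> is unramified; otherwise Cardano's formula has rational square root,
  and \<open>L\<close> is generated by a cube root of \<open>-2\<close> and the cube roots of unity.

  The valuation of the algebraic closure comes from a maximal subring not containing \<open>1/2\<close>
  (Chevalley) and is unique because \<open>\<rat>\<^sub>2\<close> is complete. Each ramified extension that occurs is
  generated by an explicit uniformizer over an unramified one, which gives its ramification index
  and its breaks.
\<close>

subsection \<open>The ring of 2-adic integers\<close>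

text \<open>The Newton polygon has the points \<open>(0, 1 + v(c6))\<close>,
  \<open>(1, v(c4))\<close>, \<open>(3, 0)\<close>. Since \<open>1728 = 2 ^ 6 * 27\<close>, a
  straight polygon forces \<open>2 v(c6) = 6 + v(\<Delta>)\<close>, and the middle point lies on or
  above the segment when \<open>3 v(c4) \<ge> 2 + 2 v(c6) = 8 + v(\<Delta>)\<close>. The roots then
  have valuation \<open>(8 + v(\<Delta>)) / 6\<close>, which for even \<open>v(\<Delta>)\<close>
  from 4 to 14 is an integer only at 4 and 10; this singles out these two values. The obstacle is
  that \<open>normalized_val\<close> and \<open>ram_index\<close> are definite descriptions
  involving valuations of the whole algebraic closure, so nothing can be computed before existence
  and uniqueness of the prolongation. Afterwards one unnormalised valuation \<open>val2bar\<close>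
  serves all fields, and a field enters through the denominator of its value group. Uniqueness also
  makes embeddings isometries. The field \<open>F\<close> is known only by its maximality: if
  \<open>L\<close> is some \<open>L_i\<close>, then \<open>F \<subseteq> L\<close> suffices; if
  \<open>L\<close> is unramified, maximality gives \<open>L = F\<close>; only the tame case has to
  determine \<open>F\<close>.\<close>

lemma residue_seq_bounds: "0 \<le> residue_seq x n" "residue_seq x n < 2 ^ n"
  using residue_seq[of x] by auto

lemma residue_seq_mod [simp]: "residue_seq x (n + k) mod 2 ^ n = residue_seq x n"
  using zadic2_compat[of "residue_seq x" n k] residue_seq[of x] by blast

lemma residue_seq_eqI: "(\<And>n. residue_seq x n = residue_seq y n) \<Longrightarrow> x = y"
  by (simp add: residue_seq_inject[symmetric] fun_eq_iff)

lemmas residue_seq_simps =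
  zero_zadic2.rep_eq one_zadic2.rep_eq plus_zadic2.rep_eq uminus_zadic2.rep_eq
  minus_zadic2.rep_eq times_zadic2.rep_eq

lemma residue_seq_of_nat: "residue_seq (of_nat k) n = int k mod 2 ^ n"
  by (induction k) (simp_all add: residue_seq_simps mod_simps)

lemma residue_seq_of_int: "residue_seq (of_int k) n = k mod 2 ^ n"
  by (cases k) (simp_all add: residue_seq_simps residue_seq_of_nat mod_simps)

lemma residue_seq_power2: "residue_seq (2 ^ m) n = 2 ^ m mod 2 ^ n"
  using residue_seq_of_int[of "2 ^ m" n] by simp

text \<open>Characteristic zero passes to the fraction field, where the short Weierstrass model
  divides by 48 and 864. The level \<open>m + n\<close> separates the two numbers because
  \<open>k < 2 ^ k\<close>.\<close>

instance zadic2 :: ring_char_0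
proof
  show "inj (of_nat :: nat \<Rightarrow> zadic2)"
  proof (rule injI)
    fix m n :: nat
    assume eq: "(of_nat m :: zadic2) = of_nat n"
    have "int m < 2 ^ (m + n)" "int n < 2 ^ (m + n)"
      using of_nat_less_two_power[of "m + n", where 'a = int] by (linarith, linarith)
    moreover have "int m mod 2 ^ (m + n) = int n mod 2 ^ (m + n)"
      using arg_cong[OF eq, of "\<lambda>x. residue_seq x (m + n)"] by (simp add: residue_seq_of_nat)
    ultimately show "m = n" by simp
  qed
qed

text \<open>The bridge from the inverse limit to arithmetic: divisibility is decided at a single
  level.\<close>

lemma power2_dvd_zadic2_iff: "2 ^ n dvd x \<longleftrightarrow> residue_seq x n = 0"
proof
  assume "2 ^ n dvd x"
  then show "residue_seq x n = 0"
    by (auto simp: residue_seq_simps residue_seq_power2 elim!: dvdE)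
next
  assume x0: "residue_seq x n = 0"
  \<comment> \<open>The quotient is read \<open>n\<close> levels higher: \<open>x\<close> modulo
    \<open>2 ^ (n + k)\<close> determines \<open>x / 2 ^ n\<close> modulo
    \<open>2 ^ k\<close>.\<close>
  define f where "f k = residue_seq x (n + k) div 2 ^ n" for k
  have f: "\<forall>k. f k \<in> {0..<2 ^ k} \<and> f (Suc k) mod 2 ^ k = f k"
  proof (intro allI conjI)
    fix k
    have "f k * 2 ^ n \<le> residue_seq x (n + k)"
      by (simp add: f_def minus_mod_eq_div_mult [symmetric] residue_seq_bounds)
    also have "\<dots> < 2 ^ k * 2 ^ n"
      using residue_seq_bounds(2)[of x "n + k"] by (simp add: power_add mult.commute)
    finally have "f k < 2 ^ k" by simp
    then show "f k \<in> {0..<2 ^ k}"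
      by (simp add: f_def residue_seq_bounds pos_imp_zdiv_nonneg_iff)
    have "residue_seq x (n + k) = residue_seq x (n + k + 1) mod (2 ^ n * 2 ^ k)"
      using residue_seq_mod[of x "n + k" 1] by (simp add: power_add)
    then show "f (Suc k) mod 2 ^ k = f k"
      by (simp add: f_def zmod_zmult2_eq)
  qed
  have "x = 2 ^ n * Abs_zadic2 f"
  proof (rule residue_seq_eqI)
    fix k
    have "2 ^ n dvd residue_seq x (n + k)" using x0 by (simp add: dvd_eq_mod_eq_0)
    then have "2 ^ n * f k = residue_seq x (n + k)" by (simp add: f_def)
    moreover have "residue_seq x (n + k) mod 2 ^ k = residue_seq x k"
      using residue_seq_mod[of x k n] by (simp add: add.commute)
    ultimately show "residue_seq x k = residue_seq (2 ^ n * Abs_zadic2 f) k"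
      using f by (simp add: residue_seq_simps residue_seq_power2 Abs_zadic2_inverse mod_mult_left_eq)
  qed
  then show "2 ^ n dvd x" by simp
qed

lemma zadic2_eq_0I:
  assumes "\<And>n. 2 ^ n dvd (x :: zadic2)"
  shows "x = 0"
  using assms by (intro residue_seq_eqI) (simp add: power2_dvd_zadic2_iff residue_seq_simps)

text \<open>The limit is the diagonal: from index \<open>n\<close> on all terms agree modulo
  \<open>2 ^ n\<close>, so level \<open>n\<close> may be taken from \<open>s n\<close>.\<close>

lemma zadic2_complete:
  fixes s :: "nat \<Rightarrow> zadic2"
  assumes "\<And>n. 2 ^ n dvd s (Suc n) - s n"
  obtains x where "\<And>n. 2 ^ n dvd x - s n"
proof -
  define f where "f n = residue_seq (s n) n" for n
  have step: "residue_seq (s (Suc n)) n = residue_seq (s n) n" for n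
  proof -
    have "(residue_seq (s (Suc n)) n - residue_seq (s n) n) mod 2 ^ n = 0"
      using assms[of n] by (simp add: power2_dvd_zadic2_iff residue_seq_simps)
    then show ?thesis
      by (metis mod_eq_dvd_iff mod_eq_0_iff_dvd mod_pos_pos_trivial residue_seq_bounds)
  qed
  have f: "\<forall>n. f n \<in> {0..<2 ^ n} \<and> f (Suc n) mod 2 ^ n = f n"
    using residue_seq_mod[of "s (Suc n)" n 1 for n] step by (simp add: f_def residue_seq_bounds)
  show ?thesis
    by (rule that[of "Abs_zadic2 f"])
      (use f in \<open>simp add: power2_dvd_zadic2_iff residue_seq_simps Abs_zadic2_inverse, simp add: f_def\<close>)
qed

text \<open>Stands in for Hensel's lemma. Inverses, square roots, cube roots and roots of cubics are
  all obtained by rewriting the equation as \<open>F x = x\<close> with \<open>F\<close> gaining a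
  factor 2 on differences; the iterates of 0 converge to a solution.\<close>

lemma zadic2_contraction_fixpoint:
  fixes F :: "zadic2 \<Rightarrow> zadic2"
  assumes F: "\<And>x y n. 2 ^ n dvd x - y \<Longrightarrow> 2 ^ Suc n dvd F x - F y"
  obtains x where "F x = x"
proof -
  define s where "s n = (F ^^ n) 0" for n
  have s: "2 ^ n dvd s (Suc n) - s n" for n
  proof (induction n)
    case (Suc n)
    then show ?case using F[OF Suc] by (simp add: s_def)
  qed simp
  then obtain x where x: "\<And>n. 2 ^ n dvd x - s n" using zadic2_complete by blast
  have "F x - x = 0"
  proof (rule zadic2_eq_0I)
    fix n
    have "2 ^ Suc n dvd F x - s (Suc n)" using F[OF x[of n]] by (simp add: s_def)
    moreover have "2 ^ Suc n dvd x - s (Suc n)" by (rule x)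
    ultimately have "2 ^ Suc n dvd (F x - s (Suc n)) - (x - s (Suc n))" by (rule dvd_diff)
    then have "2 ^ Suc n dvd F x - x" by (simp del: power_Suc)
    then show "2 ^ n dvd F x - x" by (rule dvd_trans[rotated]) simp
  qed
  then show ?thesis using that by simp
qed

lemma zadic2_parity: "2 dvd x \<or> 2 dvd x - (1 :: zadic2)"
proof -
  have "residue_seq x 1 = 0 \<or> residue_seq x 1 = 1"
    using residue_seq_bounds[of x 1] by auto
  then show ?thesis
    using power2_dvd_zadic2_iff[of 1 x] power2_dvd_zadic2_iff[of 1 "x - 1"]
    by (auto simp: residue_seq_simps)
qed

lemma zadic2_not_2_dvd_1: "\<not> 2 dvd (1 :: zadic2)"
  using power2_dvd_zadic2_iff[of 1 1] by (simp add: residue_seq_simps)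

text \<open>Locality of the ring: for \<open>u = 1 + 2 k\<close> the inverse solves
  \<open>y = 1 - 2 k y\<close>.\<close>

lemma zadic2_unit_iff: "u dvd 1 \<longleftrightarrow> \<not> 2 dvd (u :: zadic2)"
proof
  assume "u dvd 1"
  then show "\<not> 2 dvd u" using zadic2_not_2_dvd_1 dvd_trans by blast
next
  assume "\<not> 2 dvd u"
  then obtain k where k: "u - 1 = 2 * k" using zadic2_parity[of u] by (auto elim: dvdE)
  obtain y where "1 - 2 * k * y = y"
  proof (rule zadic2_contraction_fixpoint[of "\<lambda>y. 1 - 2 * k * y"])
    fix x y :: zadic2 and n
    assume "2 ^ n dvd x - y"
    then have "2 * 2 ^ n dvd 2 * (x - y)" by (rule mult_dvd_mono[OF dvd_refl])
    then have "2 ^ Suc n dvd 2 * (x - y) * (- k)" by simp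
    then show "2 ^ Suc n dvd 1 - 2 * k * x - (1 - 2 * k * y)" by (simp add: algebra_simps)
  qed
  then have "u * y = 1" using k by (auto simp: algebra_simps)
  then show "u dvd 1" by (metis dvd_triv_left)
qed

lemma zadic2_decompose:
  assumes "(x :: zadic2) \<noteq> 0"
  obtains n u where "u dvd 1" "x = 2 ^ n * u"
proof -
  obtain m where m: "\<not> 2 ^ m dvd x" using assms zadic2_eq_0I by blast
  define n where "n = (LEAST m. \<not> 2 ^ Suc m dvd x)"
  have "m \<noteq> 0" using m by (cases m) auto
  then have ex: "\<not> 2 ^ Suc (m - 1) dvd x" using m by simp
  have n: "\<not> 2 ^ Suc n dvd x" unfolding n_def by (rule LeastI[of _ "m - 1"]) (rule ex)
  have "2 ^ n dvd x"
  proof (cases n)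
    case (Suc k)
    then show ?thesis using not_less_Least[of k "\<lambda>m. \<not> 2 ^ Suc m dvd x"] n_def by auto
  qed simp
  then obtain u where u: "x = 2 ^ n * u" by (auto elim: dvdE)
  then have "u dvd 1" using n by (auto simp: zadic2_unit_iff)
  then show ?thesis using u that by blast
qed

subsection \<open>The 2-adic valuation\<close>

instance fract :: ("{idom, ring_char_0}") ring_char_0
proof
  show "inj (of_nat :: nat \<Rightarrow> 'a fract)"
    by (rule injI) (simp add: of_nat_fract eq_fract)
qed

instance fract :: ("{idom, ring_char_0}") field_char_0 ..

lemma to_fract_of_nat: "to_fract (of_nat n) = of_nat n"
  by (induction n) simp_all

lemma to_fract_of_int: "to_fract (of_int n) = of_int n"
  by (cases n) (simp_all add: to_fract_of_nat)

lemma to_fract_numeral [simp]: "to_fract (numeral n) = numeral n"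
  using to_fract_of_nat[of "numeral n"] by simp

lemma to_fract_power [simp]: "to_fract (x ^ n) = to_fract x ^ n"
  by (induction n) simp_all

lemma zadic2_unit_not_0: "u dvd (1 :: zadic2) \<Longrightarrow> u \<noteq> 0"
  by (auto simp: zadic2_unit_iff)

lemma zadic2_unit_mult: "u dvd 1 \<Longrightarrow> v dvd 1 \<Longrightarrow> u * v dvd (1 :: zadic2)"
  using mult_dvd_mono[of u 1 v 1] by simp

lemma unit_to_fract_inverse:
  assumes "u dvd (1 :: zadic2)"
  obtains u' where "u' dvd 1" "inverse (to_fract u) = to_fract u'"
proof -
  obtain u' where u': "1 = u * u'" using assms by (auto elim: dvdE)
  then have "to_fract u * to_fract u' = 1" by (metis to_fract_1 to_fract_mult)
  then have "inverse (to_fract u) = to_fract u'" by (rule inverse_unique)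
  moreover have "u' dvd 1" using u' by (metis dvd_triv_right)
  ultimately show ?thesis using that by blast
qed

lemma q2_decompose:
  assumes "(x :: q2) \<noteq> 0"
  obtains k u where "u dvd 1" "x = 2 powi k * to_fract u"
proof -
  obtain a b where ab: "x = to_fract a / to_fract b" "b \<noteq> 0"
    by (metis Fract_cases Fract_conv_to_fract)
  then have "a \<noteq> 0" using assms by auto
  obtain m u where a: "u dvd 1" "a = 2 ^ m * u" using zadic2_decompose[OF \<open>a \<noteq> 0\<close>] .
  obtain n v where b: "v dvd 1" "b = 2 ^ n * v" using zadic2_decompose[OF \<open>b \<noteq> 0\<close>] .
  obtain v' where v': "v' dvd 1" "inverse (to_fract v) = to_fract v'"
    using unit_to_fract_inverse[OF b(1)] .
  have "x = 2 ^ m / 2 ^ n * (to_fract u * inverse (to_fract v))"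
    by (simp add: ab a b field_simps)
  also have "(2 :: q2) ^ m / 2 ^ n = 2 powi (int m - int n)"
    by (simp add: power_int_diff)
  finally have "x = 2 powi (int m - int n) * to_fract (u * v')" by (simp add: v')
  moreover have "u * v' dvd 1" using a(1) v'(1) by (rule zadic2_unit_mult)
  ultimately show ?thesis using that by blast
qed

lemma powi_unit_unique:
  assumes "u dvd (1 :: zadic2)" "v dvd 1" "2 powi k * to_fract u = 2 powi l * to_fract v"
  shows "k = l"
proof -
  have *: "l \<le> k" if "u dvd (1 :: zadic2)" "v dvd 1" "2 powi k * to_fract u = 2 powi l * to_fract v"
    for u v k l
  proof (rule ccontr)
    assume "\<not> l \<le> k"
    then obtain n where n: "l = k + int (Suc n)"
      by (metis add.commute add_Suc_right not_le zless_iff_Suc_zadd)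
    have "to_fract u = 2 ^ Suc n * to_fract v"
      using that(3) by (simp add: n power_int_add del: of_nat_Suc)
    also have "\<dots> = to_fract (2 ^ Suc n * v)" by simp
    finally have "u = 2 ^ Suc n * v" by (simp only: to_fract_eq_iff)
    then show False using that(1) by (simp add: zadic2_unit_iff)
  qed
  show ?thesis using *[OF assms] *[OF assms(2,1) assms(3)[symmetric]] by simp
qed

lemma ord2_eqI:
  assumes "u dvd 1" "x = 2 powi k * to_fract u"
  shows "ord2 x = k"
  unfolding ord2_def using assms powi_unit_unique by (intro the_equality) blast+

lemma q2_ord2:
  assumes "x \<noteq> 0"
  obtains u where "u dvd 1" "x = 2 powi ord2 x * to_fract u"
  using q2_decompose[OF assms] ord2_eqI by metis

lemma val2_eqI:
  assumes "u dvd 1" "x = 2 powi k * to_fract u"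
  shows "val2 x = ereal (of_int k)"
  using ord2_eqI[OF assms] assms by (auto simp: val2_def zadic2_unit_iff)

lemma val2_0 [simp]: "val2 0 = \<infinity>" by (simp add: val2_def)

text \<open>The form in which valuations are used: an inequality becomes a factorisation over the
  integers, uniformly in \<open>x\<close>, including \<open>x = 0\<close>, where \<open>ord2\<close>
  is unspecified.\<close>

lemma val2_ge_iff: "val2 x \<ge> ereal (of_int k) \<longleftrightarrow> (\<exists>z. x = 2 powi k * to_fract z)"
proof (cases "x = 0")
  case True
  then show ?thesis by (auto intro: exI[of _ 0])
next
  case False
  obtain u where u: "u dvd 1" "x = 2 powi ord2 x * to_fract u" using q2_ord2[OF False] .
  show ?thesis
  proof
    assume "val2 x \<ge> ereal (of_int k)"
    then have "k \<le> ord2 x" using False by (simp add: val2_def)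
    then obtain n where n: "ord2 x = k + int n" by (metis zle_iff_zadd)
    have "x = 2 powi (k + int n) * to_fract u" using u(2) unfolding n .
    also have "\<dots> = 2 powi k * to_fract (2 ^ n * u)" by (simp add: power_int_add)
    finally show "\<exists>z. x = 2 powi k * to_fract z" by blast
  next
    assume "\<exists>z. x = 2 powi k * to_fract z"
    then obtain z where z: "x = 2 powi k * to_fract z" by blast
    then have "z \<noteq> 0" using False by auto
    then obtain n v where "v dvd 1" "z = 2 ^ n * v" by (rule zadic2_decompose)
    then have "v dvd 1" "x = 2 powi (k + int n) * to_fract v"
      by (auto simp: z power_int_add)
    from val2_eqI[OF this] show "val2 x \<ge> ereal (of_int k)" by simp
  qed
qed

lemma val2_nonneg_iff: "val2 x \<ge> 0 \<longleftrightarrow> integral2 x"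
  using val2_ge_iff[of 0 x] by (auto simp: integral2_def zero_ereal_def)

lemma val2_to_fract_nonneg [simp]: "val2 (to_fract x) \<ge> 0"
  by (simp add: val2_nonneg_iff integral2_def)

lemma val2_to_fract_ge_iff: "val2 (to_fract x) \<ge> ereal (real n) \<longleftrightarrow> 2 ^ n dvd x"
proof -
  have "val2 (to_fract x) \<ge> ereal (real n) \<longleftrightarrow> (\<exists>z. to_fract x = to_fract (2 ^ n * z))"
    using val2_ge_iff[of "int n" "to_fract x"] by simp
  then show ?thesis by (simp only: to_fract_eq_iff dvd_def)
qed

lemma val2_mult: "val2 (x * y) = val2 x + val2 y"
proof (cases "x = 0 \<or> y = 0")
  case False
  then have nz: "x \<noteq> 0" "y \<noteq> 0" by auto
  obtain u where u: "u dvd 1" "x = 2 powi ord2 x * to_fract u" using q2_ord2[OF nz(1)] .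
  obtain v where v: "v dvd 1" "y = 2 powi ord2 y * to_fract v" using q2_ord2[OF nz(2)] .
  have "u * v dvd 1" using u(1) v(1) by (rule zadic2_unit_mult)
  moreover have "x * y = 2 powi (ord2 x + ord2 y) * to_fract (u * v)"
    by (subst u(2), subst v(2)) (simp only: power_int_add to_fract_mult mult_ac zero_neq_numeral[symmetric] simp_thms)
  ultimately have "val2 (x * y) = ereal (of_int (ord2 x + ord2 y))" by (rule val2_eqI)
  then show ?thesis using nz by (simp add: val2_def)
qed (auto simp: val2_def)

lemma val2_valuation: "is_valuation val2"
  unfolding is_valuation_def
proof (intro conjI allI)
  fix x y :: q2
  show "val2 x \<noteq> - \<infinity>" "val2 x = \<infinity> \<longleftrightarrow> x = 0" by (auto simp: val2_def)
  show "val2 (x * y) = val2 x + val2 y" by (rule val2_mult)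
  show "min (val2 x) (val2 y) \<le> val2 (x + y)"
  proof (cases "x = 0 \<or> y = 0")
    case False
    define k where "k = min (ord2 x) (ord2 y)"
    have m: "min (val2 x) (val2 y) = ereal (of_int k)" using False by (simp add: val2_def k_def min_def)
    have "val2 x \<ge> ereal (of_int k)" "val2 y \<ge> ereal (of_int k)" using m by (auto simp: min_def split: if_splits)
    then obtain a b where "x = 2 powi k * to_fract a" "y = 2 powi k * to_fract b"
      unfolding val2_ge_iff by blast
    then have "x + y = 2 powi k * to_fract (a + b)" by (simp add: algebra_simps)
    then show ?thesis unfolding m val2_ge_iff by blast
  qed auto
qed

lemma val2_unit_iff: "val2 (to_fract u) = 0 \<longleftrightarrow> u dvd 1"
proof
  assume "u dvd 1"
  then show "val2 (to_fract u) = 0" using val2_eqI[of u _ 0] by simp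
next
  assume "val2 (to_fract u) = 0"
  then have "\<not> val2 (to_fract u) \<ge> ereal (real 1)" by simp
  then show "u dvd 1" using val2_to_fract_ge_iff[of 1 u] by (simp add: zadic2_unit_iff)
qed

subsection \<open>Prolongation of valuations\<close>

text \<open>A notion for sets inside a type-class ring, so that ordinary arithmetic applies. The
  link with the carrier-based \<open>subring\<close> and \<open>subfield\<close> is made for
  \<open>Q2bar\<close> further on.\<close>

definition is_subring :: "'a::comm_ring_1 set \<Rightarrow> bool" where
  "is_subring S \<longleftrightarrow> 1 \<in> S \<and> (\<forall>x\<in>S. \<forall>y\<in>S. x - y \<in> S \<and> x * y \<in> S)"

context
  fixes S :: "'a::comm_ring_1 set"
  assumes S: "is_subring S"
begin

lemma subring_1: "1 \<in> S" and subring_diff: "x \<in> S \<Longrightarrow> y \<in> S \<Longrightarrow> x - y \<in> S"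
  and subring_mult: "x \<in> S \<Longrightarrow> y \<in> S \<Longrightarrow> x * y \<in> S"
  using S by (auto simp: is_subring_def)

lemma subring_0: "0 \<in> S"
  using subring_diff[OF subring_1 subring_1] by simp

lemma subring_uminus: "x \<in> S \<Longrightarrow> - x \<in> S"
  using subring_diff[OF subring_0] by simp

lemma subring_add: "x \<in> S \<Longrightarrow> y \<in> S \<Longrightarrow> x + y \<in> S"
  using subring_diff[OF _ subring_uminus] by fastforce

lemma subring_power: "x \<in> S \<Longrightarrow> x ^ n \<in> S"
  by (induction n) (auto intro: subring_1 subring_mult)

lemma subring_sum: "(\<And>i. i \<in> I \<Longrightarrow> f i \<in> S) \<Longrightarrow> sum f I \<in> S"
  by (induction I rule: infinite_finite_induct) (auto intro: subring_0 subring_add)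

lemma subring_of_nat: "of_nat n \<in> S"
  by (induction n) (auto intro: subring_0 subring_1 subring_add)

lemma subring_numeral: "numeral n \<in> S"
  using subring_of_nat[of "numeral n"] by simp

end

lemmas subring_closed = subring_0 subring_1 subring_add subring_diff subring_uminus subring_mult
  subring_power subring_sum subring_of_nat subring_numeral

section \<open>Polynomials over a subring and the ring generated by one element\<close>

definition polys_over :: "'a::comm_ring_1 set \<Rightarrow> 'a poly set" where
  "polys_over S = {p. \<forall>i. Polynomial.coeff p i \<in> S}"

lemma polys_over_subring:
  assumes "is_subring S"
  shows "is_subring (polys_over S)"
  unfolding is_subring_def polys_over_def
  using assms by (auto simp: coeff_mult intro!: subring_closed)

lemma monom_in_polys_over: "is_subring S \<Longrightarrow> c \<in> S \<Longrightarrow> Polynomial.monom c n \<in> polys_over S"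
  by (auto simp: polys_over_def subring_0)

lemma pCons_in_polys_over: "c \<in> S \<Longrightarrow> p \<in> polys_over S \<Longrightarrow> pCons c p \<in> polys_over S"
  by (auto simp: polys_over_def coeff_pCons split: nat.splits)

lemma zero_in_polys_over: "is_subring S \<Longrightarrow> 0 \<in> polys_over S"
  by (auto simp: polys_over_def subring_0)

text \<open>The ring \<open>S[x]\<close>. For \<open>S\<close> containing \<open>Q2\<close> it is
  already a field, by \<open>inverse_in_subring\<close>.\<close>

definition adjoin_elem :: "'a::comm_ring_1 set \<Rightarrow> 'a \<Rightarrow> 'a set" where
  "adjoin_elem S x = (\<lambda>p. poly p x) ` polys_over S"

lemma adjoin_elem_subring:
  assumes "is_subring S"
  shows "is_subring (adjoin_elem S x)"
proof -
  note P = polys_over_subring[OF assms]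
  have "poly 1 x \<in> adjoin_elem S x" unfolding adjoin_elem_def using subring_1[OF P] by blast
  moreover have "poly p x - poly q x \<in> adjoin_elem S x \<and> poly p x * poly q x \<in> adjoin_elem S x"
    if "p \<in> polys_over S" "q \<in> polys_over S" for p q
    using subring_diff[OF P that] subring_mult[OF P that]
    unfolding adjoin_elem_def by (metis image_eqI poly_diff poly_mult)
  ultimately show ?thesis unfolding is_subring_def adjoin_elem_def by auto
qed

lemma adjoin_elem_base:
  assumes "is_subring S"
  shows "S \<subseteq> adjoin_elem S x"
proof
  fix c assume "c \<in> S"
  then have "poly [:c:] x \<in> adjoin_elem S x"
    unfolding adjoin_elem_def using assms by (intro imageI pCons_in_polys_over zero_in_polys_over)
  then show "c \<in> adjoin_elem S x" by simp
qed

lemma adjoin_elem_self: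
  assumes "is_subring S"
  shows "x \<in> adjoin_elem S x"
proof -
  have "poly [:0, 1:] x \<in> adjoin_elem S x"
    unfolding adjoin_elem_def using assms
    by (intro imageI pCons_in_polys_over zero_in_polys_over subring_0 subring_1)
  then show ?thesis by simp
qed

lemma adjoin_elem_least:
  assumes "is_subring T" "S \<subseteq> T" "x \<in> T"
  shows "adjoin_elem S x \<subseteq> T"
  using assms by (auto simp: adjoin_elem_def polys_over_def poly_altdef intro!: subring_closed)

text \<open>Chevalley's extension theorem: a subring that is maximal among those not containing \<open>1/a\<close>
  is a valuation ring.\<close>

locale max_subring_avoiding_inverse =
  fixes V :: "'a::field set" and a :: 'a
  assumes V: "is_subring V" and a: "a \<in> V" and inv_a: "inverse a \<notin> V"
    and maximal: "\<And>T. is_subring T \<Longrightarrow> V \<subseteq> T \<Longrightarrow> inverse a \<notin> T \<Longrightarrow> T = V"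
begin

lemma a_nonzero: "a \<noteq> 0"
  using inv_a subring_0[OF V] by auto

text \<open>Localise at \<open>s = 1 + a r\<close>. Since \<open>s ^ n = 1 + a t\<close> with
  \<open>t\<close> in \<open>V\<close>, having \<open>1/a\<close> in \<open>V[1/s]\<close> would put
  \<open>1/a\<close> in \<open>V\<close>; so maximality gives \<open>V[1/s] = V\<close>. In other
  words, \<open>a\<close> lies in the Jacobson radical of \<open>V\<close>.\<close>

lemma one_plus_inverse:
  assumes r: "r \<in> V"
  shows "1 + a * r \<noteq> 0" "inverse (1 + a * r) \<in> V"
proof -
  let ?s = "1 + a * r"
  show s0: "?s \<noteq> 0"
  proof
    assume "?s = 0"
    then have "inverse a = - r" using a_nonzero by (auto simp: field_simps eq_neg_iff_add_eq_0 add.commute)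
    then show False using inv_a subring_uminus[OF V r] by simp
  qed
  have sV: "?s \<in> V" using V a r by (intro subring_closed)
  define T where "T = {x. \<exists>n. x * ?s ^ n \<in> V}"
  have "is_subring T"
    unfolding is_subring_def
  proof (intro conjI ballI)
    have "1 * ?s ^ 0 \<in> V" using subring_1[OF V] by simp
    then show "1 \<in> T" unfolding T_def by blast
    fix x y assume "x \<in> T" "y \<in> T"
    then obtain m n where mn: "x * ?s ^ m \<in> V" "y * ?s ^ n \<in> V" unfolding T_def by blast
    have "(x - y) * ?s ^ (m + n) = x * ?s ^ m * ?s ^ n - y * ?s ^ n * ?s ^ m"
      by (simp add: power_add algebra_simps)
    moreover have "x * y * ?s ^ (m + n) = x * ?s ^ m * (y * ?s ^ n)"
      by (simp add: power_add)
    ultimately have "(x - y) * ?s ^ (m + n) \<in> V" "x * y * ?s ^ (m + n) \<in> V"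
      using V mn sV by (auto simp only: intro!: subring_closed)
    then show "x - y \<in> T" "x * y \<in> T" unfolding T_def by blast+
  qed
  moreover have "V \<subseteq> T"
    unfolding T_def by (auto intro!: exI[of _ 0])
  moreover have "inverse a \<notin> T"
  proof
    assume "inverse a \<in> T"
    then obtain n where n: "inverse a * ?s ^ n \<in> V" unfolding T_def by blast
    have "\<exists>t\<in>V. ?s ^ n = 1 + a * t"
    proof (induction n)
      case (Suc n)
      then obtain t where t: "t \<in> V" "?s ^ n = 1 + a * t" by blast
      then have "?s ^ Suc n = 1 + a * (r + t + a * r * t)" by (simp add: algebra_simps)
      moreover have "r + t + a * r * t \<in> V" using V a r t(1) by (intro subring_closed)
      ultimately show ?case by blast
    qed (auto intro: bexI[of _ 0] subring_0[OF V])
    then obtain t where t: "t \<in> V" "?s ^ n = 1 + a * t" by blast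
    then have "inverse a = inverse a * ?s ^ n - t" using a_nonzero by (simp add: field_simps)
    then show False using inv_a V n t(1) by (metis subring_diff)
  qed
  ultimately have "T = V" by (rule maximal)
  moreover have "inverse ?s * ?s ^ 1 \<in> V" using s0 subring_1[OF V] by simp
  ultimately show "inverse ?s \<in> V" unfolding T_def by blast
qed

text \<open>A witness for \<open>1/a\<close> in \<open>V[x]\<close> together with a degree bound, on
  which the descent runs.\<close>

definition rep_degree :: "'a \<Rightarrow> nat \<Rightarrow> bool" where
  "rep_degree x n \<longleftrightarrow> (\<exists>p\<in>polys_over V. Polynomial.degree p \<le> n \<and> a * poly p x = 1)"

lemma rep_degree_exists:
  assumes "x \<notin> V"
  shows "\<exists>n. rep_degree x n"
proof -
  have "adjoin_elem V x \<noteq> V" using adjoin_elem_self[OF V, of x] assms by auto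
  then have "inverse a \<in> adjoin_elem V x"
    using maximal[OF adjoin_elem_subring[OF V] adjoin_elem_base[OF V]] by blast
  then obtain p where "p \<in> polys_over V" "poly p x = inverse a" unfolding adjoin_elem_def by auto
  then show ?thesis unfolding rep_degree_def using a_nonzero by force
qed

lemma rep_degree_0: "\<not> rep_degree x 0"
proof
  assume "rep_degree x 0"
  then obtain c where "[:c:] \<in> polys_over V" "a * c = 1"
    unfolding rep_degree_def by (metis degree_eq_zeroE le_zero_eq poly_const_conv)
  then have "inverse a = c" "Polynomial.coeff [:c:] 0 \<in> V"
    unfolding polys_over_def by (simp_all only: inverse_unique mem_Collect_eq)
  then show False using inv_a by simp
qed

text \<open>The relation for \<open>1/x\<close> rewrites the top term of the relation for \<open>x\<close> in lower degree.\<close>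

lemma rep_degree_reduce:
  assumes x: "x \<noteq> 0" and n: "rep_degree x (Suc n)" and m: "rep_degree (inverse x) m" and "m \<le> Suc n"
  shows "rep_degree x n"
proof -
  obtain p where p: "p \<in> polys_over V" "Polynomial.degree p \<le> Suc n" "a * poly p x = 1"
    using n unfolding rep_degree_def by blast
  obtain q where q: "q \<in> polys_over V" "Polynomial.degree q \<le> m" "a * poly q (inverse x) = 1"
    using m unfolding rep_degree_def by blast
  \<comment> \<open>Moving the constant term of the relation for \<open>1/x\<close> to the left
    gives a unit \<open>u = 1 - a q_0\<close> with
    \<open>u = a * (q_1 / x + ... + q_m / x ^ m)\<close>.\<close>
  define u where "u = 1 + a * (- Polynomial.coeff q 0)"
  have cV: "Polynomial.coeff p i \<in> V" "Polynomial.coeff q i \<in> V" for i using p q by (auto simp: polys_over_def)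
  have u: "u \<noteq> 0" "inverse u \<in> V"
    unfolding u_def using one_plus_inverse subring_uminus[OF V cV(2)] by blast+
  \<comment> \<open>Multiplying by \<open>x ^ (n + 1) / u\<close> turns this into
    \<open>x ^ (n + 1) = a * r(x)\<close> with \<open>r\<close> of degree at most \<open>n\<close>;
    \<open>m \<le> Suc n\<close> keeps the exponents nonnegative.\<close>
  define r where "r = (\<Sum>j\<in>{1..m}. Polynomial.monom (Polynomial.coeff q j * inverse u) (Suc n - j))"
  define c where "c = Polynomial.coeff p (Suc n)"
  have "poly q (inverse x) = (\<Sum>j\<le>m. Polynomial.coeff q j * inverse x ^ j)"
    using arg_cong[OF poly_as_sum_of_monoms'[OF q(2)], of "\<lambda>q. poly q (inverse x)"]
    by (simp add: poly_sum poly_monom)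
  also have "\<dots> = Polynomial.coeff q 0 + (\<Sum>j\<in>{1..m}. Polynomial.coeff q j * inverse x ^ j)"
    by (subst atLeast0AtMost [symmetric], subst sum.atLeast_Suc_atMost) simp_all
  finally have "1 = a * (Polynomial.coeff q 0 + (\<Sum>j\<in>{1..m}. Polynomial.coeff q j * inverse x ^ j))"
    using q(3) by simp
  then have ueq: "u = a * (\<Sum>j\<in>{1..m}. Polynomial.coeff q j * inverse x ^ j)"
    by (simp add: u_def algebra_simps)
  have "x ^ Suc n = u * inverse u * x ^ Suc n" using u by simp
  also have "\<dots> = a * (\<Sum>j\<in>{1..m}. Polynomial.coeff q j * inverse x ^ j) * inverse u * x ^ Suc n"
    by (subst ueq) (rule refl)
  also have "\<dots> = a * (\<Sum>j\<in>{1..m}. Polynomial.coeff q j * inverse u * (inverse x ^ j * x ^ Suc n))"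
    by (simp add: sum_distrib_left sum_distrib_right mult_ac)
  also have "(\<Sum>j\<in>{1..m}. Polynomial.coeff q j * inverse u * (inverse x ^ j * x ^ Suc n)) = poly r x"
    unfolding r_def poly_sum poly_monom
  proof (rule sum.cong[OF refl])
    fix j assume "j \<in> {1..m}"
    then have "x ^ Suc n = x ^ j * x ^ (Suc n - j)" using \<open>m \<le> Suc n\<close>
      by (subst power_add [symmetric]) simp
    moreover have "inverse x ^ j * x ^ j = 1" using x by (simp flip: power_mult_distrib)
    ultimately show "Polynomial.coeff q j * inverse u * (inverse x ^ j * x ^ Suc n)
        = Polynomial.coeff q j * inverse u * x ^ (Suc n - j)"
      by (metis mult.assoc mult.left_neutral)
  qed
  finally have xr: "x ^ Suc n = a * poly r x" .
  define p' where "p' = p - Polynomial.monom c (Suc n) + Polynomial.monom (c * a) 0 * r"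
  have rV: "r \<in> polys_over V"
    unfolding r_def using V cV u(2)
    by (intro subring_sum[OF polys_over_subring] monom_in_polys_over subring_mult) auto
  have "p' \<in> polys_over V"
    unfolding p'_def c_def using p(1) rV V cV a
    by (intro subring_closed[OF polys_over_subring] monom_in_polys_over subring_mult) auto
  moreover have "Polynomial.degree p' \<le> n"
  proof -
    have "Polynomial.degree (p - Polynomial.monom c (Suc n)) \<le> n"
      using p(2) by (intro degree_le) (auto simp: c_def coeff_eq_0)
    moreover have "Polynomial.degree r \<le> n"
      unfolding r_def by (intro degree_sum_le) (auto intro!: order.trans[OF degree_monom_le])
    ultimately show ?thesis
      unfolding p'_def monom_0 by (intro degree_add_le) auto
  qed
  moreover have "a * poly p' x = 1"
  proof -
    have "poly p' x = poly p x - c * x ^ Suc n + c * (a * poly r x)"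
      unfolding p'_def monom_0 by (simp add: poly_monom)
    then show ?thesis using p(3) xr by simp
  qed
  ultimately show ?thesis unfolding rep_degree_def by blast
qed

text \<open>If neither lay in \<open>V\<close>, both would represent \<open>1/a\<close>, and of the
  two representations the one of higher degree could always be lowered. The induction excludes
  degree \<open>n\<close> for \<open>x\<close> and \<open>1/x\<close> simultaneously.\<close>

theorem valuation_ring: "x \<in> V \<or> inverse x \<in> V"
proof (rule ccontr)
  assume *: "\<not> (x \<in> V \<or> inverse x \<in> V)"
  then have x: "x \<noteq> 0" using subring_0[OF V] by auto
  have no: "\<not> rep_degree y m" if "y = x \<or> y = inverse x" "m \<le> n" for y m n
    using that
  proof (induction n arbitrary: y m)
    case 0
    then show ?case using rep_degree_0 by auto
  next
    case (Suc n)
    have "\<not> rep_degree z (Suc n)" if z: "z = x \<or> z = inverse x" for z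
    proof
      assume rz: "rep_degree z (Suc n)"
      obtain k where k: "rep_degree (inverse z) k" using rep_degree_exists * z by fastforce
      have z': "inverse z = x \<or> inverse z = inverse x" using z by auto
      \<comment> \<open>If the least degree \<open>l\<close> for \<open>1/z\<close> is at most
        \<open>n + 1\<close>, the relation for \<open>z\<close> drops to degree \<open>n\<close>,
        against the induction hypothesis; otherwise the relation for \<open>1/z\<close> drops below
        its minimum.\<close>
      define l where "l = (LEAST k. rep_degree (inverse z) k)"
      have l: "rep_degree (inverse z) l" unfolding l_def using k by (rule LeastI)
      show False
      proof (cases "l \<le> Suc n")
        case True
        then show False using rep_degree_reduce[OF _ rz l] x z Suc.IH[of z n] by auto
      next
        case False
        then obtain l' where l': "l = Suc l'" by (cases l) auto
        have "rep_degree (inverse z) l'"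
          using rep_degree_reduce[of "inverse z" l' "Suc n"] l rz False x z l' by auto
        moreover have "l' < (LEAST k. rep_degree (inverse z) k)" using l' by (simp flip: l_def)
        ultimately show False using not_less_Least by blast
      qed
    qed
    then show ?case using Suc by (metis le_Suc_eq)
  qed
  show False using rep_degree_exists[of x] no[of x] * by blast
qed

end

lemma chevalley_extension:
  fixes A :: "'a::field set"
  assumes "is_subring A" "a \<in> A" "inverse a \<notin> A"
  obtains V where "is_subring V" "A \<subseteq> V" "inverse a \<notin> V" "\<And>x. x \<in> V \<or> inverse x \<in> V"
proof -
  define \<A> where "\<A> = {T. is_subring T \<and> A \<subseteq> T \<and> inverse a \<notin> T}"
  have "\<exists>M\<in>\<A>. \<forall>T\<in>\<A>. M \<subseteq> T \<longrightarrow> T = M"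
  proof (rule subset_Zorn_nonempty)
    show "\<A> \<noteq> {}" using assms by (auto simp: \<A>_def)
    fix \<C> assume ne: "\<C> \<noteq> {}" and ch: "subset.chain \<A> \<C>"
    have sub: "\<C> \<subseteq> \<A>" using ch by (simp add: subset.chain_def)
    have "is_subring (\<Union>\<C>)"
      unfolding is_subring_def
    proof (intro conjI ballI)
      show "1 \<in> \<Union>\<C>" using ne sub subring_1 by (force simp: \<A>_def)
      fix x y assume "x \<in> \<Union>\<C>" "y \<in> \<Union>\<C>"
      then obtain T1 T2 where T12: "T1 \<in> \<C>" "x \<in> T1" "T2 \<in> \<C>" "y \<in> T2" by blast
      then have "T1 \<subseteq> T2 \<or> T2 \<subseteq> T1" using ch by (auto simp: subset_chain_def)
      then obtain T where "T \<in> \<C>" "x \<in> T" "y \<in> T" using T12 by blast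
      then have "x - y \<in> T" "x * y \<in> T"
        using sub by (auto simp: \<A>_def subring_diff subring_mult)
      then show "x - y \<in> \<Union>\<C>" "x * y \<in> \<Union>\<C>" using \<open>T \<in> \<C>\<close> by blast+
    qed
    then show "\<Union>\<C> \<in> \<A>" using ne sub by (auto simp: \<A>_def)
  qed
  then obtain V where VA: "V \<in> \<A>" "\<And>T. T \<in> \<A> \<Longrightarrow> V \<subseteq> T \<Longrightarrow> T = V" by blast
  interpret max_subring_avoiding_inverse V a
    using VA assms by unfold_locales (auto simp: \<A>_def)
  show ?thesis using that valuation_ring VA(1) by (auto simp: \<A>_def)
qed

section \<open>Valuations with values in the extended reals\<close>

locale valuation =
  fixes w :: "'a::field \<Rightarrow> ereal"
  assumes valuation: "is_valuation w"
begin

lemma val_not_MInf [simp]: "w x \<noteq> - \<infinity>"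
  and val_eq_PInf_iff [simp]: "w x = \<infinity> \<longleftrightarrow> x = 0"
  and val_mult: "w (x * y) = w x + w y"
  and val_add: "min (w x) (w y) \<le> w (x + y)"
  using valuation by (auto simp: is_valuation_def)

lemma val_0 [simp]: "w 0 = \<infinity>" by simp

lemma val_finite:
  assumes "x \<noteq> 0"
  obtains r where "w x = ereal r"
  using assms val_not_MInf[of x] val_eq_PInf_iff[of x] by (cases "w x") auto

lemma val_1 [simp]: "w 1 = 0"
proof -
  obtain r where r: "w 1 = ereal r" using val_finite[of 1] by auto
  then have "ereal r = ereal r + ereal r" using val_mult[of 1 1] by simp
  then show ?thesis using r by (simp add: zero_ereal_def)
qed

lemma val_minus [simp]: "w (- x) = w x"
proof -
  obtain r where r: "w (-1) = ereal r" using val_finite[of "-1"] by auto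
  then have "ereal r + ereal r = 0" using val_mult[of "-1" "-1"] by simp
  then have "r = 0" by simp
  then show ?thesis using r val_mult[of "-1" x] by simp
qed

lemma val_diff: "min (w x) (w y) \<le> w (x - y)"
  using val_add[of x "- y"] by simp

lemma val_add_ge: "c \<le> w x \<Longrightarrow> c \<le> w y \<Longrightarrow> c \<le> w (x + y)"
  using val_add[of x y] by (meson min.boundedI order.trans)

lemma val_diff_ge: "c \<le> w x \<Longrightarrow> c \<le> w y \<Longrightarrow> c \<le> w (x - y)"
  using val_diff[of x y] by (meson min.boundedI order.trans)

lemma val_sum_ge: "(\<And>i. i \<in> I \<Longrightarrow> c \<le> w (f i)) \<Longrightarrow> c \<le> w (sum f I)"
  by (induction I rule: infinite_finite_induct) (auto intro: val_add_ge)

lemma val_inverse: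
  assumes "x \<noteq> 0"
  shows "w (inverse x) = - w x"
proof -
  obtain r where r: "w x = ereal r" using val_finite[OF assms] .
  obtain s where s: "w (inverse x) = ereal s" using val_finite[of "inverse x"] assms by auto
  show ?thesis using val_mult[of x "inverse x"] assms r s by simp
qed

lemma val_divide:
  assumes "y \<noteq> 0"
  shows "w (x / y) = w x - w y"
  using val_mult[of x "inverse y"] val_inverse[OF assms]
  by (simp add: divide_inverse minus_ereal_def)

lemma val_power: "w (x ^ n) = ereal (real n) * w x"
proof (cases "x = 0")
  case True
  then show ?thesis by (cases n) (simp_all add: zero_ereal_def [symmetric])
next
  case False
  then obtain r where r: "w x = ereal r" by (rule val_finite)
  have "w (x ^ n) = ereal (real n * r)"
    by (induction n) (simp_all add: val_mult r algebra_simps zero_ereal_def)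
  then show ?thesis using r by simp
qed

lemma val_add_eq:
  assumes "w x < w y"
  shows "w (x + y) = w x"
proof (rule antisym)
  show "w x \<le> w (x + y)" using assms by (intro val_add_ge) auto
  show "w (x + y) \<le> w x"
  proof (rule ccontr)
    assume "\<not> w (x + y) \<le> w x"
    then have "w x < w (x + y - y)"
      using assms val_diff[of "x + y" y] by (metis less_le_trans min_less_iff_conj not_le)
    then show False by simp
  qed
qed

text \<open>No cancellation occurs between terms of different valuations. Distinctness is asked only
  for \<open>f i \<noteq> 0\<close>, because several vanishing terms share the value
  infinity.\<close>

lemma val_sum_distinct:
  assumes "finite I" "\<And>i j. i \<in> I \<Longrightarrow> j \<in> I \<Longrightarrow> i \<noteq> j \<Longrightarrow> f i \<noteq> 0 \<Longrightarrow> w (f i) \<noteq> w (f j)"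
  shows "\<forall>i\<in>I. w (sum f I) \<le> w (f i)" "sum f I \<noteq> 0 \<Longrightarrow> \<exists>i\<in>I. w (sum f I) = w (f i)"
proof -
  have "(\<forall>i\<in>I. w (sum f I) \<le> w (f i)) \<and> (sum f I \<noteq> 0 \<longrightarrow> (\<exists>i\<in>I. w (sum f I) = w (f i)))"
    using assms
  proof (induction I)
    case (insert k I)
    then have IH: "\<forall>i\<in>I. w (sum f I) \<le> w (f i)"
      "sum f I \<noteq> 0 \<longrightarrow> (\<exists>i\<in>I. w (sum f I) = w (f i))" by auto
    have s: "sum f (insert k I) = f k + sum f I" using insert.hyps by simp
    consider "f k = 0" | "sum f I = 0" | "f k \<noteq> 0" "sum f I \<noteq> 0" by blast
    then show ?case
    proof cases
      case 1
      then show ?thesis using IH s by auto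
    next
      case 2
      then show ?thesis using IH s by auto
    next
      case 3
      then obtain i where i: "i \<in> I" "w (sum f I) = w (f i)" using IH by blast
      then have "w (f k) \<noteq> w (sum f I)" using insert.prems[of k i] insert.hyps 3 by auto
      then consider "w (f k) < w (sum f I)" | "w (sum f I) < w (f k)" by fastforce
      then show ?thesis
      proof cases
        case 1
        then show ?thesis using IH s val_add_eq[OF 1] by auto
      next
        case 2
        then have "w (f k + sum f I) = w (sum f I)" using val_add_eq[OF 2] by (simp add: add.commute)
        then have "w (sum f (insert k I)) = w (f i)" using s i(2) by simp
        moreover have "\<forall>j\<in>insert k I. w (f i) \<le> w (f j)" using IH(1) i(2) 2 by auto
        ultimately show ?thesis using i(1) by auto
      qed
    qed
  qed simp
  then show "\<forall>i\<in>I. w (sum f I) \<le> w (f i)" "sum f I \<noteq> 0 \<Longrightarrow> \<exists>i\<in>I. w (sum f I) = w (f i)"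
    by blast+
qed

lemma val_mult_ge: "0 \<le> w x \<Longrightarrow> 0 \<le> w y \<Longrightarrow> 0 \<le> w (x * y)"
  by (simp add: val_mult)

lemma val_power_ge: "0 \<le> w x \<Longrightarrow> 0 \<le> w (x ^ n)"
  by (simp add: val_power)

end

section \<open>From a valuation ring over the 2-adic integers to a real-valued valuation\<close>

locale q2_val_ring =
  fixes V :: "q2bar set"
  assumes V: "is_subring V" and base: "range (to_ac \<circ> to_fract) \<subseteq> V" and half: "inverse 2 \<notin> V"
    and total: "x \<in> V \<or> inverse x \<in> V"
begin

definition units :: "q2bar set" where
  "units = {x. x \<noteq> 0 \<and> x \<in> V \<and> inverse x \<in> V}"

lemma units_1: "1 \<in> units" using V by (auto simp: units_def subring_1)
lemma units_inverse: "x \<in> units \<Longrightarrow> inverse x \<in> units" by (auto simp: units_def)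
lemma units_mult: "x \<in> units \<Longrightarrow> y \<in> units \<Longrightarrow> x * y \<in> units"
  using V by (auto simp: units_def subring_mult)
lemma units_power: "x \<in> units \<Longrightarrow> x ^ n \<in> units"
  by (induction n) (auto intro: units_1 units_mult)

lemma two_V: "2 \<in> V" by (rule subring_numeral[OF V])

lemma two_powi_units: "2 powi k \<in> units \<Longrightarrow> k = 0"
proof (rule ccontr)
  assume u: "2 powi k \<in> units" and "k \<noteq> 0"
  have neg: False if "2 powi (- int (Suc n)) \<in> V" for n
  proof -
    have "2 powi (- int (Suc n)) * 2 ^ n \<in> V" using V that two_V by (intro subring_closed)
    also have "2 powi (- int (Suc n)) * 2 ^ n = (inverse 2 :: q2bar)"
      by (simp add: power_int_minus field_simps del: of_nat_Suc)
    finally show False using half by blast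
  qed
  have V2: "2 powi k \<in> V" "2 powi (- k) \<in> V" using u by (auto simp: units_def power_int_minus)
  consider "k > 0" | "k < 0" using \<open>k \<noteq> 0\<close> by linarith
  then show False
  proof cases
    case 1
    then obtain n where "k = int (Suc n)" by (metis zero_less_imp_eq_int gr0_implies_Suc of_nat_0_less_iff)
    then show False using neg V2 by blast
  next
    case 2
    then obtain n where "- k = int (Suc n)"
      by (metis zero_less_imp_eq_int gr0_implies_Suc of_nat_0_less_iff neg_0_less_iff_less)
    then have "k = - int (Suc n)" by linarith
    then show False using neg V2 by blast
  qed
qed

lemma two_powi_V: "2 powi k \<in> V \<Longrightarrow> k \<ge> 0"
proof (rule ccontr)
  assume "2 powi k \<in> V" "\<not> k \<ge> 0"
  moreover have "inverse (2 powi k :: q2bar) = 2 ^ nat (- k)"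
    using \<open>\<not> k \<ge> 0\<close> by (simp add: power_int_def power_one_over)
  then have "inverse (2 powi k :: q2bar) \<in> V" using V two_V by (auto intro: subring_closed)
  ultimately have "2 powi k \<in> units" by (simp add: units_def)
  then show False using two_powi_units \<open>\<not> k \<ge> 0\<close> by auto
qed

text \<open>A valuation ring is local: of two nonzero elements one divides the other, and if
  \<open>z\<close> divides \<open>y\<close> and \<open>z + y\<close> is a unit, then
  \<open>z\<close> is a unit.\<close>

lemma nonunits_add:
  assumes "x \<in> V" "y \<in> V" "x \<notin> units" "y \<notin> units"
  shows "x + y \<notin> units"
proof
  assume u: "x + y \<in> units"
  have *: "z \<in> units" if "z \<in> V" "z \<noteq> 0" "y / z \<in> V" "z + y \<in> units" for y z
  proof -
    have "inverse z = (1 + y / z) * inverse (z + y)"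
      using that by (auto simp: field_simps units_def)
    also have "\<dots> \<in> V" using V that by (intro subring_closed) (auto simp: units_def)
    finally show ?thesis using that by (simp add: units_def)
  qed
  have "x \<noteq> 0" "y \<noteq> 0" using u assms by auto
  moreover have "y / x \<in> V \<or> x / y \<in> V" using total[of "y / x"] by (simp add: inverse_eq_divide)
  ultimately show False using * assms u by (metis add.commute)
qed

lemma sum_nonunits:
  assumes "finite I" "\<And>i. i \<in> I \<Longrightarrow> f i \<in> V \<and> f i \<notin> units"
  shows "sum f I \<in> V \<and> sum f I \<notin> units"
  using assms
proof (induction I)
  case empty
  then show ?case using V by (simp add: subring_0 units_def)
next
  case (insert k I)
  then show ?case using nonunits_add subring_add[OF V] by simp
qed

text \<open>In a vanishing sum two terms must be associated, since otherwise the term that divides all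
  the others would be a sum of proper multiples of itself.\<close>

lemma sum_0_associated:
  assumes "finite I" "I \<noteq> {}" "\<And>i. i \<in> I \<Longrightarrow> f i \<noteq> 0" "sum f I = 0"
  shows "\<exists>i\<in>I. \<exists>j\<in>I. i \<noteq> j \<and> f i / f j \<in> units"
proof -
  have "\<exists>k\<in>I. \<forall>i\<in>I. f i / f k \<in> V"
    using assms(1-3)
  proof (induction I rule: finite_ne_induct)
    case (singleton k)
    then show ?case using V by (auto simp: subring_1)
  next
    case (insert l I)
    then obtain k where k: "k \<in> I" "\<forall>i\<in>I. f i / f k \<in> V" by auto
    have fk: "f k \<noteq> 0" "f l \<noteq> 0" using insert.prems k by auto
    consider "f l / f k \<in> V" | "f k / f l \<in> V" using total[of "f l / f k"] by auto
    then show ?case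
    proof cases
      case 1
      then show ?thesis using k by auto
    next
      case 2
      have "f i / f l \<in> V" if "i \<in> I" for i
      proof -
        have "f i / f k * (f k / f l) \<in> V" using 2 k that by (intro subring_mult[OF V]) auto
        then show ?thesis using fk by simp
      qed
      then show ?thesis using fk V by (auto simp: subring_1)
    qed
  qed
  then obtain k where k: "k \<in> I" "\<forall>i\<in>I. f i / f k \<in> V" by blast
  have fk: "f k \<noteq> 0" using assms k by auto
  have "\<exists>i\<in>I - {k}. f i / f k \<in> units"
  proof (rule ccontr)
    assume "\<not> ?thesis"
    then have "(\<Sum>i\<in>I - {k}. f i / f k) \<notin> units"
      using sum_nonunits[of "I - {k}" "\<lambda>i. f i / f k"] assms(1) k by blast
    moreover have "(\<Sum>i\<in>I - {k}. f i / f k) = - 1"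
      using assms k fk by (simp add: sum_diff1 flip: sum_divide_distrib)
    moreover have "- 1 \<in> units" using units_1 V by (auto simp: units_def subring_uminus)
    ultimately show False by simp
  qed
  then show ?thesis using k by blast
qed

lemma q2_associated:
  assumes "c \<noteq> 0"
  shows "\<exists>k. to_ac c / 2 powi k \<in> units \<and> val2 c = ereal (of_int k)"
proof -
  obtain k u where u: "u dvd 1" "c = 2 powi k * to_fract u" using q2_decompose[OF assms] .
  obtain u' where u': "u' dvd 1" "inverse (to_fract u) = to_fract u'" using unit_to_fract_inverse[OF u(1)] .
  have "to_ac (2 powi k :: q2) = 2 powi k" by (simp add: power_int_def)
  then have c: "to_ac c / 2 powi k = to_ac (to_fract u)" by (simp add: u)
  have "to_ac (to_fract u) \<in> V" "to_ac (to_fract u') \<in> V" using base by auto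
  moreover have "inverse (to_ac (to_fract u)) = to_ac (to_fract u')"
    by (simp flip: u'(2))
  moreover have "to_ac (to_fract u) \<noteq> 0" using zadic2_unit_not_0[OF u(1)] by simp
  ultimately have "to_ac c / 2 powi k \<in> units" unfolding c units_def by simp
  then show ?thesis using val2_eqI[OF u] by blast
qed

text \<open>The value of \<open>x\<close> is the slope \<open>m / n\<close> for which
  \<open>x ^ n\<close> is associated to \<open>2 ^ m\<close>. It is a relation first, since
  existence rests on algebraicity and uniqueness on 2 being a nonunit.\<close>

definition exponent :: "q2bar \<Rightarrow> real \<Rightarrow> bool" where
  "exponent x r \<longleftrightarrow> (\<exists>n m. n > 0 \<and> r = of_int m / real n \<and> x ^ n / 2 powi m \<in> units)"

text \<open>In a vanishing polynomial expression two terms are associated; their quotient shows that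
  a positive power of \<open>x\<close> is associated to an element of \<open>Q2\<close>, hence to a
  power of 2.\<close>

lemma exponent_exists:
  assumes x: "x \<noteq> 0"
  shows "\<exists>r. exponent x r"
proof -
  obtain p :: "q2 poly" where p: "p \<noteq> 0" "poly (map_poly to_ac p) x = 0" by (rule alg_closure_algebraic)
  define f where "f i = to_ac (Polynomial.coeff p i) * x ^ i" for i
  define I where "I = {i. i \<le> Polynomial.degree p \<and> Polynomial.coeff p i \<noteq> 0}"
  have "0 = (\<Sum>i\<le>Polynomial.degree p. f i)"
    using p(2) by (simp add: poly_altdef f_def degree_map_poly coeff_map_poly)
  also have "\<dots> = sum f I"
    by (rule sum.mono_neutral_right) (auto simp: I_def f_def)
  finally have s0: "sum f I = 0" by simp
  have "Polynomial.degree p \<in> I" using p(1) by (simp add: I_def)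
  then have I: "finite I" "I \<noteq> {}" by (auto simp: I_def)
  have nz: "f i \<noteq> 0" if "i \<in> I" for i using that x by (auto simp: I_def f_def)
  obtain i j where ij: "i \<in> I" "j \<in> I" "i \<noteq> j" "f i / f j \<in> units"
    using sum_0_associated[OF I nz s0] by blast
  have "\<exists>i\<in>I. \<exists>j\<in>I. j < i \<and> f i / f j \<in> units"
  proof (cases "j < i")
    case False
    moreover have "f j / f i \<in> units" using units_inverse[OF ij(4)] by simp
    ultimately show ?thesis using ij by (metis linorder_neqE_nat)
  qed (use ij in blast)
  then obtain i j where ij: "i \<in> I" "j \<in> I" "j < i" "f i / f j \<in> units" by blast
  define c where "c = Polynomial.coeff p i / Polynomial.coeff p j"
  have c: "c \<noteq> 0" using ij by (simp add: c_def I_def)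
  then obtain k where k: "to_ac c / 2 powi k \<in> units" using q2_associated by blast
  have "x ^ i = x ^ j * x ^ (i - j)" using ij by (simp flip: power_add)
  then have "f i / f j = to_ac c * x ^ (i - j)" using x by (simp add: f_def c_def)
  then have "x ^ (i - j) / 2 powi (- k) = f i / f j * inverse (to_ac c / 2 powi k)"
    using c by (simp add: power_int_minus field_simps)
  also have "\<dots> \<in> units" using ij(4) k by (intro units_mult units_inverse)
  finally have "exponent x (of_int (- k) / real (i - j))"
    unfolding exponent_def using ij(3) by (intro exI[of _ "i - j"] exI[of _ "- k"]) auto
  then show ?thesis by blast
qed

lemma exponent_unique:
  assumes "exponent x r" "exponent x s"
  shows "r = s"
proof -
  obtain n m where nm: "n > 0" "r = of_int m / real n" "x ^ n / 2 powi m \<in> units"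
    using assms(1) unfolding exponent_def by blast
  obtain k l where kl: "k > 0" "s = of_int l / real k" "x ^ k / 2 powi l \<in> units"
    using assms(2) unfolding exponent_def by blast
  have x: "x \<noteq> 0" using nm by (auto simp: units_def power_0_left split: if_splits)
  have "(x ^ k / 2 powi l) ^ n * inverse ((x ^ n / 2 powi m) ^ k) \<in> units"
    using nm kl by (intro units_mult units_inverse units_power)
  also have "(x ^ k / 2 powi l) ^ n * inverse ((x ^ n / 2 powi m) ^ k)
      = 2 powi (m * int k - l * int n)"
    using x by (simp add: field_simps power_int_diff power_int_mult flip: power_mult)
  finally have "m * int k = l * int n" using two_powi_units by fastforce
  then have "of_int m * real k = of_int l * real n" by (metis of_int_mult of_int_of_nat_eq)
  then show ?thesis unfolding nm(2) kl(2) using nm(1) kl(1) by (simp add: frac_eq_eq)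
qed

definition rval :: "q2bar \<Rightarrow> ereal" where
  "rval x = (if x = 0 then \<infinity> else ereal (THE r. exponent x r))"

lemma rval_eqI:
  assumes "exponent x r"
  shows "rval x = ereal r"
proof -
  have "x \<noteq> 0" using assms by (auto simp: exponent_def units_def power_0_left split: if_splits)
  moreover have "(THE r. exponent x r) = r" using assms exponent_unique by blast
  ultimately show ?thesis by (simp add: rval_def)
qed

lemma rval_exponent:
  assumes "x \<noteq> 0"
  obtains r where "exponent x r" "rval x = ereal r"
  using exponent_exists[OF assms] rval_eqI by blast

lemma exponent_mult:
  assumes "exponent x r" "exponent y s"
  shows "exponent (x * y) (r + s)"
proof -
  obtain n m where nm: "n > 0" "r = of_int m / real n" "x ^ n / 2 powi m \<in> units"
    using assms(1) unfolding exponent_def by blast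
  obtain k l where kl: "k > 0" "s = of_int l / real k" "y ^ k / 2 powi l \<in> units"
    using assms(2) unfolding exponent_def by blast
  have "(x ^ n / 2 powi m) ^ k * (y ^ k / 2 powi l) ^ n \<in> units"
    using nm kl by (intro units_mult units_power)
  also have "(x ^ n / 2 powi m) ^ k * (y ^ k / 2 powi l) ^ n
      = (x * y) ^ (n * k) / 2 powi (m * int k + l * int n)"
    by (simp add: power_divide power_mult_distrib power_int_add power_int_mult mult.commute
        flip: power_mult)
  finally have "(x * y) ^ (n * k) / 2 powi (m * int k + l * int n) \<in> units" .
  moreover have "r + s = of_int (m * int k + l * int n) / real (n * k)"
    using nm kl by (simp add: field_simps)
  ultimately show ?thesis unfolding exponent_def using nm(1) kl(1) by (metis mult_pos_pos)
qed

text \<open>A valuation ring is integrally closed, so a positive power of \<open>x\<close> in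
  \<open>V\<close> puts \<open>x\<close> in \<open>V\<close>. With \<open>V\<close> recovered from
  \<open>rval\<close>, the ultrametric inequality becomes closure of \<open>V\<close> under
  addition.\<close>

lemma rval_nonneg_iff: "0 \<le> rval x \<longleftrightarrow> x \<in> V"
proof (cases "x = 0")
  case True
  then show ?thesis using V by (simp add: rval_def subring_0)
next
  case False
  then obtain r where r: "exponent x r" "rval x = ereal r" by (rule rval_exponent)
  obtain n m where nm: "n > 0" "r = of_int m / real n" "x ^ n / 2 powi m \<in> units"
    using r(1) unfolding exponent_def by blast
  define u where "u = x ^ n / 2 powi m"
  have u: "u \<in> V" "inverse u \<in> V" "u \<noteq> 0" using nm by (auto simp: units_def u_def)
  have xn: "x ^ n = u * 2 powi m" "2 powi m = inverse u * x ^ n" using u by (auto simp: u_def)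
  have iff: "0 \<le> rval x \<longleftrightarrow> 0 \<le> m" using r nm by (simp add: zero_le_divide_iff)
  show ?thesis
  proof
    assume "0 \<le> rval x"
    then have "2 powi m = (2 :: q2bar) ^ nat m" using iff by (simp add: power_int_def)
    then have "x ^ n \<in> V" using V two_V u by (simp add: xn(1) subring_mult subring_power)
    show "x \<in> V"
    proof (rule ccontr)
      assume "x \<notin> V"
      then have "inverse x \<in> V" using total by blast
      then have "x ^ n * inverse x ^ (n - 1) \<in> V"
        using V \<open>x ^ n \<in> V\<close> by (simp add: subring_mult subring_power)
      moreover have "x ^ n = x * x ^ (n - 1)" using nm(1) by (metis power_eq_if not_gr_zero)
      then have "x ^ n * inverse x ^ (n - 1) = x"
        using False by (simp add: power_inverse)
      ultimately show False using \<open>x \<notin> V\<close> by simp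
    qed
  next
    assume "x \<in> V"
    then have "2 powi m \<in> V" unfolding xn(2) using V u by (intro subring_closed)
    then show "0 \<le> rval x" using iff two_powi_V by blast
  qed
qed

lemma rval_mult: "rval (x * y) = rval x + rval y"
proof (cases "x = 0 \<or> y = 0")
  case False
  then have nz: "x \<noteq> 0" "y \<noteq> 0" by auto
  obtain r where "exponent x r" "rval x = ereal r" using rval_exponent[OF nz(1)] .
  moreover obtain s where "exponent y s" "rval y = ereal s" using rval_exponent[OF nz(2)] .
  ultimately show ?thesis using rval_eqI[OF exponent_mult] by simp
qed (auto simp: rval_def)

lemma rval_valuation: "is_valuation rval"
  unfolding is_valuation_def
proof (intro conjI allI)
  fix x y
  show "rval x \<noteq> - \<infinity>" "rval x = \<infinity> \<longleftrightarrow> x = 0" by (auto simp: rval_def)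
  show "rval (x * y) = rval x + rval y" by (rule rval_mult)
  have *: "rval x \<le> rval (x + y)" if "x \<noteq> 0" "y \<noteq> 0" "y / x \<in> V" for x y
  proof -
    have "1 + y / x \<in> V" using V that by (auto intro: subring_closed)
    then have "0 \<le> rval (1 + y / x)" by (simp add: rval_nonneg_iff)
    then have "rval x + 0 \<le> rval x + rval (1 + y / x)" by (rule add_left_mono)
    also have "\<dots> = rval (x * (1 + y / x))" by (simp add: rval_mult)
    also have "x * (1 + y / x) = x + y" using that by (simp add: field_simps)
    finally show ?thesis by simp
  qed
  show "min (rval x) (rval y) \<le> rval (x + y)"
  proof (cases "x = 0 \<or> y = 0")
    case False
    moreover have "y / x \<in> V \<or> x / y \<in> V" using total[of "y / x"] by auto
    ultimately show ?thesis using *[of x y] *[of y x] by (auto simp: add.commute min.coboundedI1 min.coboundedI2)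
  qed (auto simp: rval_def)
qed

lemma rval_to_ac: "rval (to_ac c) = val2 c"
proof (cases "c = 0")
  case False
  then obtain k where "to_ac c / 2 powi k \<in> units" "val2 c = ereal (of_int k)"
    using q2_associated by blast
  then have "exponent (to_ac c) (of_int k)"
    unfolding exponent_def by (intro exI[of _ 1] exI[of _ k]) simp
  then show ?thesis using rval_eqI \<open>val2 c = _\<close> by metis
qed (simp add: rval_def)

end

lemma val2_extension_exists: "\<exists>w. is_valuation w \<and> (\<forall>c. w (to_ac c) = val2 c)"
proof -
  define A where "A = range (to_ac \<circ> to_fract :: zadic2 \<Rightarrow> q2bar)"
  have A: "to_ac (to_fract z) \<in> A" for z unfolding A_def by auto
  have "is_subring A"
    unfolding is_subring_def
  proof (intro conjI ballI)
    show "1 \<in> A" using A[of 1] by simp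
    fix x y assume "x \<in> A" "y \<in> A"
    then obtain a b where "x = to_ac (to_fract a)" "y = to_ac (to_fract b)" unfolding A_def by auto
    then show "x - y \<in> A" "x * y \<in> A" using A[of "a - b"] A[of "a * b"] by simp_all
  qed
  moreover have "2 \<in> A" using A[of 2] by simp
  moreover have "inverse 2 \<notin> A"
  proof
    assume "inverse 2 \<in> A"
    then obtain z :: zadic2 where z: "inverse 2 = (to_ac \<circ> to_fract) z" unfolding A_def by (rule rangeE)
    have "to_ac (to_fract (2 * z)) = 2 * (to_ac \<circ> to_fract) z" by simp
    also have "\<dots> = 2 * inverse 2" unfolding z ..
    also have "\<dots> = to_ac (to_fract 1)" by simp
    finally have "2 * z = 1" by (simp only: to_ac_eq_iff to_fract_eq_iff)
    then show False using zadic2_not_2_dvd_1 by (metis dvd_triv_left)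
  qed
  ultimately obtain V where V: "is_subring V" "A \<subseteq> V" "inverse 2 \<notin> V" "\<And>x. x \<in> V \<or> inverse x \<in> V"
    by (rule chevalley_extension) blast
  interpret q2_val_ring V using V by unfold_locales (auto simp: A_def)
  show ?thesis using rval_valuation rval_to_ac by blast
qed

interpretation val2: valuation val2
  by unfold_locales (rule val2_valuation)

subsection \<open>Uniqueness of the prolongation\<close>

lemma val2_2_powi: "val2 (2 powi k) = ereal (of_int k)"
  using val2_eqI[of 1 _ k] by simp

lemma val2_2_power: "val2 (2 ^ n) = ereal (real n)"
  using val2_eqI[of 1 _ "int n"] by simp

lemma q2_complete:
  fixes s :: "nat \<Rightarrow> q2"
  assumes s: "\<And>n. ereal (real n - real C) \<le> val2 (s (Suc n) - s n)"
  obtains l where "\<And>n. ereal (real n - real C) \<le> val2 (l - s n)"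
proof -
  \<comment> \<open>Subtracting \<open>s 0\<close> and multiplying by \<open>2 ^ C\<close> makes the
    sequence integral, with \<open>n\<close>-th increment divisible by \<open>2 ^ n\<close>.\<close>
  define t where "t n = 2 ^ C * (s n - s 0)" for n
  have shift: "ereal (real n) \<le> val2 (2 ^ C * x) \<longleftrightarrow> ereal (real n - real C) \<le> val2 x" for n x
    by (cases "val2 x") (auto simp: val2_mult val2_2_power)
  have diff: "ereal (real n) \<le> val2 (t (Suc n) - t n)" for n
  proof -
    have "t (Suc n) - t n = 2 ^ C * (s (Suc n) - s n)" by (simp add: t_def algebra_simps)
    then show ?thesis using s shift by simp
  qed
  have "0 \<le> val2 (t n)" for n
  proof (induction n)
    case (Suc n)
    have "0 \<le> val2 (t (Suc n) - t n)" using diff[of n] by (rule order.trans[rotated]) simp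
    then have "0 \<le> val2 ((t (Suc n) - t n) + t n)" using Suc by (rule val2.val_add_ge)
    then show ?case by simp
  qed (simp add: t_def)
  then have "\<forall>n. \<exists>z. t n = to_fract z" unfolding val2_nonneg_iff integral2_def by auto
  then obtain T where T: "t n = to_fract (T n)" for n by metis
  have "2 ^ n dvd T (Suc n) - T n" for n
    using diff[of n] by (simp add: T flip: val2_to_fract_ge_iff to_fract_diff)
  then obtain z where z: "\<And>n. 2 ^ n dvd z - T n" using zadic2_complete by blast
  have "ereal (real n - real C) \<le> val2 (to_fract z / 2 ^ C + s 0 - s n)" for n
  proof -
    have "ereal (real n) \<le> val2 (to_fract (z - T n))" using z by (simp only: val2_to_fract_ge_iff)
    also have "to_fract (z - T n) = 2 ^ C * (to_fract z / 2 ^ C + s 0 - s n)"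
      by (simp flip: T) (simp add: t_def algebra_simps)
    finally show ?thesis by (simp only: shift)
  qed
  then show ?thesis using that by blast
qed

section \<open>Finite-dimensional spaces over the complete field\<close>

locale q2bar_valuation = valuation w for w :: "q2bar \<Rightarrow> ereal" +
  assumes val_to_ac: "w (to_ac c) = val2 c"
begin

definition lin_indep :: "nat set \<Rightarrow> (nat \<Rightarrow> q2bar) \<Rightarrow> bool" where
  "lin_indep I b \<longleftrightarrow> (\<forall>a. (\<Sum>i\<in>I. to_ac (a i) * b i) = 0 \<longrightarrow> (\<forall>i\<in>I. a i = 0))"

lemma lin_comb_bound_below:
  assumes "finite I"
  obtains B :: real where "\<And>a c. (\<And>i. i \<in> I \<Longrightarrow> c \<le> val2 (a i)) \<Longrightarrow>
     c + ereal B \<le> w (\<Sum>i\<in>I. to_ac (a i) * b i)"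
proof -
  have "\<exists>B::real. \<forall>i\<in>I. ereal B \<le> w (b i)"
    using assms
  proof (induction I)
    case (insert i I)
    then obtain B where B: "\<forall>i\<in>I. ereal B \<le> w (b i)" by blast
    obtain B' where B': "ereal B' \<le> w (b i)"
      by (cases "w (b i)") (auto intro: that)
    have "ereal (min B B') \<le> w (b j)" if "j \<in> insert i I" for j
      using that B B' by (auto simp: min_def intro: order.trans[rotated])
    then show ?case by blast
  qed auto
  then obtain B where B: "\<And>i. i \<in> I \<Longrightarrow> ereal B \<le> w (b i)" by blast
  show ?thesis
  proof (rule that[of B], rule val_sum_ge)
    fix a i and c :: ereal assume "\<And>i. i \<in> I \<Longrightarrow> c \<le> val2 (a i)" "i \<in> I"
    then show "c + ereal B \<le> w (to_ac (a i) * b i)"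
      unfolding val_mult val_to_ac using B by (intro add_mono) auto
  qed
qed

text \<open>Equivalence of norms on a finite-dimensional space over a complete field.\<close>

lemma lin_comb_bound_above:
  assumes "finite I" "lin_indep I b"
  obtains C :: nat where "\<And>a i. i \<in> I \<Longrightarrow> w (\<Sum>i\<in>I. to_ac (a i) * b i) \<le> val2 (a i) + ereal (real C)"
proof -
  have "\<exists>C::nat. \<forall>a. \<forall>i\<in>I. w (\<Sum>i\<in>I. to_ac (a i) * b i) \<le> val2 (a i) + ereal (real C)"
    using assms
  proof (induction "card I" arbitrary: I rule: less_induct)
    case (less I)
    have "\<exists>C::nat. \<forall>a. w (\<Sum>i\<in>I. to_ac (a i) * b i) \<le> val2 (a i) + ereal (real C)" if i: "i \<in> I" for i
    proof (rule ccontr)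
      assume *: "\<not> ?thesis"
      define J where "J = I - {i}"
      have J: "finite J" "card J < card I" "i \<notin> J"
        using less.prems(1) card_Diff1_less[OF less.prems(1) i] by (simp_all add: J_def)
      have split: "(\<Sum>j\<in>I. f j) = f i + (\<Sum>j\<in>J. f j)" for f :: "nat \<Rightarrow> q2bar"
        unfolding J_def using less.prems(1) i by (rule sum.remove)
      have Jind: "lin_indep J b"
        unfolding lin_indep_def
      proof (intro allI impI ballI)
        fix a j assume a: "(\<Sum>i\<in>J. to_ac (a i) * b i) = 0" and j: "j \<in> J"
        define a' where "a' = a(i := 0)"
        have "(\<Sum>j\<in>J. to_ac (a' j) * b j) = 0"
          unfolding a [symmetric] using J(3) by (intro sum.cong) (auto simp: a'_def)
        then have "(\<Sum>j\<in>I. to_ac (a' j) * b j) = 0" unfolding split by (simp add: a'_def)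
        then have "a' j = 0" using less.prems(2) j unfolding lin_indep_def J_def by blast
        then show "a j = 0" using j J(3) by (auto simp: a'_def split: if_splits)
      qed
      obtain C :: nat where C: "\<And>a j. j \<in> J \<Longrightarrow> w (\<Sum>i\<in>J. to_ac (a i) * b i) \<le> val2 (a j) + ereal (real C)"
        using less.hyps[OF J(2,1) Jind] by blast
      \<comment> \<open>Without a bound for coordinate \<open>i\<close>, division by
        \<open>a i\<close> yields vectors with coefficient 1 at \<open>b i\<close> and arbitrarily
        large valuation.\<close>
      have "\<exists>a. ereal (real n) \<le> w (b i + (\<Sum>j\<in>J. to_ac (a j) * b j))" for n
      proof -
        obtain a where a: "val2 (a i) + ereal (real n) < w (\<Sum>i\<in>I. to_ac (a i) * b i)"
          using * by (auto simp: not_le)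
        then have ai: "a i \<noteq> 0" by auto
        then obtain r where r: "val2 (a i) = ereal r" by (rule val2.val_finite)
        have "(\<Sum>i\<in>I. to_ac (a i) * b i) = to_ac (a i) * (b i + (\<Sum>j\<in>J. to_ac (a j / a i) * b j))"
          unfolding split using ai by (simp add: algebra_simps sum_distrib_left)
        then have "ereal r + ereal (real n) < ereal r + w (b i + (\<Sum>j\<in>J. to_ac (a j / a i) * b j))"
          using a by (simp only: val_mult val_to_ac r)
        then have "ereal (real n) \<le> w (b i + (\<Sum>j\<in>J. to_ac (a j / a i) * b j))"
          by (cases "w (b i + (\<Sum>j\<in>J. to_ac (a j / a i) * b j))") auto
        then show ?thesis by (rule exI[where x = "\<lambda>j. a j / a i"])
      qed
      then obtain a where a: "ereal (real n) \<le> w (b i + (\<Sum>j\<in>J. to_ac (a n j) * b j))" for n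
        by metis
      \<comment> \<open>Two such vectors differ by a combination over \<open>J\<close>, so the bound
        for \<open>J\<close> makes every coordinate a Cauchy sequence.\<close>
      have step: "ereal (real n - real C) \<le> val2 (a (Suc n) j - a n j)" if j: "j \<in> J" for n j
      proof -
        have "ereal (real n) \<le> w (b i + (\<Sum>j\<in>J. to_ac (a (Suc n) j) * b j))"
          using a[of "Suc n"] by (rule order.trans[rotated]) simp
        then have "ereal (real n) \<le> w ((b i + (\<Sum>j\<in>J. to_ac (a (Suc n) j) * b j)) - (b i + (\<Sum>j\<in>J. to_ac (a n j) * b j)))"
          using a[of n] by (rule val_diff_ge)
        also have "(b i + (\<Sum>j\<in>J. to_ac (a (Suc n) j) * b j)) - (b i + (\<Sum>j\<in>J. to_ac (a n j) * b j))
            = (\<Sum>j\<in>J. to_ac (a (Suc n) j - a n j) * b j)"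
          by (simp add: sum_subtractf algebra_simps)
        also have "w \<dots> \<le> val2 (a (Suc n) j - a n j) + ereal (real C)"
          using C[OF j] .
        finally show ?thesis by (cases "val2 (a (Suc n) j - a n j)") auto
      qed
      have "\<forall>j\<in>J. \<exists>l. \<forall>n. ereal (real n - real C) \<le> val2 (l - a n j)"
      proof
        fix j assume "j \<in> J"
        from q2_complete[of C "\<lambda>n. a n j", OF step[OF this]]
        show "\<exists>l. \<forall>n. ereal (real n - real C) \<le> val2 (l - a n j)" by blast
      qed
      then obtain l where l: "\<And>j n. j \<in> J \<Longrightarrow> ereal (real n - real C) \<le> val2 (l j - a n j)"
        by metis
      obtain B where B: "\<And>a c. (\<And>i. i \<in> J \<Longrightarrow> c \<le> val2 (a i)) \<Longrightarrow>
         c + ereal B \<le> w (\<Sum>i\<in>J. to_ac (a i) * b i)"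
        using lin_comb_bound_below[OF J(1), of b] by blast
      define y where "y = b i + (\<Sum>j\<in>J. to_ac (l j) * b j)"
      have y: "ereal (min (real n) (real n - real C + B)) \<le> w y" for n
      proof -
        have "y = (b i + (\<Sum>j\<in>J. to_ac (a n j) * b j)) + (\<Sum>j\<in>J. to_ac (l j - a n j) * b j)"
          by (simp add: y_def sum_subtractf algebra_simps)
        moreover have "ereal (real n - real C) + ereal B \<le> w (\<Sum>j\<in>J. to_ac (l j - a n j) * b j)"
          using l by (rule B)
        then have "ereal (min (real n) (real n - real C + B)) \<le> w (\<Sum>j\<in>J. to_ac (l j - a n j) * b j)"
          by (rule order.trans[rotated]) simp
        moreover have "ereal (min (real n) (real n - real C + B)) \<le> w (b i + (\<Sum>j\<in>J. to_ac (a n j) * b j))"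
          using a[of n] by (rule order.trans[rotated]) simp
        ultimately show ?thesis using val_add_ge by simp
      qed
      have "w y = \<infinity>"
      proof (rule ccontr)
        assume "w y \<noteq> \<infinity>"
        then obtain r where r: "w y = ereal r" using val_not_MInf by (cases "w y") auto
        obtain n :: nat where "real n > \<bar>r\<bar> + \<bar>B\<bar> + real C" using reals_Archimedean2 by blast
        then show False using y[of n] r by (simp add: min_def split: if_splits)
      qed
      then have "y = 0" by simp
      \<comment> \<open>The limit is a vanishing combination with coefficient 1 at
        \<open>b i\<close>, against independence.\<close>
      define l' where "l' = l(i := 1)"
      have "(\<Sum>j\<in>J. to_ac (l' j) * b j) = (\<Sum>j\<in>J. to_ac (l j) * b j)"
        using J(3) by (intro sum.cong) (auto simp: l'_def)
      then have "(\<Sum>j\<in>I. to_ac (l' j) * b j) = y" unfolding split by (simp add: l'_def y_def)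
      then have "l' i = 0" using less.prems(2) i \<open>y = 0\<close> unfolding lin_indep_def by blast
      then show False by (simp add: l'_def)
    qed
    then obtain c where c: "\<And>i a. i \<in> I \<Longrightarrow> w (\<Sum>i\<in>I. to_ac (a i) * b i) \<le> val2 (a i) + ereal (real (c i :: nat))"
      by metis
    have "w (\<Sum>i\<in>I. to_ac (a i) * b i) \<le> val2 (a i) + ereal (real (sum c I))" if "i \<in> I" for i a
    proof -
      have "c i \<le> sum c I" using less.prems(1) that by (simp add: member_le_sum)
      then have "val2 (a i) + ereal (real (c i)) \<le> val2 (a i) + ereal (real (sum c I))"
        by (intro add_left_mono) (simp del: of_nat_sum)
      then show ?thesis using c[OF that] by (rule order.trans[rotated])
    qed
    then show ?case by blast
  qed
  then show ?thesis using that by blast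
qed

end

abbreviation ev :: "q2 poly \<Rightarrow> q2bar \<Rightarrow> q2bar" where
  "ev f x \<equiv> poly (map_poly to_ac f) x"

lemma ev_add: "ev (f + g) x = ev f x + ev g x"
proof -
  have "map_poly to_ac (f + g) = map_poly to_ac f + map_poly to_ac g"
    by (rule poly_eqI) (simp add: coeff_map_poly)
  then show ?thesis by simp
qed

lemma ev_pCons: "ev (pCons c f) x = to_ac c + x * ev f x"
  by (simp add: map_poly_pCons)

lemma ev_smult: "ev (Polynomial.smult c f) x = to_ac c * ev f x"
proof -
  have "map_poly to_ac (Polynomial.smult c f) = Polynomial.smult (to_ac c) (map_poly to_ac f)"
    by (rule poly_eqI) (simp add: coeff_map_poly)
  then show ?thesis by simp
qed

lemma ev_mult: "ev (f * g) x = ev f x * ev g x"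
  by (induction f) (simp_all add: ev_pCons ev_add ev_smult algebra_simps)

lemma ev_monom: "ev (Polynomial.monom c n) x = to_ac c * x ^ n"
  by (simp add: map_poly_monom poly_monom)

lemma ev_sum_lessThan:
  assumes "f = 0 \<or> Polynomial.degree f < n"
  shows "ev f x = (\<Sum>i<n. to_ac (Polynomial.coeff f i) * x ^ i)"
proof -
  have "ev f x = (\<Sum>i\<le>Polynomial.degree f. to_ac (Polynomial.coeff f i) * x ^ i)"
    by (simp add: poly_altdef degree_map_poly coeff_map_poly)
  also have "\<dots> = (\<Sum>i<n. to_ac (Polynomial.coeff f i) * x ^ i)"
  proof (cases "f = 0")
    case False
    then show ?thesis using assms by (intro sum.mono_neutral_left) (auto simp: coeff_eq_0)
  qed simp
  finally show ?thesis .
qed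

text \<open>A valuation prolonging the 2-adic one is unique, and invariant under conjugation: the powers
  of conjugate elements have the same coordinates with respect to bases of powers, and the
  valuation of \<open>x ^ k\<close> agrees with the minimum of the valuations of its coordinates up to a
  constant independent of \<open>k\<close>.\<close>

lemma conjugate_val_le:
  assumes "q2bar_valuation w" "q2bar_valuation w'" and conj: "\<And>f. ev f x = 0 \<longleftrightarrow> ev f x' = 0"
  shows "w x \<le> w' x'"
proof (cases "x' = 0")
  case True
  interpret w': q2bar_valuation w' by fact
  show ?thesis using True by simp
next
  case False
  interpret w: q2bar_valuation w by fact
  interpret w': q2bar_valuation w' by fact
  have x: "x \<noteq> 0" using conj[of "[:0, 1:]"] False by (simp add: ev_pCons)
  have "\<exists>p. p \<noteq> 0 \<and> ev p x = 0" using alg_closure_algebraic by metis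
  then obtain p where p: "p \<noteq> 0" "ev p x = 0"
    and least: "\<And>q. q \<noteq> 0 \<Longrightarrow> ev q x = 0 \<Longrightarrow> Polynomial.degree p \<le> Polynomial.degree q"
    using ex_has_least_nat[of "\<lambda>p. p \<noteq> 0 \<and> ev p x = 0" _ Polynomial.degree] by blast
  define n where "n = Polynomial.degree p"
  have "w.lin_indep {..<n} (\<lambda>i. x ^ i)"
    unfolding w.lin_indep_def
  proof (intro allI impI ballI)
    fix a i assume a: "(\<Sum>i<n. to_ac (a i) * x ^ i) = 0" and i: "i \<in> {..<n}"
    define q where "q = (\<Sum>i<n. Polynomial.monom (a i) i)"
    have cq: "Polynomial.coeff q j = (if j < n then a j else 0)" for j
      by (simp add: q_def coeff_sum)
    have dq: "q = 0 \<or> Polynomial.degree q < n"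
      using cq by (metis leading_coeff_0_iff)
    have "ev q x = 0" unfolding ev_sum_lessThan[OF dq] using a by (simp add: cq)
    then have "q = 0" using least[of q] dq unfolding n_def by (metis leD)
    then show "a i = 0" using cq[of i] i by simp
  qed
  then obtain C where C: "\<And>a i. i \<in> {..<n} \<Longrightarrow> w (\<Sum>i<n. to_ac (a i) * x ^ i) \<le> val2 (a i) + ereal (real C)"
    using w.lin_comb_bound_above[of "{..<n}"] by blast
  obtain B where B: "\<And>a c. (\<And>i. i \<in> {..<n} \<Longrightarrow> c \<le> val2 (a i)) \<Longrightarrow>
      c + ereal B \<le> w' (\<Sum>i<n. to_ac (a i) * x' ^ i)"
    using w'.lin_comb_bound_below[of "{..<n}" "\<lambda>i. x' ^ i"] by blast
  have key: "w (x ^ k) \<le> w' (x' ^ k) + ereal (real C - B)" for k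
  proof -
    \<comment> \<open>One remainder modulo the minimal polynomial gives the coordinates of both
      \<open>x ^ k\<close> and \<open>x' ^ k\<close>, since \<open>p\<close> annihilates both
      elements.\<close>
    define q where "q = Polynomial.monom 1 k mod p"
    have dq: "q = 0 \<or> Polynomial.degree q < n"
      using degree_mod_less[of p "Polynomial.monom 1 k"] p(1) by (simp add: q_def n_def)
    have pk: "Polynomial.monom 1 k = (Polynomial.monom 1 k div p) * p + q" by (simp add: q_def)
    have "ev p x' = 0" using conj p(2) by blast
    then have "ev (Polynomial.monom 1 k) x' = ev q x'" "ev (Polynomial.monom 1 k) x = ev q x"
      using p(2) by (subst pk, simp only: ev_add ev_mult, simp)+
    then have xk: "x ^ k = (\<Sum>i<n. to_ac (Polynomial.coeff q i) * x ^ i)"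
      "x' ^ k = (\<Sum>i<n. to_ac (Polynomial.coeff q i) * x' ^ i)"
      by (simp_all add: ev_monom ev_sum_lessThan[OF dq])
    obtain r where r: "w (x ^ k) = ereal r" using w.val_finite[of "x ^ k"] x by auto
    have "ereal (r - real C) \<le> val2 (Polynomial.coeff q i)" if "i \<in> {..<n}" for i
      using C[OF that, of "Polynomial.coeff q"] r xk(1)
      by (cases "val2 (Polynomial.coeff q i)") auto
    then have "ereal (r - real C) + ereal B \<le> w' (x' ^ k)"
      unfolding xk(2) by (rule B)
    then show ?thesis using r False by (cases "w' (x' ^ k)") auto
  qed
  obtain r where r: "w x = ereal r" using w.val_finite[OF x] .
  obtain s where s: "w' x' = ereal s" using w'.val_finite[OF False] .
  have ks: "real k * (r - s) \<le> real C - B" for k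
    using key[of k] by (simp add: w.val_power w'.val_power r s algebra_simps)
  have "r \<le> s"
  proof (rule ccontr)
    assume "\<not> r \<le> s"
    then obtain k where "real C - B < real k * (r - s)"
      using reals_Archimedean3[of "r - s"] by auto
    then show False using ks[of k] by simp
  qed
  then show ?thesis using r s by simp
qed

lemma conjugate_val_eq:
  assumes "q2bar_valuation w" "q2bar_valuation w'" "\<And>f. ev f x = 0 \<longleftrightarrow> ev f x' = 0"
  shows "w x = w' x'"
  using conjugate_val_le[OF assms(1,2)] conjugate_val_le[OF assms(2,1)] assms(3) by (metis order.antisym)

definition val2bar :: "q2bar \<Rightarrow> ereal" where
  "val2bar = (SOME w. is_valuation w \<and> (\<forall>c. w (to_ac c) = val2 c))"

interpretation W: q2bar_valuation val2bar
proof -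
  have "is_valuation val2bar \<and> (\<forall>c. val2bar (to_ac c) = val2 c)"
    unfolding val2bar_def using val2_extension_exists by (rule someI_ex)
  then show "q2bar_valuation val2bar" by unfold_locales auto
qed

lemma q2bar_valuation_unique: "q2bar_valuation w \<Longrightarrow> w = val2bar"
  using conjugate_val_eq[OF _ W.q2bar_valuation_axioms] by blast

subsection \<open>Subfields, ramification index and upper breaks\<close>

lemma Q2bar_simps [simp]:
  "carrier Q2bar = UNIV" "x \<otimes>\<^bsub>Q2bar\<^esub> y = x * y" "\<one>\<^bsub>Q2bar\<^esub> = 1" "\<zero>\<^bsub>Q2bar\<^esub> = 0"
  "x \<oplus>\<^bsub>Q2bar\<^esub> y = x + y"
  by (simp_all add: ring_of_type_algebra_def)

lemma Q2bar_field: "Ring.field Q2bar"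
  by (rule field_from_type_algebra)

lemma Q2bar_ring: "Ring.ring Q2bar"
  by (rule ring_from_type_algebra)

lemma Q2bar_cring: "Ring.cring Q2bar"
  by (rule cring_from_type_algebra)

lemma Q2bar_a_inv [simp]: "\<ominus>\<^bsub>Q2bar\<^esub> x = - x"
  using cring.sum_zero_eq_neg[OF Q2bar_cring, of "- x" x] by simp

lemma Q2bar_inv [simp]: "x \<noteq> 0 \<Longrightarrow> inv\<^bsub>Q2bar\<^esub> x = inverse x"
  by (rule comm_monoid.comm_inv_char[OF cring.axioms(2)[OF Q2bar_cring]]) simp_all

lemma subfield_is_subring: "subfield S Q2bar \<Longrightarrow> is_subring S"
  unfolding is_subring_def
  using subringE(3)[OF subfieldE(1), of S Q2bar] subringE(5)[OF subfieldE(1), of S Q2bar]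
    subringE(6)[OF subfieldE(1), of S Q2bar] subringE(7)[OF subfieldE(1), of S Q2bar]
  by simp (metis ab_group_add_class.ab_diff_conv_add_uminus)

lemma Q2_subring: "is_subring Q2"
  unfolding is_subring_def
  by (auto intro: range_eqI[of _ to_ac 1] simp flip: to_ac_diff to_ac_mult)

lemma to_ac_Q2 [simp]: "to_ac c \<in> Q2" by simp

text \<open>The minimal polynomial of \<open>x\<close> over \<open>Q2\<close> has nonzero constant
  term, which writes \<open>1/x\<close> as a polynomial in \<open>x\<close>. Thus subrings
  containing \<open>Q2\<close> are fields, and only ring closure has to be checked for them.\<close>

lemma inverse_in_subring:
  assumes "is_subring S" "Q2 \<subseteq> S" "x \<in> S"
  shows "inverse x \<in> S"
proof (cases "x = 0")
  case True
  then show ?thesis using assms by simp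
next
  case False
  have ex: "\<exists>p. p \<noteq> 0 \<and> ev p x = 0" using alg_closure_algebraic by metis
  then obtain p where p: "p \<noteq> 0" "ev p x = 0"
    and least: "\<And>q. q \<noteq> 0 \<Longrightarrow> ev q x = 0 \<Longrightarrow> Polynomial.degree p \<le> Polynomial.degree q"
    using ex_has_least_nat[of "\<lambda>p. p \<noteq> 0 \<and> ev p x = 0" _ Polynomial.degree] by blast
  obtain c q where pcq: "p = pCons c q" by (cases p)
  have "c \<noteq> 0"
  proof
    assume "c = 0"
    then have "ev q x = 0" "q \<noteq> 0" using p pcq False by (auto simp: ev_pCons)
    then show False using least[of q] pcq by simp
  qed
  have "inverse x = - to_ac (inverse c) * ev q x"
    using p(2) pcq False \<open>c \<noteq> 0\<close> by (simp add: ev_pCons field_simps eq_neg_iff_add_eq_0)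
  also have "ev q x = (\<Sum>i\<le>Polynomial.degree q. to_ac (Polynomial.coeff q i) * x ^ i)"
    by (simp add: poly_altdef degree_map_poly coeff_map_poly)
  finally show ?thesis using assms(1,3) subsetD[OF assms(2) to_ac_Q2]
    by (auto intro!: subring_closed simp del: to_ac_inverse)
qed

lemma subring_divide:
  assumes "is_subring S" "Q2 \<subseteq> S" "x \<in> S" "y \<in> S"
  shows "x / y \<in> S"
  using subring_mult[OF assms(1,3) inverse_in_subring[OF assms(1,2,4)]] by (simp add: divide_inverse)

lemma subringI_subfield:
  assumes "is_subring S" "Q2 \<subseteq> S"
  shows "subfield S Q2bar"
proof (rule field.subfieldI'[OF Q2bar_field])
  show "subring S Q2bar"
    using assms(1) by (intro ring.subringI[OF Q2bar_ring]) (auto intro: subring_closed)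
  show "inv\<^bsub>Q2bar\<^esub> k \<in> S" if "k \<in> S - {\<zero>\<^bsub>Q2bar\<^esub>}" for k
    using that inverse_in_subring[OF assms] by simp
qed

lemma Q2_subfield: "subfield Q2 Q2bar"
  by (rule subringI_subfield[OF Q2_subring order.refl])

lemma adjoin_is_subring: "is_subring (adjoin K T)"
  unfolding adjoin_def
  by (intro subfield_is_subring field.generate_field_is_subfield[OF Q2bar_field]) simp

lemma adjoin_upper: "K \<subseteq> adjoin K T" "T \<subseteq> adjoin K T"
  by (auto simp: adjoin_def intro: generate_field.incl)

lemma adjoin_least:
  assumes "is_subring S" "Q2 \<subseteq> S" "K \<subseteq> S" "T \<subseteq> S"
  shows "adjoin K T \<subseteq> S"
  unfolding adjoin_def using assms
  by (intro field.generate_field_min_subfield1[OF Q2bar_field] subringI_subfield) auto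

lemma compositum_eq: "compositum F L = adjoin F L"
  by (simp add: compositum_def adjoin_def)

lemma compositum_subset_left:
  assumes "is_subring L" "Q2 \<subseteq> L" "F \<subseteq> L"
  shows "compositum F L = L"
  unfolding compositum_eq using adjoin_least[OF assms order.refl] adjoin_upper by blast

text \<open>The value group of \<open>L\<close> is \<open>1/e\<close> times the integers, measured
  by the single valuation \<open>val2bar\<close>. Both definite descriptions,
  \<open>normalized_val\<close> and \<open>ram_index\<close>, are computed from this.\<close>

definition has_ram_index :: "q2bar set \<Rightarrow> nat \<Rightarrow> bool" where
  "has_ram_index L e \<longleftrightarrow> e > 0 \<and>
     val2bar ` (L - {0}) = range (\<lambda>n::int. ereal (of_int n / real e))"

lemma is_valuation_scaled:
  assumes "is_valuation w" "c > 0"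
  shows "is_valuation (\<lambda>x. ereal c * w x)"
proof -
  interpret w: valuation w by unfold_locales fact
  show ?thesis
    unfolding is_valuation_def
  proof (intro conjI allI)
    fix x y
    show "ereal c * w x \<noteq> - \<infinity>"
      using assms(2) w.val_not_MInf[of x] by (cases "w x") auto
    show "ereal c * w x = \<infinity> \<longleftrightarrow> x = 0"
      using assms(2) w.val_eq_PInf_iff[of x] w.val_not_MInf[of x] by (cases "w x") auto
    show "ereal c * w (x * y) = ereal c * w x + ereal c * w y"
      unfolding w.val_mult using assms(2) w.val_not_MInf[of x] w.val_not_MInf[of y]
      by (cases "w x"; cases "w y") (auto simp: distrib_left simp del: w.val_eq_PInf_iff w.val_not_MInf)
    have *: "ereal c * a \<le> ereal c * b" if "a \<le> b" for a b
      using that assms(2) by (intro ereal_mult_left_mono) auto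
    show "min (ereal c * w x) (ereal c * w y) \<le> ereal c * w (x + y)"
      using w.val_add[of x y] *[of "w x" "w (x + y)"] *[of "w y" "w (x + y)"]
      by (auto simp: min_le_iff_disj)
  qed
qed

lemma q2bar_valuation_scaled:
  assumes w: "is_valuation w" and c: "c > 0" "\<And>x. w (to_ac x) = ereal c * val2 x"
  shows "w x = ereal c * val2bar x"
proof -
  have cc: "ereal (inverse c) * (ereal c * y) = y" for y
    using c(1) by (cases y) auto
  have "q2bar_valuation (\<lambda>x. ereal (inverse c) * w x)"
  proof
    show "is_valuation (\<lambda>x. ereal (inverse c) * w x)" using w c(1) by (intro is_valuation_scaled) auto
    show "ereal (inverse c) * w (to_ac x) = val2 x" for x by (simp only: c(2) cc)
  qed
  then have "(\<lambda>x. ereal (inverse c) * w x) = val2bar" by (rule q2bar_valuation_unique)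
  then have "ereal c * val2bar x = ereal c * (ereal (inverse c) * w x)" by metis
  also have "\<dots> = w x" using c(1) by (cases "w x") auto
  finally show ?thesis by simp
qed

text \<open>A competitor is \<open>c * val2bar\<close> by uniqueness, and its value group,
  \<open>c / e\<close> times the integers, equals the integers only for \<open>c = e\<close>, as
  \<open>c > 0\<close>.\<close>

lemma normalized_val_eq:
  assumes "has_ram_index L e"
  shows "normalized_val L = (\<lambda>x. ereal (real e) * val2bar x)"
proof -
  have e: "e > 0" and im: "val2bar ` (L - {0}) = range (\<lambda>n::int. ereal (of_int n / real e))"
    using assms by (auto simp: has_ram_index_def)
  let ?w = "\<lambda>x. ereal (real e) * val2bar x"
  have im_scale: "(\<lambda>x. ereal c * val2bar x) ` (L - {0}) = range (\<lambda>n::int. ereal (c * of_int n / real e))" for c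
  proof -
    have "(\<lambda>x. ereal c * val2bar x) ` (L - {0}) = (\<lambda>y. ereal c * y) ` val2bar ` (L - {0})"
      by (simp add: image_image)
    also have "\<dots> = range (\<lambda>n::int. ereal (c * of_int n / real e))"
      unfolding im image_image by simp
    finally show ?thesis .
  qed
  show ?thesis
    unfolding normalized_val_def
  proof (rule the_equality)
    have "is_valuation ?w" using e W.valuation by (intro is_valuation_scaled) auto
    moreover have "?w ` (L - {0}) = range (\<lambda>n::int. ereal (of_int n))"
      unfolding im_scale using e by simp
    ultimately show "is_valuation ?w \<and> (\<exists>c>0. \<forall>x. ?w (to_ac x) = ereal c * val2 x) \<and>
        ?w ` (L - {0}) = range (\<lambda>n::int. ereal (of_int n))"
      using e by (auto simp: W.val_to_ac intro!: exI[of _ "real e"])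
  next
    fix w assume w: "is_valuation w \<and> (\<exists>c>0. \<forall>x. w (to_ac x) = ereal c * val2 x) \<and>
        w ` (L - {0}) = range (\<lambda>n::int. ereal (of_int n))"
    then obtain c where c: "c > 0" "\<forall>x. w (to_ac x) = ereal c * val2 x" by blast
    have weq: "w = (\<lambda>x. ereal c * val2bar x)"
      using q2bar_valuation_scaled[of w c] w c by blast
    then have r: "range (\<lambda>n::int. ereal (c * of_int n / real e)) = range (\<lambda>n::int. ereal (of_int n))"
      using w im_scale by metis
    then have "ereal (of_int 1) \<in> range (\<lambda>n::int. ereal (c * of_int n / real e))"
      "ereal (c * of_int 1 / real e) \<in> range (\<lambda>n::int. ereal (of_int n))" by blast+
    then obtain m n :: int where "ereal (of_int 1) = ereal (c * of_int m / real e)"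
      "ereal (c * of_int 1 / real e) = ereal (of_int n)" by blast
    then have mn: "c * of_int m / real e = 1" "c / real e = of_int n"
      by (simp_all only: ereal.inject of_int_1 mult_1_right)
    then have nm: "real_of_int n * of_int m = 1" by (metis times_divide_eq_left)
    then have "n * m = 1" by (metis of_int_1 of_int_eq_iff of_int_mult)
    moreover have "0 < real_of_int n" using mn(2) c(1) e by (metis divide_pos_pos of_nat_0_less_iff)
    ultimately have "n = 1" by (auto simp: zmult_eq_1_iff)
    then have "c = real e" using mn(2) e by (simp add: field_simps)
    then show "w = ?w" using weq by simp
  qed
qed

lemma ram_index_eq:
  assumes "has_ram_index L e"
  shows "ram_index Q2 L = e"
proof -
  have e: "e > 0" using assms by (simp add: has_ram_index_def)
  have im: "normalized_val L ` (Q2 - {0}) = range (\<lambda>n::int. ereal (of_int (int e * n)))"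
  proof (intro equalityI subsetI)
    fix y assume "y \<in> normalized_val L ` (Q2 - {0})"
    then obtain x where "x \<in> Q2" "x \<noteq> 0" "y = ereal (real e) * val2bar x"
      by (auto simp: normalized_val_eq[OF assms])
    then obtain c where "c \<noteq> 0" "y = ereal (real e) * val2 c"
      by (auto simp: W.val_to_ac)
    then show "y \<in> range (\<lambda>n::int. ereal (of_int (int e * n)))"
      by (auto simp: val2_def)
  next
    fix y assume "y \<in> range (\<lambda>n::int. ereal (of_int (int e * n)))"
    then obtain n :: int where "y = ereal (of_int (int e * n))" by blast
    then have "y = normalized_val L (to_ac (2 powi n))"
      by (simp add: normalized_val_eq[OF assms] W.val_to_ac val2_2_powi)
    moreover have "to_ac (2 powi n :: q2) \<in> Q2 - {0}" by simp
    ultimately show "y \<in> normalized_val L ` (Q2 - {0})" by blast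
  qed
  show ?thesis
    unfolding ram_index_def
  proof (rule the_equality)
    fix e' :: nat assume e': "e' > 0 \<and> normalized_val L ` (Q2 - {0}) = range (\<lambda>n::int. ereal (of_int (int e' * n)))"
    then have r: "range (\<lambda>n::int. ereal (of_int (int e * n))) = range (\<lambda>n::int. ereal (of_int (int e' * n)))"
      using im by simp
    have "ereal (of_int (int e * 1)) \<in> range (\<lambda>n::int. ereal (of_int (int e' * n)))"
      "ereal (of_int (int e' * 1)) \<in> range (\<lambda>n::int. ereal (of_int (int e * n)))"
      using r by blast+
    then obtain m n where "ereal (of_int (int e * 1)) = ereal (of_int (int e' * m))"
      "ereal (of_int (int e' * 1)) = ereal (of_int (int e * n))" by blast
    then have "int e = int e' * m" "int e' = int e * n"
      by (simp_all only: ereal.inject of_int_eq_iff mult_1_right)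
    then have "int e' dvd int e" "int e dvd int e'" by (metis dvd_triv_left)+
    then show "e' = e" by (simp add: dvd_antisym)
  qed (use im e in simp)
qed

lemma has_ram_indexI:
  assumes L: "is_subring L" "Q2 \<subseteq> L" and "e > 0" and p: "p \<in> L" "val2bar p = ereal (1 / real e)"
    and "\<And>x. x \<in> L \<Longrightarrow> x \<noteq> 0 \<Longrightarrow> \<exists>n::int. val2bar x = ereal (of_int n / real e)"
  shows "has_ram_index L e"
  unfolding has_ram_index_def
proof (intro conjI equalityI subsetI)
  fix y assume "y \<in> range (\<lambda>n::int. ereal (of_int n / real e))"
  then obtain n :: int where n: "y = ereal (of_int n / real e)" by blast
  have p0: "p \<noteq> 0" using p(2) by auto
  obtain k l :: nat where kl: "n = int k - int l" by (metis int_diff_cases)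
  have "val2bar (p ^ k / p ^ l) = y"
    using p0 assms(3) by (simp add: W.val_divide W.val_power p(2) n kl diff_divide_distrib)
  moreover have "p ^ k / p ^ l \<in> L - {0}"
    using p0 L p(1) by (auto intro!: subring_divide subring_power)
  ultimately show "y \<in> val2bar ` (L - {0})" by blast
qed (use assms in auto)

section \<open>Embeddings over a base field\<close>

context
  fixes K L :: "q2bar set" and \<sigma> :: "q2bar \<Rightarrow> q2bar"
  assumes K: "is_subring K" "Q2 \<subseteq> K" and L: "is_subring L" "K \<subseteq> L" and \<sigma>: "\<sigma> \<in> embeddings K L"
begin

lemma embedding_add: "x \<in> L \<Longrightarrow> y \<in> L \<Longrightarrow> \<sigma> (x + y) = \<sigma> x + \<sigma> y"
  using ring_hom_add[of \<sigma> "Q2bar\<lparr>carrier := L\<rparr>" Q2bar x y] \<sigma> by (simp add: embeddings_def)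

lemma embedding_mult: "x \<in> L \<Longrightarrow> y \<in> L \<Longrightarrow> \<sigma> (x * y) = \<sigma> x * \<sigma> y"
  using ring_hom_mult[of \<sigma> "Q2bar\<lparr>carrier := L\<rparr>" Q2bar x y] \<sigma> by (simp add: embeddings_def)

lemma embedding_base: "x \<in> K \<Longrightarrow> \<sigma> x = x"
  using \<sigma> by (simp add: embeddings_def)

lemma embedding_diff:
  assumes "x \<in> L" "y \<in> L"
  shows "\<sigma> (x - y) = \<sigma> x - \<sigma> y"
  using embedding_add[OF subring_diff[OF L(1) assms] assms(2)] by simp

lemma embedding_eq_0_iff: "x \<in> L \<Longrightarrow> \<sigma> x = 0 \<longleftrightarrow> x = 0"
proof
  assume x: "x \<in> L" "\<sigma> x = 0"
  have inv: "inverse x \<in> L" using inverse_in_subring[OF L(1)] K L x by blast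
  show "x = 0"
  proof (rule ccontr)
    assume "x \<noteq> 0"
    then have "\<sigma> x * \<sigma> (inverse x) = 1"
      using embedding_mult[OF x(1) inv] embedding_base[OF subring_1[OF K(1)]] by simp
    then show False using x by simp
  qed
next
  show "x = 0 \<Longrightarrow> \<sigma> x = 0" using embedding_base[OF subring_0[OF K(1)]] by simp
qed

lemma embedding_poly:
  assumes x: "x \<in> L" and f: "f \<in> polys_over K"
  shows "\<sigma> (poly f x) = poly f (\<sigma> x)" "poly f x \<in> L"
proof -
  have "\<sigma> (poly f x) = poly f (\<sigma> x) \<and> poly f x \<in> L"
    using f
  proof (induction f)
    case 0
    then show ?case using embedding_eq_0_iff subring_0[OF L(1)] by simp
  next
    case (pCons a p)
    have a: "a \<in> K" and p: "p \<in> polys_over K"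
      using pCons.prems by (auto simp: polys_over_def coeff_pCons split: nat.splits)
    then have IH: "\<sigma> (poly p x) = poly p (\<sigma> x)" "poly p x \<in> L" using pCons.IH by auto
    have xp: "x * poly p x \<in> L" using subring_mult[OF L(1) x IH(2)] .
    have aL: "a \<in> L" using a L by blast
    show ?case using embedding_add[OF aL xp] embedding_mult[OF x IH(2)] IH embedding_base[OF a]
        subring_add[OF L(1) aL xp] by simp
  qed
  then show "\<sigma> (poly f x) = poly f (\<sigma> x)" "poly f x \<in> L" by auto
qed

lemma embedding_root:
  assumes "x \<in> L" "f \<in> polys_over K"
  shows "poly f (\<sigma> x) = 0 \<longleftrightarrow> poly f x = 0"
  using embedding_poly[OF assms] embedding_eq_0_iff by metis

text \<open>An element and its image satisfy the same polynomials over \<open>Q2\<close>, so this is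
  conjugation invariance of the prolongation.\<close>

lemma embedding_val:
  assumes "x \<in> L"
  shows "val2bar (\<sigma> x) = val2bar x"
proof (rule conjugate_val_eq[OF W.q2bar_valuation_axioms W.q2bar_valuation_axioms])
  fix f
  have "map_poly to_ac f \<in> polys_over K"
    using subsetD[OF K(2) to_ac_Q2] by (simp add: polys_over_def coeff_map_poly)
  then show "ev f (\<sigma> x) = 0 \<longleftrightarrow> ev f x = 0" by (rule embedding_root[OF assms])
qed

lemma embedding_eq_idI:
  assumes "L = adjoin K T" "\<And>x. x \<in> T \<Longrightarrow> \<sigma> x = x"
  shows "\<sigma> = restrict id L"
proof -
  define S where "S = {x \<in> L. \<sigma> x = x}"
  have "is_subring S"
    unfolding is_subring_def S_def using L(1) embedding_base[OF subring_1[OF K(1)]]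
    by (auto simp: embedding_diff embedding_mult intro: subring_closed)
  moreover have "K \<subseteq> S" using L(2) embedding_base by (auto simp: S_def)
  moreover have "T \<subseteq> S" using assms adjoin_upper(2)[of T K] by (auto simp: S_def)
  ultimately have "L \<subseteq> S" unfolding assms(1) using adjoin_least K(2) by blast
  moreover have "\<sigma> \<in> extensional L" using \<sigma> by (simp add: embeddings_def)
  ultimately show ?thesis by (intro extensionalityI[of \<sigma> L]) (auto simp: S_def)
qed

end

lemma id_embedding:
  assumes "is_subring L" "K \<subseteq> L"
  shows "restrict id L \<in> embeddings K L"
  unfolding embeddings_def
proof (intro CollectI conjI ballI)
  show "restrict id L \<in> Ring.ring_hom (Q2bar\<lparr>carrier := L\<rparr>) Q2bar"
    using assms(1) by (intro ring_hom_memI) (auto intro: subring_closed)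
qed (use assms in auto)

lemma embeddings_mono: "K \<subseteq> K' \<Longrightarrow> embeddings K' L \<subseteq> embeddings K L"
  by (auto simp: embeddings_def)

text \<open>The image of \<open>f(x)\<close> is \<open>f(x')\<close>; \<open>conj\<close>, applied
  to the difference of two representations, makes it independent of \<open>f\<close>.\<close>

lemma conjugate_embedding:
  assumes K: "is_subring K" "Q2 \<subseteq> K"
    and conj: "\<And>f. f \<in> polys_over K \<Longrightarrow> poly f x = 0 \<Longrightarrow> poly f x' = 0"
  obtains \<sigma> where "\<sigma> \<in> embeddings K (adjoin_elem K x)" "\<sigma> x = x'"
proof -
  define L where "L = adjoin_elem K x"
  have L: "is_subring L" "K \<subseteq> L" "x \<in> L"
    unfolding L_def using adjoin_elem_subring adjoin_elem_base adjoin_elem_self K by blast+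
  define \<sigma> where "\<sigma> = restrict (\<lambda>y. poly (SOME f. f \<in> polys_over K \<and> poly f x = y) x') L"
  have \<sigma>: "\<sigma> (poly f x) = poly f x'" if f: "f \<in> polys_over K" for f
  proof -
    define g where "g = (SOME g. g \<in> polys_over K \<and> poly g x = poly f x)"
    have g: "g \<in> polys_over K \<and> poly g x = poly f x"
      unfolding g_def by (rule someI[of _ f]) (simp add: f)
    then have "poly (g - f) x' = 0"
      using subring_diff[OF polys_over_subring[OF K(1)]] f by (intro conj) auto
    then show ?thesis using f by (simp add: \<sigma>_def g_def L_def adjoin_elem_def)
  qed
  have fL: "\<exists>f\<in>polys_over K. y = poly f x" if "y \<in> L" for y
    using that by (auto simp: L_def adjoin_elem_def)
  note P = polys_over_subring[OF K(1)]
  have const: "[:c:] \<in> polys_over K" if "c \<in> K" for c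
    using that by (intro pCons_in_polys_over zero_in_polys_over K(1))
  have "\<sigma> \<in> Ring.ring_hom (Q2bar\<lparr>carrier := L\<rparr>) Q2bar"
  proof (intro ring_hom_memI)
    fix y z assume "y \<in> carrier (Q2bar\<lparr>carrier := L\<rparr>)" "z \<in> carrier (Q2bar\<lparr>carrier := L\<rparr>)"
    then have "y \<in> L" "z \<in> L" by simp_all
    then obtain f g where fg: "f \<in> polys_over K" "y = poly f x" "g \<in> polys_over K" "z = poly g x"
      using fL[of y] fL[of z] by blast
    show "\<sigma> (y \<otimes>\<^bsub>Q2bar\<lparr>carrier := L\<rparr>\<^esub> z) = \<sigma> y \<otimes>\<^bsub>Q2bar\<^esub> \<sigma> z"
      using \<sigma>[OF subring_mult[OF P fg(1,3)]] \<sigma>[OF fg(1)] \<sigma>[OF fg(3)] fg by simp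
    show "\<sigma> (y \<oplus>\<^bsub>Q2bar\<lparr>carrier := L\<rparr>\<^esub> z) = \<sigma> y \<oplus>\<^bsub>Q2bar\<^esub> \<sigma> z"
      using \<sigma>[OF subring_add[OF P fg(1,3)]] \<sigma>[OF fg(1)] \<sigma>[OF fg(3)] fg by simp
  next
    show "\<sigma> \<one>\<^bsub>Q2bar\<lparr>carrier := L\<rparr>\<^esub> = \<one>\<^bsub>Q2bar\<^esub>" using \<sigma>[OF subring_1[OF P]] by simp
  qed simp
  moreover have "\<sigma> c = c" if "c \<in> K" for c using \<sigma>[OF const[OF that]] by simp
  moreover have "\<sigma> \<in> extensional L" by (simp add: \<sigma>_def)
  ultimately have "\<sigma> \<in> embeddings K L" by (simp add: embeddings_def)
  moreover have "[:0, 1:] \<in> polys_over K"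
    using K(1) by (intro pCons_in_polys_over zero_in_polys_over subring_0 subring_1)
  then have "\<sigma> x = x'" using \<sigma>[of "[:0, 1:]"] by simp
  ultimately show ?thesis using that L_def by blast
qed

text \<open>A lower bound for an infimum is a bound for each member, so no minimum has to be
  attained. Division by \<open>e\<close> passes from the normalised valuation to
  \<open>val2bar\<close>.\<close>

lemma lower_ram_iff:
  assumes "has_ram_index L e"
  shows "\<sigma> \<in> lower_ram K L y \<longleftrightarrow> \<sigma> \<in> embeddings K L \<and>
     (\<forall>a\<in>L. 0 \<le> val2bar a \<longrightarrow> ereal ((y + 1) / real e) \<le> val2bar (\<sigma> a - a))"
proof -
  have e: "real e > 0" using assms by (simp add: has_ram_index_def)
  have 1: "0 \<le> ereal (real e) * v \<longleftrightarrow> 0 \<le> v" for v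
    using e by (cases v) (auto simp: zero_le_mult_iff)
  have 2: "ereal (y + 1) \<le> ereal (real e) * v \<longleftrightarrow> ereal ((y + 1) / real e) \<le> v" for v
    using e by (cases v) (auto simp: field_simps)
  show ?thesis
    unfolding lower_ram_def ram_number_def normalized_val_eq[OF assms]
    by (auto simp: le_INF_iff 1 2)
qed

lemma lower_ram_mono: "y \<le> z \<Longrightarrow> lower_ram K L z \<subseteq> lower_ram K L y"
  unfolding lower_ram_def by (auto intro: order.trans[of "ereal (y + 1)" "ereal (z + 1)"])

lemma id_in_lower_ram:
  assumes "has_ram_index L e" "is_subring L" "K \<subseteq> L"
  shows "restrict id L \<in> lower_ram K L y"
  using id_embedding[OF assms(2,3)] by (simp add: lower_ram_iff[OF assms(1)])

text \<open>The Herbrand function is explicit, since between \<open>0\<close> and the last lower break \<open>t\<close> the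
  ramification groups have order \<open>e\<close>.\<close>

lemma max_upper_break_eq:
  assumes e: "has_ram_index L e" and L: "is_subring L" "Q2 \<subseteq> L" "L \<noteq> Q2" and t: "-1 \<le> t"
    and mid: "\<And>y. 0 < y \<Longrightarrow> y \<le> t \<Longrightarrow> card (lower_ram Q2 L y) = e"
    and high: "\<And>y. t < y \<Longrightarrow> lower_ram Q2 L y = {restrict id L}"
    and at_t: "lower_ram Q2 L t \<noteq> {restrict id L}"
  shows "max_upper_break Q2 L = ereal (t + 1)"
proof -
  \<comment> \<open>\<open>t\<close> is \<open>-1\<close> in the unramified case while integration
    starts at 0, so the kink of the Herbrand function is at \<open>max t 0\<close>.\<close>
  define t' where "t' = max t 0"
  have e0: "real e > 0" using e by (simp add: has_ram_index_def)
  let ?f = "\<lambda>y. real (card (lower_ram Q2 L y))"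
  have low_int: "(?f has_integral real e * m) {0..m}" if "0 \<le> m" "m \<le> t'" for m
  proof -
    have "((\<lambda>_. real e) has_integral real e * m) {0..m}"
      using has_integral_const_real[of "real e" 0 m] that by (simp add: mult.commute)
    then show ?thesis
    proof (rule has_integral_spike_finite[of "{0}", rotated 2])
      fix y assume "y \<in> {0..m} - {0}"
      then have "0 < y" "y \<le> max t 0" using that by (auto simp: t'_def)
      then show "?f y = real e" using mid[of y] by (auto simp: le_max_iff_disj)
    qed simp
  qed
  have high_int: "(?f has_integral (m - t')) {t'..m}" if "t' \<le> m" for m
  proof -
    have "((\<lambda>_. 1) has_integral (m - t')) {t'..m}"
      using has_integral_const_real[of "1::real" t' m] that by simp
    then show ?thesis
    proof (rule has_integral_spike_finite[of "{t'}", rotated 2])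
      fix y assume "y \<in> {t'..m} - {t'}"
      then show "?f y = 1" using high[of y] by (auto simp: t'_def)
    qed simp
  qed
  \<comment> \<open>The slope is \<open>e / e = 1\<close> up to \<open>t'\<close> and
    \<open>1 / e\<close> beyond, where only the inclusion is left.\<close>
  define \<phi> where "\<phi> m = (if m \<le> t' then m else t' + (m - t') / real e)" for m
  have phi: "herbrand_phi Q2 L m = \<phi> m" for m
  proof -
    consider "m \<le> 0" | "0 < m" "m \<le> t'" | "t' < m" by linarith
    then show ?thesis
    proof cases
      case 1
      then show ?thesis by (auto simp: herbrand_phi_def \<phi>_def t'_def)
    next
      case 2
      then have "integral {0..m} ?f = real e * m" using low_int by (intro integral_unique) auto
      then show ?thesis using 2 e0 by (simp add: herbrand_phi_def \<phi>_def ram_index_eq[OF e])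
    next
      case 3
      have t'0: "0 \<le> t'" by (simp add: t'_def)
      have "(?f has_integral (real e * t' + (m - t'))) {0..m}"
        using 3 t'0 low_int[of t'] high_int[of m] by (intro has_integral_combine[of 0 t' m]) auto
      then have "integral {0..m} ?f = real e * t' + (m - t')" by (rule integral_unique)
      then show ?thesis using 3 t'0 e0
        by (simp add: herbrand_phi_def \<phi>_def ram_index_eq[OF e] add_divide_distrib)
    qed
  qed
  define \<psi> where "\<psi> m = (if m \<le> t' then m else t' + (m - t') * real e)" for m
  have \<phi>\<psi>: "\<phi> (\<psi> m) = m" for m
    using e0 by (auto simp: \<phi>_def \<psi>_def zero_less_mult_iff field_simps)
  have \<psi>\<phi>: "\<psi> (\<phi> m) = m" for m
    using e0 by (auto simp: \<phi>_def \<psi>_def divide_le_0_iff)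
  have tt': "0 \<le> t'" "t \<le> t'" by (simp_all add: t'_def)
  have psi_gt: "t' < \<psi> m" if "t' < m" for m
    using that mult_pos_pos[of "m - t'" "real e"] e0 by (simp add: \<psi>_def)
  have psi: "herbrand_psi Q2 L m = \<psi> m" if "-1 \<le> m" for m
  proof -
    have "inj_on (herbrand_phi Q2 L) {-1..}"
      by (rule inj_on_inverseI[of _ \<psi>]) (simp add: phi \<psi>\<phi>)
    moreover have "-1 \<le> \<psi> m" using that psi_gt[of m] tt' by (cases "m \<le> t'") (auto simp: \<psi>_def)
    ultimately show ?thesis
      unfolding herbrand_psi_def by (intro the_inv_into_f_eq) (auto simp: phi \<phi>\<psi>)
  qed
  have nontriv: "upper_ram_shifted Q2 L m \<noteq> {restrict id L} \<longleftrightarrow> m \<le> t + 1" if "0 \<le> m" for m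
  proof (cases "m \<le> t + 1")
    case True
    then have "m - 1 \<le> t'" using tt' by linarith
    then have "\<psi> (m - 1) = m - 1" by (simp add: \<psi>_def)
    then have "lower_ram Q2 L t \<subseteq> upper_ram_shifted Q2 L m"
      using True that lower_ram_mono[of "m - 1" t Q2 L]
      by (simp add: upper_ram_shifted_def upper_ram_def psi)
    moreover have "restrict id L \<in> lower_ram Q2 L t" by (rule id_in_lower_ram[OF e L(1,2)])
    ultimately show ?thesis using at_t True by blast
  next
    case False
    then have "t < \<psi> (m - 1)" using psi_gt[of "m - 1"] tt' by (cases "m - 1 \<le> t'") (auto simp: \<psi>_def)
    then show ?thesis using False that high by (simp add: upper_ram_shifted_def upper_ram_def psi)
  qed
  have "{m. 0 \<le> m \<and> upper_ram_shifted Q2 L m \<noteq> {restrict id L}} = {m. 0 \<le> m \<and> m \<le> t + 1}"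
    by (rule Collect_cong, rule conj_cong[OF refl], erule nontriv)
  also have "\<dots> = {0..t + 1}" by auto
  finally have "{m. 0 \<le> m \<and> upper_ram_shifted Q2 L m \<noteq> {restrict id L}} = {0..t + 1}" .
  moreover have "Sup (ereal ` {0..t + 1}) = ereal (t + 1)"
    by (rule Sup_eqI) (use t in auto)
  ultimately show ?thesis using L(3) by (simp add: max_upper_break_def)
qed

text \<open>Quotient and remainder must keep their coefficients in \<open>K\<close>; a monic
  \<open>f\<close> lets leading terms be removed without dividing.\<close>

lemma monic_reduce:
  fixes f g :: "'a::idom poly"
  assumes K: "is_subring K" and f: "f \<in> polys_over K" "Polynomial.lead_coeff f = 1" "0 < Polynomial.degree f"
    and g: "g \<in> polys_over K"
  shows "\<exists>q\<in>polys_over K. \<exists>r\<in>polys_over K. g = q * f + r \<and> Polynomial.degree r < Polynomial.degree f"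
  using g
proof (induction "Polynomial.degree g" arbitrary: g rule: less_induct)
  case less
  note P = polys_over_subring[OF K]
  show ?case
  proof (cases "Polynomial.degree g < Polynomial.degree f")
    case True
    then show ?thesis using less.prems subring_0[OF P] by (intro bexI[of _ 0] bexI[of _ g]) auto
  next
    case False
    define m where "m = Polynomial.monom (Polynomial.lead_coeff g) (Polynomial.degree g - Polynomial.degree f)"
    have g0: "g \<noteq> 0" using False f(3) by auto
    have m: "m \<in> polys_over K"
      unfolding m_def using less.prems by (intro monom_in_polys_over K) (simp add: polys_over_def)
    define h where "h = g - m * f"
    have h: "h \<in> polys_over K" unfolding h_def using less.prems m f(1) P by (intro subring_closed)
    have f0: "f \<noteq> 0" using f(3) by auto
    have m0: "m \<noteq> 0" "Polynomial.degree m = Polynomial.degree g - Polynomial.degree f"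
      using g0 by (simp_all add: m_def degree_monom_eq)
    have dmf: "Polynomial.degree (m * f) = Polynomial.degree g"
      using False m0 f0 by (simp add: degree_mult_eq)
    have "Polynomial.lead_coeff (m * f) = Polynomial.lead_coeff g"
      using f(2) g0 by (simp add: lead_coeff_mult m_def degree_monom_eq)
    then have "Polynomial.coeff (m * f) (Polynomial.degree g) = Polynomial.lead_coeff g"
      by (simp only: dmf)
    then have "Polynomial.degree h < Polynomial.degree g"
      unfolding h_def using False f(3) dmf
      by (intro degree_lessI) (auto simp: coeff_eq_0 le_less)
    then obtain q r where qr: "q \<in> polys_over K" "r \<in> polys_over K" "h = q * f + r"
      "Polynomial.degree r < Polynomial.degree f"
      using less.hyps[OF _ h] by blast
    have "g = (q + m) * f + r" using qr(3) by (simp add: h_def algebra_simps)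
    then show ?thesis using qr m subring_add[OF P qr(1) m] by blast
  qed
qed

lemma adjoin_elem_reduced:
  fixes f :: "'a::idom poly"
  assumes K: "is_subring K" and f: "f \<in> polys_over K" "Polynomial.lead_coeff f = 1" "0 < Polynomial.degree f"
    and root: "poly f x = 0" and y: "y \<in> adjoin_elem K x"
  obtains r where "r \<in> polys_over K" "Polynomial.degree r < Polynomial.degree f" "y = poly r x"
proof -
  obtain g where g: "g \<in> polys_over K" "y = poly g x" using y by (auto simp: adjoin_elem_def)
  obtain q r where "q \<in> polys_over K" "r \<in> polys_over K" "g = q * f + r"
    "Polynomial.degree r < Polynomial.degree f"
    using monic_reduce[OF K f g(1)] by blast
  then show ?thesis using that root g(2) by simp
qed

text \<open>\<open>indep\<close> makes \<open>f\<close> the minimal polynomial of \<open>x\<close>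
  over \<open>K\<close>, so \<open>f\<close> divides \<open>g\<close>.\<close>

lemma roots_conjugate:
  fixes f :: "'a::idom poly"
  assumes K: "is_subring K" and f: "f \<in> polys_over K" "Polynomial.lead_coeff f = 1" "0 < Polynomial.degree f"
    and indep: "\<And>r. r \<in> polys_over K \<Longrightarrow> Polynomial.degree r < Polynomial.degree f \<Longrightarrow> poly r x = 0 \<Longrightarrow> r = 0"
    and root: "poly f x = 0" "poly f x' = 0" and g: "g \<in> polys_over K" "poly g x = 0"
  shows "poly g x' = 0"
proof -
  obtain q r where "q \<in> polys_over K" "r \<in> polys_over K" "g = q * f + r"
    "Polynomial.degree r < Polynomial.degree f"
    using monic_reduce[OF K f g(1)] by blast
  then show ?thesis using indep[of r] root g(2) by simp
qed

lemma has_ram_index_int: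
  assumes "has_ram_index K 1" "c \<in> K" "c \<noteq> 0"
  obtains m :: int where "val2bar c = ereal (of_int m)"
proof -
  have "val2bar c \<in> range (\<lambda>n::int. ereal (of_int n / real 1))"
    using assms unfolding has_ram_index_def by blast
  then show ?thesis using that by auto
qed

lemma has_ram_index_Q2: "has_ram_index Q2 1"
proof (rule has_ram_indexI[where p = "to_ac 2"])
  show "val2bar (to_ac 2) = ereal (1 / real 1)"
    using val2_2_power[of 1] by (simp only: W.val_to_ac) simp
  fix x assume "x \<in> Q2" "x \<noteq> 0"
  then obtain c where "x = to_ac c" "c \<noteq> 0" by auto
  then show "\<exists>n::int. val2bar x = ereal (of_int n / real 1)" by (auto simp: W.val_to_ac val2_def)
qed (simp_all add: Q2_subring del: to_ac_numeral)

section \<open>Extensions generated by a uniformizer over an unramified base\<close>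

context
  fixes K :: "q2bar set" and \<pi> :: q2bar and n :: nat
  assumes K: "is_subring K" "Q2 \<subseteq> K" "has_ram_index K 1"
    and n: "n > 0" and \<pi>: "val2bar \<pi> = ereal (1 / real n)"
begin

text \<open>The Eisenstein argument: a nonzero \<open>c * \<pi> ^ i\<close> with \<open>c\<close> in
  \<open>K\<close> has valuation in \<open>i / n\<close> plus an integer, so for
  \<open>i < n\<close> the terms have different valuations and cannot cancel.\<close>

lemma uniformizer_expansion:
  assumes r: "r \<in> polys_over K" "Polynomial.degree r < n"
  shows "val2bar (poly r \<pi>) \<le> val2bar (Polynomial.coeff r i) + ereal (real i / real n)"
    and "r \<noteq> 0 \<Longrightarrow> \<exists>m::int. val2bar (poly r \<pi>) = ereal (of_int m / real n)"
proof -
  define f where "f i = Polynomial.coeff r i * \<pi> ^ i" for i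
  have sum: "poly r \<pi> = sum f {..<n}"
  proof -
    have "poly r \<pi> = (\<Sum>i\<le>Polynomial.degree r. f i)" by (simp add: poly_altdef f_def)
    also have "\<dots> = sum f {..<n}"
      using r(2) by (intro sum.mono_neutral_left) (auto simp: f_def coeff_eq_0)
    finally show ?thesis .
  qed
  have vf: "val2bar (f i) = val2bar (Polynomial.coeff r i) + ereal (real i / real n)" for i
    by (simp add: f_def W.val_mult W.val_power \<pi>)
  have vf': "\<exists>m::int. val2bar (f i) = ereal (of_int (m * int n + int i) / real n)" if "f i \<noteq> 0" for i
  proof -
    have "Polynomial.coeff r i \<in> K" "Polynomial.coeff r i \<noteq> 0"
      using r that by (auto simp: polys_over_def f_def)
    then obtain m :: int where "val2bar (Polynomial.coeff r i) = ereal (of_int m)"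
      using has_ram_index_int K(3) by blast
    then have "val2bar (f i) = ereal (of_int (m * int n + int i) / real n)"
      using n by (simp add: vf add_divide_distrib)
    then show ?thesis by blast
  qed
  have distinct: "val2bar (f i) \<noteq> val2bar (f j)" if ij: "i \<in> {..<n}" "j \<in> {..<n}" "i \<noteq> j" "f i \<noteq> 0" for i j
  proof
    assume eq: "val2bar (f i) = val2bar (f j)"
    then have "f j \<noteq> 0" using ij(4) by (metis W.val_eq_PInf_iff)
    obtain k :: int where k: "val2bar (f i) = ereal (of_int (k * int n + int i) / real n)"
      using vf'[OF ij(4)] by blast
    obtain l :: int where l: "val2bar (f j) = ereal (of_int (l * int n + int j) / real n)"
      using vf'[OF \<open>f j \<noteq> 0\<close>] by blast
    have "real_of_int (k * int n + int i) = of_int (l * int n + int j)"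
      using eq n unfolding k l by (simp del: of_int_add of_int_mult)
    then have "k * int n + int i = l * int n + int j" by (simp only: of_int_eq_iff)
    then have "(k * int n + int i) mod int n = (l * int n + int j) mod int n" by simp
    then show False using ij by simp
  qed
  note D = W.val_sum_distinct[of "{..<n}" f, OF finite_lessThan distinct]
  show "val2bar (poly r \<pi>) \<le> val2bar (Polynomial.coeff r i) + ereal (real i / real n)"
  proof (cases "i < n")
    case True
    then show ?thesis unfolding sum vf [symmetric] using D(1) by blast
  next
    case False
    then have "Polynomial.coeff r i = 0" using r(2) by (simp add: coeff_eq_0)
    then show ?thesis by simp
  qed
  show "\<exists>m::int. val2bar (poly r \<pi>) = ereal (of_int m / real n)" if "r \<noteq> 0"
  proof -
    have \<pi>0: "\<pi> \<noteq> 0" using \<pi> by auto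
    have "sum f {..<n} \<noteq> 0"
    proof
      assume "sum f {..<n} = 0"
      then have "val2bar (f (Polynomial.degree r)) = \<infinity>" using D(1) r(2) by auto
      then show False using that \<pi>0 by (simp add: f_def)
    qed
    then obtain i where "i < n" "val2bar (sum f {..<n}) = val2bar (f i)" using D(2) by blast
    moreover have "f i \<noteq> 0" using \<open>sum f {..<n} \<noteq> 0\<close> calculation(2) by (metis W.val_eq_PInf_iff)
    ultimately show ?thesis using vf' sum by metis
  qed
qed

lemma uniformizer_powers_indep:
  assumes "r \<in> polys_over K" "Polynomial.degree r < n" "poly r \<pi> = 0"
  shows "r = 0"
  using uniformizer_expansion(2)[OF assms(1,2)] assms(3) by auto

context
  fixes f :: "q2bar poly"
  assumes f: "f \<in> polys_over K" "Polynomial.lead_coeff f = 1" "Polynomial.degree f = n" "poly f \<pi> = 0"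
begin

lemma uniformizer_extension_ram_index: "has_ram_index (adjoin_elem K \<pi>) n"
proof (rule has_ram_indexI)
  show "is_subring (adjoin_elem K \<pi>)" "Q2 \<subseteq> adjoin_elem K \<pi>" "\<pi> \<in> adjoin_elem K \<pi>"
    using adjoin_elem_subring adjoin_elem_base adjoin_elem_self K by blast+
  show "\<exists>m::int. val2bar y = ereal (of_int m / real n)" if y: "y \<in> adjoin_elem K \<pi>" "y \<noteq> 0" for y
  proof -
    obtain r where r: "r \<in> polys_over K" "Polynomial.degree r < n" "y = poly r \<pi>"
      using adjoin_elem_reduced[OF K(1) f(1,2) _ f(4) y(1)] f(3) n by auto
    then have "r \<noteq> 0" using y(2) by auto
    then show ?thesis using uniformizer_expansion(2) r by blast
  qed
qed (fact n \<pi>)+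

text \<open>Integral elements have integral coefficients in the powers of \<open>\<pi>\<close>, and
  \<open>p ^ i - \<pi> ^ i\<close> is an integral multiple of \<open>p - \<pi>\<close> for
  \<open>p = \<sigma> \<pi>\<close>. Hence ramification numbers over \<open>K\<close> are read at
  the uniformizer alone.\<close>

lemma uniformizer_ram_number:
  assumes \<sigma>: "\<sigma> \<in> embeddings K (adjoin_elem K \<pi>)" and a: "a \<in> adjoin_elem K \<pi>" "0 \<le> val2bar a"
  shows "val2bar (\<sigma> \<pi> - \<pi>) \<le> val2bar (\<sigma> a - a)"
proof -
  let ?L = "adjoin_elem K \<pi>"
  have L: "is_subring ?L" "K \<subseteq> ?L" "\<pi> \<in> ?L"
    using adjoin_elem_subring adjoin_elem_base adjoin_elem_self K by blast+
  obtain r where r: "r \<in> polys_over K" "Polynomial.degree r < n" "a = poly r \<pi>"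
    using adjoin_elem_reduced[OF K(1) f(1,2) _ f(4) a(1)] f(3) n by auto
  define p where "p = \<sigma> \<pi>"
  have p: "val2bar p = ereal (1 / real n)"
    unfolding p_def using embedding_val[OF K(1,2) L(1,2) \<sigma> L(3)] \<pi> by simp
  have pow: "val2bar (p - \<pi>) \<le> val2bar (p ^ i - \<pi> ^ i)" for i
  proof (induction i)
    case (Suc i)
    have p0: "0 \<le> val2bar p" "0 \<le> val2bar (\<pi> ^ i)" using p \<pi> by (auto intro!: W.val_power_ge)
    have "p ^ Suc i - \<pi> ^ Suc i = p * (p ^ i - \<pi> ^ i) + \<pi> ^ i * (p - \<pi>)"
      by (simp add: algebra_simps)
    moreover have "val2bar (p - \<pi>) \<le> val2bar (p * (p ^ i - \<pi> ^ i))"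
      unfolding W.val_mult using Suc p0(1) by (metis add.left_neutral add_mono)
    moreover have "val2bar (p - \<pi>) \<le> val2bar (\<pi> ^ i * (p - \<pi>))"
      unfolding W.val_mult using p0(2) by (metis add.left_neutral add_right_mono)
    ultimately show ?case using W.val_add_ge by simp
  qed simp
  \<comment> \<open>A nonzero coefficient has integer valuation \<open>m\<close>, and
    \<open>m + i / n \<ge> 0\<close> with \<open>i < n\<close> rules out
    \<open>m \<le> -1\<close>.\<close>
  have c0: "0 \<le> val2bar (Polynomial.coeff r i)" if "i \<le> Polynomial.degree r" for i
  proof (cases "Polynomial.coeff r i = 0")
    case False
    then obtain m :: int where m: "val2bar (Polynomial.coeff r i) = ereal (of_int m)"
      using has_ram_index_int[OF K(3)] r(1) by (auto simp: polys_over_def)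
    have "0 \<le> val2bar (Polynomial.coeff r i) + ereal (real i / real n)"
      using uniformizer_expansion(1)[OF r(1,2), of i] a(2) r(3) by (metis order.trans)
    moreover have "real i / real n < 1" using that r(2) n by simp
    ultimately have "- 1 < real_of_int m" using m by simp
    then have "0 \<le> m" by linarith
    then show ?thesis using m by simp
  qed simp
  have "\<sigma> a - a = poly r p - poly r \<pi>"
    unfolding r(3) p_def using embedding_poly(1)[OF K(1,2) L(1,2) \<sigma> L(3) r(1)] by simp
  also have "\<dots> = (\<Sum>i\<le>Polynomial.degree r. Polynomial.coeff r i * (p ^ i - \<pi> ^ i))"
    by (simp add: poly_altdef algebra_simps sum_subtractf)
  also have "val2bar (p - \<pi>) \<le> val2bar \<dots>"
  proof (rule W.val_sum_ge)
    fix i assume "i \<in> {..Polynomial.degree r}"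
    then show "val2bar (p - \<pi>) \<le> val2bar (Polynomial.coeff r i * (p ^ i - \<pi> ^ i))"
      unfolding W.val_mult using pow[of i] c0[of i] by (metis add.left_neutral add_mono atMost_iff)
  qed
  finally show ?thesis by (simp add: p_def)
qed

lemma uniformizer_embedding:
  assumes "poly f \<pi>' = 0"
  obtains \<sigma> where "\<sigma> \<in> embeddings K (adjoin_elem K \<pi>)" "\<sigma> \<pi> = \<pi>'"
proof (rule conjugate_embedding[OF K(1,2)])
  show "poly g \<pi>' = 0" if "g \<in> polys_over K" "poly g \<pi> = 0" for g
    using roots_conjugate[OF K(1) f(1,2) _ _ f(4) assms that] uniformizer_powers_indep f(3) n by auto
qed (use that in blast)

end

end

lemma adjoin_elem_eq_adjoin:
  assumes "is_subring K" "Q2 \<subseteq> K"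
  shows "adjoin_elem K x = adjoin K {x}"
proof
  show "adjoin_elem K x \<subseteq> adjoin K {x}"
    using adjoin_upper[of K "{x}"] adjoin_upper(2)[of "{x}" K] by (intro adjoin_elem_least adjoin_is_subring) auto
  show "adjoin K {x} \<subseteq> adjoin_elem K x"
    using adjoin_elem_subring adjoin_elem_base adjoin_elem_self assms by (intro adjoin_least) blast+
qed

lemma quadratic_polys_over:
  assumes "is_subring K" "p \<in> K" "q \<in> K"
  shows "[:q, p, 1:] \<in> polys_over K"
  using assms by (intro pCons_in_polys_over zero_in_polys_over subring_1)

text \<open>\<open>2 * \<alpha> + p\<close> is, up to sign, the difference of the two roots. In the
  valuation normalised by \<open>e = 2\<close> the nontrivial embedding moves the uniformizer by
  \<open>2 d\<close>, so the lower break is \<open>2 d - 1\<close>. Up to there the Herbrand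
  function is the identity, and the shift by one gives \<open>2 d\<close>.\<close>

lemma ramified_quadratic_break:
  assumes pq: "p \<in> Q2" "q \<in> Q2" and \<alpha>: "\<alpha>\<^sup>2 + p * \<alpha> + q = 0" "val2bar \<alpha> = ereal (1 / 2)"
    and d: "val2bar (2 * \<alpha> + p) = ereal d" "0 \<le> d"
  shows "max_upper_break Q2 (adjoin Q2 {\<alpha>}) = ereal (2 * d)"
proof -
  let ?f = "[:q, p, 1:]"
  define L where "L = adjoin_elem Q2 \<alpha>"
  have L: "is_subring L" "Q2 \<subseteq> L" "\<alpha> \<in> L"
    unfolding L_def using adjoin_elem_subring adjoin_elem_base adjoin_elem_self Q2_subring by blast+
  have f: "?f \<in> polys_over Q2" "Polynomial.lead_coeff ?f = 1" "Polynomial.degree ?f = 2" "poly ?f \<alpha> = 0"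
    using \<alpha>(1) quadratic_polys_over[OF Q2_subring pq] by (simp_all add: power2_eq_square algebra_simps)
  have \<alpha>': "val2bar \<alpha> = ereal (1 / real 2)" using \<alpha>(2) by simp
  note E = Q2_subring order.refl has_ram_index_Q2 zero_less_numeral \<alpha>' f
  have e: "has_ram_index L 2" unfolding L_def by (rule uniformizer_extension_ram_index[OF E])
  define \<beta> where "\<beta> = - p - \<alpha>"
  have roots: "poly ?f x = (x - \<alpha>) * (x - \<beta>)" for x
  proof -
    have "poly ?f x = poly ?f x - poly ?f \<alpha>" using f(4) by simp
    also have "\<dots> = (x - \<alpha>) * (x - \<beta>)" by (simp add: \<beta>_def algebra_simps)
    finally show ?thesis .
  qed
  have \<beta>\<alpha>: "val2bar (\<beta> - \<alpha>) = ereal d"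
    using d(1) W.val_minus[of "2 * \<alpha> + p"] by (simp add: \<beta>_def algebra_simps)
  have "poly ?f \<beta> = 0" unfolding roots by simp
  then obtain \<sigma> where \<sigma>: "\<sigma> \<in> embeddings Q2 L" "\<sigma> \<alpha> = \<beta>"
    unfolding L_def using uniformizer_embedding[OF E] by blast
  have LT: "L = adjoin Q2 {\<alpha>}" unfolding L_def by (rule adjoin_elem_eq_adjoin[OF Q2_subring order.refl])
  have \<beta>ne: "\<beta> \<noteq> \<alpha>" using \<beta>\<alpha> by auto
  then have \<sigma>id: "\<sigma> \<noteq> restrict id L" using \<sigma>(2) L(3) by auto
  have id: "\<tau> = restrict id L" if "\<tau> \<in> embeddings Q2 L" "\<tau> \<alpha> = \<alpha>" for \<tau>
    by (rule embedding_eq_idI[OF Q2_subring order.refl L(1,2) that(1) LT]) (use that in auto)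
  have val: "\<tau> \<alpha> = \<alpha> \<or> \<tau> \<alpha> = \<beta>" if "\<tau> \<in> embeddings Q2 L" for \<tau>
    using embedding_root[OF Q2_subring order.refl L(1,2) that L(3) f(1)] f(4) unfolding roots by auto
  have emb: "embeddings Q2 L = {restrict id L, \<sigma>}"
  proof (intro equalityI subsetI)
    fix \<tau> assume t: "\<tau> \<in> embeddings Q2 L"
    show "\<tau> \<in> {restrict id L, \<sigma>}"
    proof (cases "\<tau> \<alpha> = \<alpha>")
      case False
      have "\<tau> y = \<sigma> y" if y: "y \<in> L" for y
      proof -
        obtain g where g: "g \<in> polys_over Q2" "y = poly g \<alpha>" using y by (auto simp: L_def adjoin_elem_def)
        show ?thesis
          using embedding_poly(1)[OF Q2_subring order.refl L(1,2) t L(3) g(1)]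
            embedding_poly(1)[OF Q2_subring order.refl L(1,2) \<sigma>(1) L(3) g(1)] val[OF t] False \<sigma>(2) g(2)
          by simp
      qed
      then have "\<tau> = \<sigma>" using t \<sigma>(1) by (intro extensionalityI[of \<tau> L]) (auto simp: embeddings_def)
      then show ?thesis by simp
    qed (use id[OF t] in simp)
  qed (use \<sigma> id_embedding[OF L(1,2)] in auto)
  have \<alpha>int: "0 \<le> val2bar \<alpha>" using \<alpha>(2) by simp
  have mem: "\<sigma> \<in> lower_ram Q2 L y \<longleftrightarrow> y \<le> 2 * d - 1" for y
  proof
    assume "\<sigma> \<in> lower_ram Q2 L y"
    then have "ereal ((y + 1) / real 2) \<le> val2bar (\<sigma> \<alpha> - \<alpha>)"
      using lower_ram_iff[OF e] L(3) \<alpha>int by blast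
    then show "y \<le> 2 * d - 1" using \<beta>\<alpha> \<sigma>(2) by simp
  next
    assume y: "y \<le> 2 * d - 1"
    have "ereal ((y + 1) / real 2) \<le> val2bar (\<sigma> a - a)" if "a \<in> L" "0 \<le> val2bar a" for a
    proof -
      have "ereal ((y + 1) / real 2) \<le> ereal d" using y by simp
      also have "\<dots> = val2bar (\<sigma> \<alpha> - \<alpha>)" using \<beta>\<alpha> \<sigma>(2) by simp
      also have "\<dots> \<le> val2bar (\<sigma> a - a)"
        using uniformizer_ram_number[OF E] \<sigma>(1) that unfolding L_def by blast
      finally show ?thesis .
    qed
    then show "\<sigma> \<in> lower_ram Q2 L y" using lower_ram_iff[OF e] \<sigma>(1) by blast
  qed
  have lower: "lower_ram Q2 L y = (if y \<le> 2 * d - 1 then {restrict id L, \<sigma>} else {restrict id L})" for y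
  proof -
    have "lower_ram Q2 L y \<subseteq> embeddings Q2 L" by (auto simp: lower_ram_def)
    then show ?thesis using mem[of y] id_in_lower_ram[OF e L(1,2), of y] emb by auto
  qed
  have "L \<noteq> Q2"
  proof
    assume "L = Q2"
    then show False using \<sigma> emb \<sigma>id embedding_base[OF Q2_subring order.refl L(1,2) \<sigma>(1)] L(3) \<beta>ne by auto
  qed
  then have "max_upper_break Q2 L = ereal (2 * d - 1 + 1)"
    using \<sigma>id d(2) by (intro max_upper_break_eq[OF e L(1,2)]) (simp_all add: lower)
  then show ?thesis by (simp add: LT)
qed

text \<open>The break sits at \<open>t = -1\<close>: embeddings are isometries, so each belongs to
  the group at \<open>-1\<close>, whereas for \<open>y > -1\<close> only the inclusion survives by
  \<open>sep\<close>. The embedding \<open>\<sigma>\<close> keeps \<open>L\<close> apart from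
  \<open>Q2\<close>, whose break is set by a separate clause.\<close>

lemma unramified_break:
  assumes L: "is_subring L" "Q2 \<subseteq> L" and e: "has_ram_index L 1"
    and T: "L = adjoin Q2 T" "\<And>x. x \<in> T \<Longrightarrow> 0 \<le> val2bar x"
    and sep: "\<And>\<tau> x. \<tau> \<in> embeddings Q2 L \<Longrightarrow> x \<in> T \<Longrightarrow> \<tau> x \<noteq> x \<Longrightarrow> val2bar (\<tau> x - x) = 0"
    and \<sigma>: "\<sigma> \<in> embeddings Q2 L" "\<sigma> \<noteq> restrict id L"
  shows "max_upper_break Q2 L = 0"
proof -
  have TL: "T \<subseteq> L" unfolding T(1) by (rule adjoin_upper)
  have "L \<noteq> Q2"
  proof
    assume "L = Q2"
    then have "\<sigma> = restrict id L"
      using embedding_base[OF Q2_subring order.refl L \<sigma>(1)] \<sigma>(1)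
      by (intro extensionalityI[of \<sigma> L]) (auto simp: embeddings_def)
    then show False using \<sigma>(2) by simp
  qed
  moreover have "lower_ram Q2 L y = {restrict id L}" if "-1 < y" for y
  proof -
    have "\<tau> = restrict id L" if t: "\<tau> \<in> lower_ram Q2 L y" for \<tau>
    proof (rule embedding_eq_idI[OF Q2_subring order.refl L _ T(1)])
      show te: "\<tau> \<in> embeddings Q2 L" using t by (simp add: lower_ram_def)
      fix x assume x: "x \<in> T"
      have "ereal ((y + 1) / real 1) \<le> val2bar (\<tau> x - x)"
        using t x TL T(2) lower_ram_iff[OF e] by blast
      then have "val2bar (\<tau> x - x) \<noteq> 0" using \<open>-1 < y\<close> by auto
      then show "\<tau> x = x" using sep[OF te x] by blast
    qed
    then show ?thesis using id_in_lower_ram[OF e L] by blast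
  qed
  moreover have "\<sigma> \<in> lower_ram Q2 L (-1)"
    unfolding lower_ram_iff[OF e]
    using \<sigma>(1) embedding_val[OF Q2_subring order.refl L \<sigma>(1)]
    by (auto intro: W.val_diff_ge simp flip: zero_ereal_def)
  ultimately have "max_upper_break Q2 L = ereal (-1 + 1)"
    using \<sigma>(2) by (intro max_upper_break_eq[OF e L]) auto
  then show ?thesis by simp
qed

section \<open>Simple extensions, dimension and rupture fields in the carrier-based setting\<close>

lemma Q2bar_domain: "Ring.domain Q2bar"
  by (rule field.axioms(1)[OF Q2bar_field])

lemma is_subring_subring: "is_subring S \<Longrightarrow> subring S Q2bar"
  by (intro ring.subringI[OF Q2bar_ring]) (auto intro: subring_closed)

lemma subring_is_subring:
  assumes "subring S Q2bar"
  shows "is_subring S"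
  unfolding is_subring_def
  using subringE(3)[OF assms] subringE(5)[OF assms] subringE(6)[OF assms] subringE(7)[OF assms]
  by simp (metis ab_group_add_class.ab_diff_conv_add_uminus)

lemma simple_extension_eq:
  assumes "is_subring K"
  shows "ring.simple_extension Q2bar K x = adjoin_elem K x"
proof -
  have "ring.simple_extension Q2bar K x = \<Inter>{S. subring S Q2bar \<and> K \<subseteq> S \<and> x \<in> S}"
    by (rule domain.simple_extension_minimal[OF Q2bar_domain is_subring_subring[OF assms]]) simp
  also have "\<dots> = adjoin_elem K x"
  proof
    show "\<Inter>{S. subring S Q2bar \<and> K \<subseteq> S \<and> x \<in> S} \<subseteq> adjoin_elem K x"
      using is_subring_subring[OF adjoin_elem_subring[OF assms]] adjoin_elem_base[OF assms]
        adjoin_elem_self[OF assms] by blast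
    show "adjoin_elem K x \<subseteq> \<Inter>{S. subring S Q2bar \<and> K \<subseteq> S \<and> x \<in> S}"
      using adjoin_elem_least subring_is_subring by blast
  qed
  finally show ?thesis .
qed

text \<open>\<open>K[x]\<close> is already a field, which a transcendental element never generates
  as a ring.\<close>

lemma algebraic_over:
  assumes "is_subring K" "Q2 \<subseteq> K"
  shows "\<not> ring.transcendental Q2bar K x"
proof -
  have "subfield (adjoin_elem K x) Q2bar"
    using adjoin_elem_subring[OF assms(1)] adjoin_elem_base[OF assms(1)] assms(2)
    by (intro subringI_subfield) blast+
  then have "subfield (ring.simple_extension Q2bar K x) Q2bar"
    by (simp add: simple_extension_eq[OF assms(1)])
  then have "(ring.algebraic Q2bar over K) x"
    by (rule domain.simple_extension_subfield_imp_algebraic[OF Q2bar_domain is_subring_subring[OF assms(1)], rotated]) simp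
  then show ?thesis by (simp add: over_def)
qed

lemma finite_dimension_adjoin_elem: "ring.finite_dimension Q2bar Q2 (adjoin_elem Q2 x)"
proof -
  have "(ring.algebraic Q2bar over Q2) x"
    using algebraic_over[OF Q2_subring order.refl] by (simp add: over_def)
  from domain.dimension_simple_extension[OF Q2bar_domain Q2_subfield _ this]
  show ?thesis
    by (intro ring.finite_dimensionI[OF Q2bar_ring]) (simp add: simple_extension_eq[OF Q2_subring])
qed

text \<open>Supplies the competitors against which the maximality of \<open>F\<close> is
  applied.\<close>

lemma unramified_adjoin_elem:
  assumes "has_ram_index (adjoin_elem Q2 x) 1"
  shows "unramified_ext Q2 (adjoin_elem Q2 x)"
  unfolding unramified_ext_def
  using adjoin_elem_subring[OF Q2_subring] adjoin_elem_base[OF Q2_subring]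
  by (auto simp: ram_index_eq[OF assms] finite_dimension_adjoin_elem intro!: subringI_subfield)

lemma Q2bar_nat_pow [simp]: "x [^]\<^bsub>Q2bar\<^esub> (n::nat) = x ^ n"
  by (induction n) (simp_all add: nat_pow_def)

lemma Q2bar_eval_Nil [simp]: "ring.eval Q2bar [] x = 0"
  by (simp add: ring.eval.simps[OF Q2bar_ring])

lemma Q2bar_eval_Cons [simp]: "ring.eval Q2bar (c # cs) x = c * x ^ length cs + ring.eval Q2bar cs x"
  by (simp add: ring.eval.simps[OF Q2bar_ring])

text \<open>The first isomorphism theorem for evaluation at \<open>\<theta>\<close>. Its kernel is
  generated by \<open>Irr\<close>, which \<open>indep\<close> identifies with the coefficient list
  of \<open>X ^ 3 + 2\<close>. The theorem maps the quotient to the field, so the isomorphism is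
  inverted at the end.\<close>

lemma iso_rupture_cube_root:
  assumes K: "is_subring K" "Q2 \<subseteq> K"
    and indep: "\<And>r. r \<in> polys_over K \<Longrightarrow> Polynomial.degree r < 3 \<Longrightarrow> poly r \<theta> = 0 \<Longrightarrow> r = 0"
    and \<theta>: "\<theta> ^ 3 = - 2"
  shows "iso_rupture (adjoin_elem K \<theta>) K [1, 0, 0, 2]"
proof -
  let ?p = "[1, 0, 0, 2] :: q2bar list"
  let ?R = "K[X]\<^bsub>Q2bar\<^esub>"
  let ?ev = "\<lambda>p. ring.eval Q2bar p \<theta>"
  have Kc: "0 \<in> K" "1 \<in> K" "2 \<in> K"
    using K by (auto intro: subring_0 subring_1 subring_numeral)
  have sf: "subfield K Q2bar" by (rule subringI_subfield[OF K])
  have sr: "subring K Q2bar" by (rule is_subring_subring[OF K(1)])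
  have alg: "(ring.algebraic Q2bar over K) \<theta>" using algebraic_over[OF K] by (simp add: over_def)
  have p: "?p \<in> carrier ?R"
    unfolding univ_poly_carrier [symmetric] polynomial_def using Kc by auto
  have evp: "?ev ?p = 0" using \<theta> by (simp add: eval_nat_numeral)
  define q where "q = ring.Irr Q2bar K \<theta>"
  note Irr = domain.IrrE[OF Q2bar_domain sf _ alg, folded q_def, simplified]
  have "polynomial\<^bsub>Q2bar\<^esub> K q" using Irr(1) by (simp add: univ_poly_carrier)
  then have qK: "set q \<subseteq> K" by (auto simp: polynomial_def)
  have q0: "q \<noteq> []"
    using domain.pirreducibleE(1)[OF Q2bar_domain sr Irr(1) Irr(2)] .
  have "q pdivides\<^bsub>Q2bar\<^esub> ?p"
    using domain.Irr_minimal[OF Q2bar_domain sf _ alg p] evp by (simp add: q_def)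
  then have "length q \<le> 4"
    using domain.pdivides_imp_degree_le[OF Q2bar_domain sr Irr(1) p] by simp
  moreover have no2: "a + b * \<theta> + c * \<theta>\<^sup>2 = 0 \<Longrightarrow> a = 0 \<and> b = 0 \<and> c = 0"
    if "a \<in> K" "b \<in> K" "c \<in> K" for a b c
  proof -
    assume "a + b * \<theta> + c * \<theta>\<^sup>2 = 0"
    then have "poly [:a, b, c:] \<theta> = 0" by (simp add: algebra_simps power2_eq_square)
    moreover have "[:a, b, c:] \<in> polys_over K"
      using that by (intro pCons_in_polys_over zero_in_polys_over K(1))
    moreover have "Polynomial.degree [:a, b, c:] < 3" by simp
    ultimately have "[:a, b, c:] = 0" using indep by blast
    then show ?thesis by simp
  qed
  ultimately have "q = ?p"
  proof -
    assume l: "length q \<le> 4"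
    obtain cs where q: "q = 1 # cs" using q0 Irr(3) by (cases q) auto
    have csK: "set cs \<subseteq> K" using qK q by simp
    have ev0: "\<theta> ^ length cs + ?ev cs = 0" using Irr(4) q by simp
    have "length cs \<le> 3" using l q by simp
    \<comment> \<open>Lower degrees contradict the independence of
      \<open>1, \<theta>, \<theta> ^ 2\<close>; in degree three, replacing
      \<open>\<theta> ^ 3\<close> by \<open>-2\<close> forces the remaining coefficients.\<close>
    then consider "cs = []" | b where "cs = [b]" | b c where "cs = [b, c]" | b c d where "cs = [b, c, d]"
      by (cases cs; cases "tl cs"; cases "tl (tl cs)") auto
    then show ?thesis
    proof cases
      case 1
      then show ?thesis using ev0 by simp
    next
      case 2
      then show ?thesis using ev0 csK no2[of b 1 0] Kc by (simp add: add.commute)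
    next
      case 3
      then show ?thesis using ev0 csK no2[of c b 1] Kc by (simp add: algebra_simps power2_eq_square)
    next
      case 4
      then have "d - 2 + c * \<theta> + b * \<theta>\<^sup>2 = 0" using ev0 \<theta> by (simp add: algebra_simps eval_nat_numeral)
      moreover have "d - 2 \<in> K" using 4 csK Kc by (auto intro: subring_diff[OF K(1)])
      ultimately have "d - 2 = 0 \<and> c = 0 \<and> b = 0" using no2[of "d - 2" c b] 4 csK by simp
      then show ?thesis using 4 q by simp
    qed
  qed
  then have ker: "a_kernel ?R Q2bar ?ev = PIdl\<^bsub>?R\<^esub> ?p"
    using domain.Irr_generates_ker[OF Q2bar_domain sf _ alg] by (simp add: q_def)
  have hom: "ring_hom_ring ?R Q2bar ?ev"
    by (rule domain.eval_ring_hom[OF Q2bar_domain sr]) simp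
  have img: "?ev ` carrier ?R = adjoin_elem K \<theta>"
    using ring.simple_extension_as_eval_img[OF Q2bar_ring, of K \<theta>] simple_extension_eq[OF K(1)] by simp
  define g where "g = (\<lambda>s. the_elem (?ev ` s))"
  define Ru where "Ru = Rupt\<^bsub>Q2bar\<^esub> K ?p"
  have Rupt: "Ru = ?R Quot (a_kernel ?R Q2bar ?ev)" by (simp add: Ru_def rupture_def ker)
  have iso: "g \<in> ring_iso Ru (Q2bar\<lparr>carrier := adjoin_elem K \<theta>\<rparr>)"
    using ring_hom_ring.FactRing_iso_set_aux[OF hom] unfolding g_def Rupt img .
  interpret R: Ring.ring ?R using hom by (rule ring_hom_ring.axioms(1))
  have ringRu: "Ring.ring Ru"
    unfolding Rupt by (rule ideal.quotient_is_ring[OF ring_hom_ring.kernel_is_ideal[OF hom]])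
  have iso': "inv_into (carrier Ru) g \<in> ring_iso (Q2bar\<lparr>carrier := adjoin_elem K \<theta>\<rparr>) Ru"
    by (rule ring_iso_set_sym[OF ringRu iso])
  have "inv_into (carrier Ru) g a = ring.rupture_surj Q2bar K ?p (ring.poly_of_const Q2bar a)" if a: "a \<in> K" for a
  proof -
    have ca: "ring.poly_of_const Q2bar a \<in> carrier ?R"
      using a unfolding ring.poly_of_const_def[OF Q2bar_ring] univ_poly_carrier [symmetric] polynomial_def
      by (auto simp: ring.normalize.simps[OF Q2bar_ring])
    have eva: "?ev (ring.poly_of_const Q2bar a) = a"
      unfolding ring.poly_of_const_def[OF Q2bar_ring] by (auto simp: ring.normalize.simps[OF Q2bar_ring])
    let ?s = "ring.rupture_surj Q2bar K ?p (ring.poly_of_const Q2bar a)"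
    have "g ?s = a"
      unfolding g_def ker [symmetric] using ring_hom_ring.the_elem_simp[OF hom ca] eva by simp
    moreover have "?s \<in> carrier Ru"
      unfolding Rupt ker FactRing_def A_RCOSETS_def' using ca by auto
    moreover have "inj_on g (carrier Ru)" using iso by (auto simp: ring_iso_def bij_betw_def)
    ultimately show ?thesis by (metis inv_into_f_f)
  qed
  then show ?thesis unfolding iso_rupture_def using iso' unfolding Ru_def by blast
qed

text \<open>Dividing by the coefficient of least order leaves a unit among the \<open>z i\<close>.
  Zero coefficients are kept out of the minimum, their \<open>ord2\<close> being
  unspecified.\<close>

lemma primitive_scaling:
  assumes "finite I" "\<exists>i\<in>I. a i \<noteq> (0::q2)"
  obtains k :: int and z :: "nat \<Rightarrow> zadic2" where "\<And>i. i \<in> I \<Longrightarrow> a i = 2 powi k * to_fract (z i)"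
    "\<exists>i\<in>I. \<not> 2 dvd z i"
proof -
  define J where "J = {i \<in> I. a i \<noteq> 0}"
  have J: "finite J" "J \<noteq> {}" using assms by (auto simp: J_def)
  then have "Min ((\<lambda>i. ord2 (a i)) ` J) \<in> (\<lambda>i. ord2 (a i)) ` J" by (intro Min_in) auto
  then obtain j where j: "j \<in> J" "Min ((\<lambda>i. ord2 (a i)) ` J) = ord2 (a j)" by (rule imageE)
  have least: "ord2 (a j) \<le> ord2 (a i)" if "i \<in> J" for i
    unfolding j(2) [symmetric] using J that by (intro Min_le) auto
  have "ereal (of_int (ord2 (a j))) \<le> val2 (a i)" if "i \<in> I" for i
    using least[of i] that by (cases "a i = 0") (auto simp: J_def val2_def)
  then have "\<forall>i\<in>I. \<exists>z. a i = 2 powi ord2 (a j) * to_fract z" unfolding val2_ge_iff by blast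
  then obtain z where z: "\<And>i. i \<in> I \<Longrightarrow> a i = 2 powi ord2 (a j) * to_fract (z i)" by metis
  have jI: "j \<in> I" "a j \<noteq> 0" using j by (auto simp: J_def)
  obtain u where u: "u dvd 1" "a j = 2 powi ord2 (a j) * to_fract u" using q2_ord2[OF jI(2)] .
  have "2 powi ord2 (a j) * to_fract (z j) = 2 powi ord2 (a j) * to_fract u"
    by (rule trans[OF sym[OF z[OF jI(1)]] u(2)])
  then have "z j = u" by simp
  then have odd: "\<exists>i\<in>I. \<not> 2 dvd z i" using jI(1) u(1) by (auto simp: zadic2_unit_iff)
  show ?thesis by (rule that[OF z odd])
qed

subsection \<open>Unramified extensions\<close>

abbreviation emb :: "zadic2 \<Rightarrow> q2bar" where
  "emb z \<equiv> to_ac (to_fract z)"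

lemma emb_Q2: "emb z \<in> Q2" by simp

lemma val_emb: "val2bar (emb z) = val2 (to_fract z)"
  by (rule W.val_to_ac)

lemma val_emb_nonneg: "0 \<le> val2bar (emb z)"
  by (simp add: val_emb)

lemma val_emb_unit: "\<not> 2 dvd z \<Longrightarrow> val2bar (emb z) = 0"
  by (simp add: val_emb val2_unit_iff zadic2_unit_iff)

lemma val_emb_pos: "2 dvd z \<Longrightarrow> 0 < val2bar (emb z)"
  using val2_to_fract_ge_iff[of 1 z] by (auto simp: val_emb intro: less_le_trans[of 0 "ereal 1"])

context
  fixes f :: "q2bar poly" and x :: q2bar
  assumes f: "f \<in> polys_over Q2" "Polynomial.lead_coeff f = 1" "0 < Polynomial.degree f" "poly f x = 0"
    and unit: "\<And>z. \<exists>i<Polynomial.degree f. \<not> 2 dvd z i \<Longrightarrow>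
       val2bar (\<Sum>i<Polynomial.degree f. emb (z i) * x ^ i) = 0"
begin

text \<open>The hypothesis \<open>unit\<close> says that the residues of the powers of
  \<open>x\<close> below the degree are independent over the field with two elements. After scaling
  the coefficients to be primitive, only a power of 2 contributes to the valuation.\<close>

lemma unramified_expansion:
  assumes "r \<in> polys_over Q2" "Polynomial.degree r < Polynomial.degree f" "r \<noteq> 0"
  shows "\<exists>k::int. val2bar (poly r x) = ereal (of_int k)"
proof -
  let ?n = "Polynomial.degree f"
  define a where "a i = of_ac (Polynomial.coeff r i)" for i
  have a: "Polynomial.coeff r i = to_ac (a i)" for i
    using assms(1) by (simp add: a_def polys_over_def to_ac_of_ac)
  have "poly r x = (\<Sum>i\<le>Polynomial.degree r. Polynomial.coeff r i * x ^ i)" by (simp add: poly_altdef)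
  also have "\<dots> = (\<Sum>i<?n. Polynomial.coeff r i * x ^ i)"
    using assms(2) by (intro sum.mono_neutral_left) (auto simp: coeff_eq_0)
  finally have sum: "poly r x = (\<Sum>i<?n. to_ac (a i) * x ^ i)" by (simp add: a)
  have "a (Polynomial.degree r) \<noteq> 0" using assms(3) a[of "Polynomial.degree r"] by auto
  then have "\<exists>i\<in>{..<?n}. a i \<noteq> 0" using assms(2) by blast
  then obtain k z where kz: "\<And>i. i \<in> {..<?n} \<Longrightarrow> a i = 2 powi k * to_fract (z i)" "\<exists>i\<in>{..<?n}. \<not> 2 dvd z i"
    using primitive_scaling[of "{..<?n}" a] by blast
  have "poly r x = to_ac (2 powi k) * (\<Sum>i<?n. emb (z i) * x ^ i)"
    unfolding sum sum_distrib_left by (rule sum.cong) (simp_all add: kz(1))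
  moreover have "val2bar (\<Sum>i<?n. emb (z i) * x ^ i) = 0" using kz(2) by (intro unit) blast
  ultimately have "val2bar (poly r x) = ereal (of_int k)"
    by (simp only: W.val_mult W.val_to_ac val2_2_powi add_0_right)
  then show ?thesis by blast
qed

lemma unramified_powers_indep:
  assumes "r \<in> polys_over Q2" "Polynomial.degree r < Polynomial.degree f" "poly r x = 0"
  shows "r = 0"
  using unramified_expansion[OF assms(1,2)] assms(3) by auto

lemma unramified_extension_ram_index: "has_ram_index (adjoin_elem Q2 x) 1"
proof (rule has_ram_indexI)
  show "is_subring (adjoin_elem Q2 x)" "Q2 \<subseteq> adjoin_elem Q2 x"
    using adjoin_elem_subring adjoin_elem_base Q2_subring by blast+
  then show "to_ac 2 \<in> adjoin_elem Q2 x" by blast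
  show "val2bar (to_ac 2) = ereal (1 / real 1)"
    using val2_2_power[of 1] by (simp only: W.val_to_ac) simp
  show "\<exists>m::int. val2bar y = ereal (of_int m / real 1)" if y: "y \<in> adjoin_elem Q2 x" "y \<noteq> 0" for y
  proof -
    obtain r where r: "r \<in> polys_over Q2" "Polynomial.degree r < Polynomial.degree f" "y = poly r x"
      using adjoin_elem_reduced[OF Q2_subring f y(1)] .
    then have "r \<noteq> 0" using y(2) by auto
    then show ?thesis using unramified_expansion r by auto
  qed
qed simp

lemma unramified_embedding:
  assumes "poly f x' = 0"
  obtains \<sigma> where "\<sigma> \<in> embeddings Q2 (adjoin_elem Q2 x)" "\<sigma> x = x'"
proof (rule conjugate_embedding[OF Q2_subring order.refl])
  show "poly g x' = 0" if "g \<in> polys_over Q2" "poly g x = 0" for g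
    using roots_conjugate[OF Q2_subring f(1-3) _ f(4) assms that] unramified_powers_indep by blast
qed (use that in blast)

end

section \<open>Parity, squares and cubes of 2-adic units\<close>

lemma zadic2_even_add: "2 dvd x + y \<longleftrightarrow> (2 dvd x \<longleftrightarrow> 2 dvd (y :: zadic2))"
proof -
  have "2 dvd x + y" if "\<not> 2 dvd x" "\<not> 2 dvd y"
  proof -
    have "2 dvd (x - 1) + (y - 1)" using that zadic2_parity by (blast intro: dvd_add)
    then have "2 dvd (x - 1) + (y - 1) + 2" by (rule dvd_add) simp
    then show ?thesis by simp
  qed
  then show ?thesis by (metis dvd_add dvd_add_left_iff dvd_add_right_iff)
qed

lemma zadic2_even_diff: "2 dvd x - y \<longleftrightarrow> (2 dvd x \<longleftrightarrow> 2 dvd (y :: zadic2))"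
  using zadic2_even_add[of x "- y"] by simp

lemma zadic2_even_mult: "2 dvd x * y \<longleftrightarrow> 2 dvd x \<or> 2 dvd (y :: zadic2)"
  using zadic2_unit_mult[of x y] zadic2_unit_iff[of x] zadic2_unit_iff[of y] zadic2_unit_iff[of "x * y"]
  by (auto intro: dvd_mult dvd_mult2)

lemma zadic2_even_power: "2 dvd x ^ n \<longleftrightarrow> n > 0 \<and> 2 dvd (x :: zadic2)"
  by (induction n) (auto simp: zadic2_even_mult zadic2_not_2_dvd_1)

lemma zadic2_even_numeral:
  "2 dvd (numeral (num.Bit0 n) :: zadic2)" "\<not> 2 dvd (numeral (num.Bit1 n) :: zadic2)"
proof -
  show e: "2 dvd (numeral (num.Bit0 n) :: zadic2)" for n
    by (metis dvd_triv_left numeral_Bit0_eq_double)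
  have "(numeral (num.Bit1 n) :: zadic2) = numeral (num.Bit0 n) + 1" by (simp add: numeral_eq_Suc numeral_Bit1 numeral_Bit0)
  then show "\<not> 2 dvd (numeral (num.Bit1 n) :: zadic2)"
    using e[of n] zadic2_not_2_dvd_1 by (simp only: zadic2_even_add simp_thms)
qed

lemmas zadic2_even_simps = zadic2_even_add zadic2_even_diff zadic2_even_mult zadic2_even_power
  zadic2_even_numeral zadic2_not_2_dvd_1 dvd_minus_iff dvd_0_right

lemma zadic2_contraction_mult:
  fixes x y a :: zadic2
  assumes "2 ^ n dvd x - y" "2 dvd a"
  shows "2 ^ Suc n dvd a * (x - y)"
  unfolding power_Suc using assms(2,1) by (rule mult_dvd_mono)

text \<open>For \<open>u = 1 + 8 k\<close>, comparing with
  \<open>(1 + 4 z) ^ 2 = 1 + 8 (z + 2 z ^ 2)\<close> gives the contraction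
  \<open>z = k - 2 z ^ 2\<close>.\<close>

lemma zadic2_square_1_mod_8:
  assumes "8 dvd u - (1 :: zadic2)"
  obtains z where "u = (1 + 4 * z)\<^sup>2"
proof -
  obtain k where k: "u = 1 + 8 * k" using assms by (metis add.commute diff_add_cancel dvdE)
  obtain z where z: "k - 2 * z\<^sup>2 = z"
  proof (rule zadic2_contraction_fixpoint[of "\<lambda>z. k - 2 * z\<^sup>2"])
    fix x y :: zadic2 and n
    assume xy: "2 ^ n dvd x - y"
    have "2 ^ Suc n dvd - (2 * (x + y)) * (x - y)"
      by (rule zadic2_contraction_mult[OF xy]) simp
    also have "- (2 * (x + y)) * (x - y) = k - 2 * x\<^sup>2 - (k - 2 * y\<^sup>2)"
      by (simp add: algebra_simps power2_eq_square)
    finally show "2 ^ Suc n dvd k - 2 * x\<^sup>2 - (k - 2 * y\<^sup>2)" .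
  qed
  then have "k = z + 2 * z\<^sup>2" by (simp add: algebra_simps)
  then have "u = (1 + 4 * z)\<^sup>2" by (simp add: k power2_eq_square algebra_simps)
  then show ?thesis by (rule that)
qed

text \<open>From \<open>(1 + 2 x) ^ 3 = 1 + 2 (3 x + 6 x ^ 2 + 4 x ^ 3)\<close>, one copy of
  \<open>x\<close> is isolated in \<open>3 x\<close>; the rest carries a factor 2 because 3 is
  odd.\<close>

lemma zadic2_unit_cube:
  assumes "\<not> 2 dvd (u :: zadic2)"
  obtains t where "\<not> 2 dvd t" "u = t ^ 3"
proof -
  obtain k where k: "u - 1 = 2 * k" using assms zadic2_parity by (blast elim: dvdE)
  define F where "F x = k - 2 * x - 6 * x\<^sup>2 - 4 * x ^ 3" for x
  obtain x where x: "F x = x"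
  proof (rule zadic2_contraction_fixpoint[of F])
    fix x y :: zadic2 and n
    assume xy: "2 ^ n dvd x - y"
    have "2 ^ Suc n dvd (2 * - (1 + 3 * (x + y) + 2 * (x\<^sup>2 + x * y + y\<^sup>2))) * (x - y)"
      by (rule zadic2_contraction_mult[OF xy dvd_triv_left])
    also have "(2 * - (1 + 3 * (x + y) + 2 * (x\<^sup>2 + x * y + y\<^sup>2))) * (x - y) = F x - F y"
      by (simp add: F_def algebra_simps power2_eq_square power3_eq_cube)
    finally show "2 ^ Suc n dvd F x - F y" .
  qed
  then have "k = 3 * x + 6 * x\<^sup>2 + 4 * x ^ 3" by (simp add: F_def algebra_simps)
  then have "u = 1 + 2 * (3 * x + 6 * x\<^sup>2 + 4 * x ^ 3)" using k by (simp add: algebra_simps)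
  then have "u = (1 + 2 * x) ^ 3" by (simp add: power2_eq_square power3_eq_cube algebra_simps)
  moreover have "\<not> 2 dvd 1 + 2 * x" by (simp add: zadic2_even_simps)
  ultimately show ?thesis using that by blast
qed

lemma zadic2_unit_mod_8:
  assumes "\<not> 2 dvd (u :: zadic2)"
  shows "8 dvd u - 1 \<or> 8 dvd u - 3 \<or> 8 dvd u - 5 \<or> 8 dvd u - 7"
proof -
  define r where "r = residue_seq u 3"
  have r: "0 \<le> r" "r < 8" using residue_seq_bounds[of u 3] by (simp_all add: r_def)
  have "8 dvd u - of_int r"
    using power2_dvd_zadic2_iff[of 3 "u - of_int r"] r
    by (simp add: residue_seq_simps residue_seq_of_int flip: r_def)
  moreover have "r = 0 \<or> r = 1 \<or> r = 2 \<or> r = 3 \<or> r = 4 \<or> r = 5 \<or> r = 6 \<or> r = 7"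
    using r by arith
  moreover have "\<not> 8 dvd u - of_int r" if "even r"
  proof
    assume "8 dvd u - of_int r"
    then have "2 dvd u - of_int r" by (rule dvd_trans[rotated]) (simp add: zadic2_even_numeral)
    moreover have "2 dvd (of_int r :: zadic2)" using that by (auto elim!: evenE)
    ultimately have "2 dvd u" by (simp add: zadic2_even_diff)
    then show False using assms by blast
  qed
  ultimately show ?thesis by auto
qed

lemma val_perturb: "val2bar x = 0 \<Longrightarrow> 0 < val2bar y \<Longrightarrow> val2bar (x + y) = 0"
  using W.val_add_eq[of x y] by simp

lemma val_mult_zero:
  assumes "val2bar (x * y) = 0" "0 \<le> val2bar x" "0 \<le> val2bar y"
  shows "val2bar x = 0" "val2bar y = 0"
  using assms by (cases "val2bar x"; cases "val2bar y"; auto simp: W.val_mult)+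

lemma val_square: "val2bar (x\<^sup>2) = val2bar x + val2bar x"
  by (simp add: power2_eq_square W.val_mult)

lemma val_even_pos:
  assumes "0 \<le> val2bar x"
  shows "0 < val2bar (2 * x)"
proof -
  have "val2bar 2 = ereal 1" using val2_2_power[of 1] W.val_to_ac[of 2] by simp
  then show ?thesis using assms by (cases "val2bar x") (auto simp: W.val_mult)
qed

lemma exists_root:
  fixes p :: "'a::alg_closed_field poly"
  assumes "Polynomial.degree p > 0"
  obtains x where "poly p x = 0"
  using alg_closed_imp_poly_has_root assms by blast

section \<open>The unramified quadratic extension by cube roots of unity\<close>

context
  fixes \<omega> :: q2bar
  assumes \<omega>: "\<omega>\<^sup>2 + \<omega> + 1 = 0"
begin

lemma omega_sum: "\<omega> + \<omega>\<^sup>2 = - 1"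
  using \<omega> by (simp add: add.commute eq_neg_iff_add_eq_0)

lemma omega_prod: "\<omega> * \<omega>\<^sup>2 = 1"
proof -
  have "\<omega> * \<omega>\<^sup>2 = \<omega> * (\<omega>\<^sup>2 + \<omega> + 1) - (\<omega> + \<omega>\<^sup>2)"
    by (simp add: power2_eq_square algebra_simps)
  then show ?thesis unfolding \<omega> omega_sum by simp
qed

lemma omega_factor: "t * t + t + 1 = (t - \<omega>) * (t - \<omega>\<^sup>2)"
proof -
  have "(t - \<omega>) * (t - v) = t * t - t * (\<omega> + v) + \<omega> * v" for v
    by (simp add: algebra_simps)
  then show ?thesis by (simp add: omega_sum omega_prod)
qed

lemma val_omega: "val2bar \<omega> = 0"
proof -
  have "val2bar \<omega> + (val2bar \<omega> + val2bar \<omega>) = 0"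
    using arg_cong[OF omega_prod, of val2bar] by (simp add: W.val_mult val_square)
  then show ?thesis by (cases "val2bar \<omega>") auto
qed

text \<open>The integral elements \<open>\<omega> - 1\<close> and \<open>\<omega> ^ 2 - 1\<close>
  have product 3, a 2-adic unit.\<close>

lemma val_omega_diff: "val2bar (\<omega>\<^sup>2 - \<omega>) = 0" "val2bar (\<omega> - 1) = 0"
proof -
  have "(\<omega> - 1) * (\<omega>\<^sup>2 - 1) = 3" using omega_factor[of 1] by (simp add: algebra_simps)
  moreover have "val2bar (3 :: q2bar) = 0"
    using val_emb_unit[of 3] by (simp add: zadic2_even_numeral)
  moreover have "0 \<le> val2bar (\<omega> - 1)" "0 \<le> val2bar (\<omega>\<^sup>2 - 1)"
    using val_omega by (auto intro!: W.val_diff_ge simp: val_square)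
  ultimately show "val2bar (\<omega> - 1) = 0" using val_mult_zero by metis
  moreover have "\<omega>\<^sup>2 - \<omega> = \<omega> * (\<omega> - 1)" by (simp add: power2_eq_square algebra_simps)
  ultimately show "val2bar (\<omega>\<^sup>2 - \<omega>) = 0" using val_omega by (simp add: W.val_mult)
qed

lemma omega_poly:
  shows "[:1, 1, 1:] \<in> polys_over Q2" "Polynomial.lead_coeff [:1, 1, 1 :: q2bar:] = 1"
    "0 < Polynomial.degree [:1, 1, 1 :: q2bar:]" "poly [:1, 1, 1:] \<omega> = 0"
  using quadratic_polys_over[OF Q2_subring, of 1 1] subring_1[OF Q2_subring] \<omega>
  by (simp_all add: algebra_simps power2_eq_square)

text \<open>The norm of \<open>a + b \<omega>\<close> is \<open>a ^ 2 - a b + b ^ 2\<close>, odd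
  unless \<open>a\<close> and \<open>b\<close> are both even; integral factors of a unit are
  units.\<close>

lemma omega_unit:
  assumes "\<exists>i<Polynomial.degree [:1, 1, 1 :: q2bar:]. \<not> 2 dvd z i"
  shows "val2bar (\<Sum>i<Polynomial.degree [:1, 1, 1 :: q2bar:]. emb (z i) * \<omega> ^ i) = 0"
proof -
  have deg: "{..<Polynomial.degree [:1, 1, 1 :: q2bar:]} = {0, 1}" by auto
  define a b where "a = z 0" and "b = z 1"
  have odd: "\<not> 2 dvd a \<or> \<not> 2 dvd b" using assms by (auto simp: a_def b_def less_2_cases_iff numeral_2_eq_2 less_Suc_eq)
  have "\<not> 2 dvd a\<^sup>2 - a * b + b\<^sup>2" using odd by (auto simp: zadic2_even_simps)
  then have "val2bar (emb (a\<^sup>2 - a * b + b\<^sup>2)) = 0" by (rule val_emb_unit)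
  also have "emb (a\<^sup>2 - a * b + b\<^sup>2) = (emb a + emb b * \<omega>) * (emb a + emb b * \<omega>\<^sup>2)"
  proof -
    have "(x + y * \<omega>) * (x + y * v) = x * x + x * y * (\<omega> + v) + y * y * (\<omega> * v)" for x y v
      by (simp add: algebra_simps)
    then show ?thesis by (simp add: omega_sum omega_prod power2_eq_square [of "emb a"] power2_eq_square [of "emb b"])
  qed
  finally have "val2bar ((emb a + emb b * \<omega>) * (emb a + emb b * \<omega>\<^sup>2)) = 0" .
  moreover have "0 \<le> val2bar (emb a + emb b * \<omega>)" "0 \<le> val2bar (emb a + emb b * \<omega>\<^sup>2)"
    using val_omega by (auto intro!: W.val_add_ge W.val_mult_ge val_emb_nonneg simp: val_square)
  ultimately have "val2bar (emb a + emb b * \<omega>) = 0" by (rule val_mult_zero)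
  then show ?thesis unfolding deg by (simp add: a_def b_def)
qed

abbreviation Q\<omega> :: "q2bar set" where "Q\<omega> \<equiv> adjoin_elem Q2 \<omega>"

lemma omega_subring: "is_subring Q\<omega>" "Q2 \<subseteq> Q\<omega>" "\<omega> \<in> Q\<omega>"
  using adjoin_elem_subring adjoin_elem_base adjoin_elem_self Q2_subring by blast+

lemma omega_ram_index: "has_ram_index Q\<omega> 1"
  by (rule unramified_extension_ram_index[OF omega_poly omega_unit])

lemma omega_embedding_values:
  assumes "\<tau> \<in> embeddings Q2 L" "is_subring L" "Q2 \<subseteq> L" "\<omega> \<in> L"
  shows "\<tau> \<omega> = \<omega> \<or> \<tau> \<omega> = \<omega>\<^sup>2"
proof -
  have "poly [:1, 1, 1:] (\<tau> \<omega>) = 0"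
    using embedding_root[OF Q2_subring order.refl assms(2,3,1,4) omega_poly(1)] omega_poly(4) by blast
  then have "(\<tau> \<omega> - \<omega>) * (\<tau> \<omega> - \<omega>\<^sup>2) = 0"
    using omega_factor[of "\<tau> \<omega>"] by (simp add: algebra_simps)
  then show ?thesis by simp
qed

lemma omega_break: "max_upper_break Q2 Q\<omega> = 0"
proof -
  have "poly [:1, 1, 1:] (\<omega>\<^sup>2) = 0"
    using omega_factor[of "\<omega>\<^sup>2"] by (simp add: algebra_simps)
  then obtain \<sigma> where \<sigma>: "\<sigma> \<in> embeddings Q2 Q\<omega>" "\<sigma> \<omega> = \<omega>\<^sup>2"
    using unramified_embedding[OF omega_poly omega_unit] by blast
  have ne: "\<omega>\<^sup>2 \<noteq> \<omega>" using val_omega_diff(1) by auto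
  show ?thesis
  proof (rule unramified_break[OF omega_subring(1,2) omega_ram_index])
    show "Q\<omega> = adjoin Q2 {\<omega>}" by (rule adjoin_elem_eq_adjoin[OF Q2_subring order.refl])
    show "\<sigma> \<noteq> restrict id Q\<omega>" using \<sigma>(2) ne omega_subring(3) by auto
    show "val2bar (\<tau> x - x) = 0" if "\<tau> \<in> embeddings Q2 Q\<omega>" "x \<in> {\<omega>}" "\<tau> x \<noteq> x" for \<tau> x
      using omega_embedding_values[OF that(1) omega_subring] that val_omega_diff(1) by auto
  qed (use \<sigma>(1) val_omega in auto)
qed

end

subsection \<open>Ramified quadratic extensions\<close>

lemma adjoin_cong:
  assumes "S \<subseteq> adjoin Q2 T" "T \<subseteq> adjoin Q2 S"
  shows "adjoin Q2 S = adjoin Q2 T"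
  using assms by (intro order.antisym adjoin_least adjoin_is_subring adjoin_upper)

lemma adjoin_memI: "x \<in> T \<Longrightarrow> x \<in> adjoin Q2 T" "x \<in> Q2 \<Longrightarrow> x \<in> adjoin Q2 T"
  using adjoin_upper by blast+

lemma val2bar_2: "val2bar 2 = ereal 1"
  using val2_2_power[of 1] W.val_to_ac[of 2] by simp

lemma numeral_Q2: "numeral n \<in> Q2"
  by (rule subring_numeral[OF Q2_subring])

lemma val_sqrt:
  assumes "val2bar (\<beta>\<^sup>2) = ereal r"
  shows "val2bar \<beta> = ereal (r / 2)"
  using assms by (cases "val2bar \<beta>") (auto simp: val_square)

text \<open>\<open>\<beta>\<close> is a uniformizer and the two roots differ by
  \<open>2 \<beta>\<close>, of valuation \<open>1 + 1/2\<close>; doubling gives 3.\<close>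

lemma sqrt_uniformizer_break:
  assumes n: "n \<in> Q2" "val2bar n = 1" and \<beta>: "\<beta>\<^sup>2 = n"
  shows "max_upper_break Q2 (adjoin Q2 {\<beta>}) = 3"
proof -
  have v: "val2bar \<beta> = ereal (1 / 2)" using val_sqrt[of \<beta> 1] n \<beta> by (simp add: one_ereal_def)
  then have "val2bar (2 * \<beta> + 0) = ereal (3 / 2)" by (simp add: W.val_mult val2bar_2)
  then have "max_upper_break Q2 (adjoin Q2 {\<beta>}) = ereal (2 * (3 / 2))"
    using v n(1) \<beta> by (intro ramified_quadratic_break[of 0 "- n"])
      (auto intro: subring_0[OF Q2_subring] subring_uminus[OF Q2_subring])
  then show ?thesis by simp
qed

text \<open>Here \<open>\<beta>\<close> is a unit, and the uniformizer is
  \<open>\<alpha> = \<beta> - 1\<close>: its square \<open>- 2 \<beta> + (z + 1)\<close> has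
  valuation 1 because 4 divides \<open>z + 1\<close>. The roots of its equation differ by
  \<open>2 \<beta>\<close>, of valuation 1, whence the break 2.\<close>

lemma sqrt_minus_unit_break:
  assumes z: "4 dvd z + 1" and \<beta>: "\<beta>\<^sup>2 = emb z"
  shows "max_upper_break Q2 (adjoin Q2 {\<beta>}) = 2"
proof -
  have "2 dvd z + 1" using z by (rule dvd_trans[rotated]) (rule zadic2_even_numeral)
  then have "\<not> 2 dvd z" using zadic2_even_add[of z 1] zadic2_not_2_dvd_1 by simp
  then have v\<beta>: "val2bar \<beta> = 0" using val_sqrt[of \<beta> 0] val_emb_unit \<beta> by (simp add: zero_ereal_def)
  define \<alpha> where "\<alpha> = \<beta> - 1"
  have a2: "\<alpha>\<^sup>2 = - 2 * \<beta> + emb (z + 1)"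
    using \<beta> by (simp add: \<alpha>_def power2_eq_square algebra_simps)
  have v2\<beta>: "val2bar (2 * \<beta>) = ereal 1" using v\<beta> by (simp add: W.val_mult val2bar_2)
  have "ereal 1 < val2bar (emb (z + 1))"
    using val2_to_fract_ge_iff[of 2 "z + 1"] z unfolding val_emb
    by (auto intro: less_le_trans[of "ereal 1" "ereal 2"])
  then have "val2bar (\<alpha>\<^sup>2) = ereal 1"
    unfolding a2 using W.val_add_eq[of "- 2 * \<beta>" "emb (z + 1)"] v2\<beta> W.val_minus[of "2 * \<beta>"] by simp
  then have v\<alpha>: "val2bar \<alpha> = ereal (1 / 2)" by (rule val_sqrt)
  have q: "2 \<in> Q2" "1 - emb z \<in> Q2" using Q2_subring by (auto intro!: subring_closed emb_Q2)
  have "\<alpha>\<^sup>2 + 2 * \<alpha> + (1 - emb z) = 0" unfolding a2 by (simp add: \<alpha>_def algebra_simps)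
  moreover have "val2bar (2 * \<alpha> + 2) = ereal 1" using v2\<beta> by (simp add: \<alpha>_def algebra_simps)
  ultimately have "max_upper_break Q2 (adjoin Q2 {\<alpha>}) = ereal (2 * 1)"
    using v\<alpha> q by (intro ramified_quadratic_break) auto
  moreover have "adjoin Q2 {\<alpha>} = adjoin Q2 {\<beta>}"
  proof (rule adjoin_cong)
    have "\<beta> - 1 \<in> adjoin Q2 {\<beta>}"
      by (intro subring_diff[OF adjoin_is_subring] subring_1[OF adjoin_is_subring] adjoin_memI(1)) simp
    then show "{\<alpha>} \<subseteq> adjoin Q2 {\<beta>}" by (simp add: \<alpha>_def)
    have "\<alpha> + 1 \<in> adjoin Q2 {\<alpha>}"
      by (intro subring_add[OF adjoin_is_subring] subring_1[OF adjoin_is_subring] adjoin_memI(1)) simp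
    then show "{\<beta>} \<subseteq> adjoin Q2 {\<alpha>}" by (simp add: \<alpha>_def)
  qed
  ultimately show ?thesis by simp
qed

lemma adjoin_sqrt_shift:
  assumes "(s + c)\<^sup>2 = \<beta>\<^sup>2" "c \<in> Q2"
  shows "adjoin Q2 {s} = adjoin Q2 {\<beta>}"
proof (rule adjoin_cong)
  note R = adjoin_is_subring
  have sc: "s + c = \<beta> \<or> s + c = - \<beta>" using assms(1) by (simp add: power2_eq_iff)
  have "\<beta> - c \<in> adjoin Q2 {\<beta>}" "- \<beta> - c \<in> adjoin Q2 {\<beta>}"
    by (intro subring_diff[OF R] subring_uminus[OF R] adjoin_memI(2)[OF assms(2)] adjoin_memI(1); simp)+
  moreover have "s = \<beta> - c \<or> s = - \<beta> - c" using sc by (metis add_diff_cancel_right')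
  ultimately show "{s} \<subseteq> adjoin Q2 {\<beta>}" by auto
  have "s + c \<in> adjoin Q2 {s}" "- (s + c) \<in> adjoin Q2 {s}"
    by (intro subring_add[OF R] subring_uminus[OF R] adjoin_memI(2)[OF assms(2)] adjoin_memI(1); simp)+
  moreover have "\<beta> = s + c \<or> \<beta> = - (s + c)" using sc by (metis minus_minus)
  ultimately show "{\<beta>} \<subseteq> adjoin Q2 {s}" by auto
qed

text \<open>Completing the square turns the root picked by the choice operator into plus or minus
  \<open>\<beta>\<close>, and the sign does not affect the field.\<close>

lemma ram_quadratic_eq:
  assumes root: "\<And>s. poly (ram_quadratic_poly i) s = (s + c)\<^sup>2 - n" and "c \<in> Q2" "\<beta>\<^sup>2 = n"
  shows "ram_quadratic i = adjoin Q2 {\<beta>}"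
proof -
  define s where "s = (SOME \<alpha>. poly (ram_quadratic_poly i) \<alpha> = 0)"
  have "poly (ram_quadratic_poly i) (\<beta> - c) = 0" unfolding root using assms(3) by simp
  then have "poly (ram_quadratic_poly i) s = 0" unfolding s_def by (rule someI)
  then have "(s + c)\<^sup>2 = \<beta>\<^sup>2" unfolding root using assms(3) by simp
  then have "adjoin Q2 {s} = adjoin Q2 {\<beta>}" using assms(2) by (rule adjoin_sqrt_shift)
  then show ?thesis by (simp add: ram_quadratic_def s_def)
qed

lemma ram_quadratic_sqrt:
  shows "\<beta>\<^sup>2 = - 1 \<Longrightarrow> ram_quadratic 1 = adjoin Q2 {\<beta>}"
    and "\<beta>\<^sup>2 = - 5 \<Longrightarrow> ram_quadratic 2 = adjoin Q2 {\<beta>}"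
    and "\<beta>\<^sup>2 = - 2 \<Longrightarrow> ram_quadratic 3 = adjoin Q2 {\<beta>}"
    and "\<beta>\<^sup>2 = - 10 \<Longrightarrow> ram_quadratic 4 = adjoin Q2 {\<beta>}"
    and "\<beta>\<^sup>2 = 2 \<Longrightarrow> ram_quadratic 5 = adjoin Q2 {\<beta>}"
    and "\<beta>\<^sup>2 = - 6 \<Longrightarrow> ram_quadratic 6 = adjoin Q2 {\<beta>}"
proof -
  note Q = subring_0[OF Q2_subring] subring_1[OF Q2_subring] numeral_Q2
  show "\<beta>\<^sup>2 = - 1 \<Longrightarrow> ram_quadratic 1 = adjoin Q2 {\<beta>}"
    by (rule ram_quadratic_eq[where c = 1]) (use Q in \<open>auto simp: ram_quadratic_poly_def power2_eq_square algebra_simps\<close>)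
  show "\<beta>\<^sup>2 = - 5 \<Longrightarrow> ram_quadratic 2 = adjoin Q2 {\<beta>}"
    by (rule ram_quadratic_eq[where c = 1]) (use Q in \<open>auto simp: ram_quadratic_poly_def power2_eq_square algebra_simps\<close>)
  show "\<beta>\<^sup>2 = - 2 \<Longrightarrow> ram_quadratic 3 = adjoin Q2 {\<beta>}"
    by (rule ram_quadratic_eq[where c = 0]) (use Q in \<open>auto simp: ram_quadratic_poly_def power2_eq_square algebra_simps eval_nat_numeral\<close>)
  show "\<beta>\<^sup>2 = - 10 \<Longrightarrow> ram_quadratic 4 = adjoin Q2 {\<beta>}"
    by (rule ram_quadratic_eq[where c = 0]) (use Q in \<open>auto simp: ram_quadratic_poly_def power2_eq_square algebra_simps eval_nat_numeral\<close>)
  show "\<beta>\<^sup>2 = 2 \<Longrightarrow> ram_quadratic 5 = adjoin Q2 {\<beta>}"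
    by (rule ram_quadratic_eq[where c = 2]) (use Q in \<open>auto simp: ram_quadratic_poly_def power2_eq_square algebra_simps eval_nat_numeral\<close>)
  show "\<beta>\<^sup>2 = - 6 \<Longrightarrow> ram_quadratic 6 = adjoin Q2 {\<beta>}"
    by (rule ram_quadratic_eq[where c = 2]) (use Q in \<open>auto simp: ram_quadratic_poly_def power2_eq_square algebra_simps eval_nat_numeral\<close>)
qed

subsection \<open>The splitting field of the polynomial \<open>X ^ 3 + 2\<close>\<close>

context
  fixes \<omega> \<theta> :: q2bar
  assumes \<omega>: "\<omega>\<^sup>2 + \<omega> + 1 = 0" and \<theta>: "\<theta> ^ 3 = - 2"
begin

abbreviation Q\<omega>\<theta> :: "q2bar set" where "Q\<omega>\<theta> \<equiv> adjoin_elem (adjoin_elem Q2 \<omega>) \<theta>"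

lemma val_theta: "val2bar \<theta> = ereal (1 / real 3)"
proof -
  have "ereal 3 * val2bar \<theta> = ereal 1" using W.val_power[of \<theta> 3] \<theta> val2bar_2 by simp
  then show ?thesis by (cases "val2bar \<theta>") auto
qed

lemma theta_poly:
  shows "[:2, 0, 0, 1:] \<in> polys_over (adjoin_elem Q2 \<omega>)" "Polynomial.lead_coeff [:2, 0, 0, 1 :: q2bar:] = 1"
    "Polynomial.degree [:2, 0, 0, 1 :: q2bar:] = 3" "poly [:2, 0, 0, 1:] \<theta> = 0"
proof -
  show "[:2, 0, 0, 1:] \<in> polys_over (adjoin_elem Q2 \<omega>)"
    using omega_subring(1)[OF \<omega>]
    by (intro pCons_in_polys_over zero_in_polys_over subring_0 subring_1 subring_numeral)
  show "poly [:2, 0, 0, 1:] \<theta> = 0" using \<theta> by (simp add: power3_eq_cube algebra_simps)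
qed simp_all

lemmas theta_setting = omega_subring(1,2)[OF \<omega>] omega_ram_index[OF \<omega>] zero_less_numeral val_theta
lemmas theta_extension = theta_setting theta_poly

lemma theta_subring: "is_subring Q\<omega>\<theta>" "adjoin_elem Q2 \<omega> \<subseteq> Q\<omega>\<theta>" "\<theta> \<in> Q\<omega>\<theta>" "Q2 \<subseteq> Q\<omega>\<theta>" "\<omega> \<in> Q\<omega>\<theta>"
proof -
  show "is_subring Q\<omega>\<theta>" "adjoin_elem Q2 \<omega> \<subseteq> Q\<omega>\<theta>" "\<theta> \<in> Q\<omega>\<theta>"
    using adjoin_elem_subring adjoin_elem_base adjoin_elem_self omega_subring(1)[OF \<omega>] by blast+
  then show "Q2 \<subseteq> Q\<omega>\<theta>" "\<omega> \<in> Q\<omega>\<theta>" using omega_subring[OF \<omega>] by blast+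
qed

lemma theta_adjoin: "Q\<omega>\<theta> = adjoin Q2 {\<omega>, \<theta>}"
proof
  have A: "is_subring (adjoin Q2 {\<omega>, \<theta>})" "Q2 \<subseteq> adjoin Q2 {\<omega>, \<theta>}" "{\<omega>, \<theta>} \<subseteq> adjoin Q2 {\<omega>, \<theta>}"
    by (rule adjoin_is_subring adjoin_upper)+
  then show "Q\<omega>\<theta> \<subseteq> adjoin Q2 {\<omega>, \<theta>}" by (intro adjoin_elem_least) auto
  show "adjoin Q2 {\<omega>, \<theta>} \<subseteq> Q\<omega>\<theta>" using theta_subring by (intro adjoin_least) auto
qed

lemma theta_ram_index: "has_ram_index Q\<omega>\<theta> 3"
  by (rule uniformizer_extension_ram_index[OF theta_extension])

lemma theta_indep:
  "r \<in> polys_over (adjoin_elem Q2 \<omega>) \<Longrightarrow> Polynomial.degree r < 3 \<Longrightarrow> poly r \<theta> = 0 \<Longrightarrow> r = 0"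
  by (rule uniformizer_powers_indep[OF theta_setting])

lemma theta_iso_rupture: "iso_rupture Q\<omega>\<theta> (adjoin_elem Q2 \<omega>) [1, 0, 0, 2]"
  by (rule iso_rupture_cube_root[OF omega_subring(1,2)[OF \<omega>] theta_indep \<theta>])

lemma theta_factor: "poly [:2, 0, 0, 1:] t = (t - \<theta>) * (t - \<omega> * \<theta>) * (t - \<omega>\<^sup>2 * \<theta>)"
proof -
  have *: "(t - \<theta>) * (t - \<omega> * \<theta>) * (t - v * \<theta>)
      = t ^ 3 - (1 + (\<omega> + v)) * t\<^sup>2 * \<theta> + (\<omega> + v + \<omega> * v) * t * \<theta>\<^sup>2 - \<omega> * v * \<theta> ^ 3" for v
    by (simp add: power2_eq_square power3_eq_cube algebra_simps)
  have "(t - \<theta>) * (t - \<omega> * \<theta>) * (t - \<omega>\<^sup>2 * \<theta>) = t ^ 3 + 2"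
    unfolding * by (simp add: omega_sum[OF \<omega>] omega_prod[OF \<omega>] \<theta>)
  then show ?thesis by (simp add: power3_eq_cube algebra_simps)
qed

lemma theta_diff_val: "val2bar (\<omega> * \<theta> - \<theta>) = ereal (1 / 3)" "val2bar (\<omega>\<^sup>2 * \<theta> - \<theta>) = ereal (1 / 3)"
proof -
  have "\<omega> * \<theta> - \<theta> = (\<omega> - 1) * \<theta>" by (simp add: algebra_simps)
  then show "val2bar (\<omega> * \<theta> - \<theta>) = ereal (1 / 3)"
    using val_theta val_omega_diff(2)[OF \<omega>] by (simp add: W.val_mult)
  have "(\<omega> - 1) * (\<omega>\<^sup>2 - 1) = 3" using omega_factor[OF \<omega>, of 1] by (simp add: algebra_simps)
  moreover have "val2bar (3 :: q2bar) = 0"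
    using val_emb_unit[of 3] by (simp add: zadic2_even_numeral)
  ultimately have "val2bar (\<omega>\<^sup>2 - 1) = 0" using val_omega_diff(2)[OF \<omega>] by (metis W.val_mult add_0)
  moreover have "\<omega>\<^sup>2 * \<theta> - \<theta> = (\<omega>\<^sup>2 - 1) * \<theta>" by (simp add: algebra_simps)
  ultimately show "val2bar (\<omega>\<^sup>2 * \<theta> - \<theta>) = ereal (1 / 3)"
    using val_theta by (simp add: W.val_mult)
qed

text \<open>Tame ramification: the conjugates of \<open>\<theta>\<close> differ from it by a unit
  times \<open>\<theta>\<close>, so by 1 in the normalised valuation, and the last lower break is
  0.\<close>

lemma theta_break: "max_upper_break Q2 Q\<omega>\<theta> = 1"
proof -
  note L = theta_subring
  have root: "poly [:2, 0, 0, 1:] (\<omega> * \<theta>) = 0" unfolding theta_factor by simp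
  obtain \<sigma> where \<sigma>: "\<sigma> \<in> embeddings (adjoin_elem Q2 \<omega>) Q\<omega>\<theta>" "\<sigma> \<theta> = \<omega> * \<theta>"
    using uniformizer_embedding[OF theta_extension root] .
  have \<sigma>': "\<sigma> \<in> embeddings Q2 Q\<omega>\<theta>" using embeddings_mono[OF omega_subring(2)[OF \<omega>]] \<sigma>(1) by blast
  have "\<omega> * \<theta> \<noteq> \<theta>" using theta_diff_val(1) by auto
  then have ne: "\<sigma> \<noteq> restrict id Q\<omega>\<theta>" using \<sigma>(2) L(3) by auto
  have "ereal ((0 + 1) / real 3) \<le> val2bar (\<sigma> a - a)" if "a \<in> Q\<omega>\<theta>" "0 \<le> val2bar a" for a
    using uniformizer_ram_number[OF theta_extension \<sigma>(1) that] theta_diff_val(1) \<sigma>(2) by simp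
  then have low: "\<sigma> \<in> lower_ram Q2 Q\<omega>\<theta> 0" unfolding lower_ram_iff[OF theta_ram_index] using \<sigma>' by blast
  have high: "lower_ram Q2 Q\<omega>\<theta> y = {restrict id Q\<omega>\<theta>}" if y: "0 < y" for y
  proof -
    have "\<tau> = restrict id Q\<omega>\<theta>" if t: "\<tau> \<in> lower_ram Q2 Q\<omega>\<theta> y" for \<tau>
    proof -
      have te: "\<tau> \<in> embeddings Q2 Q\<omega>\<theta>" using t by (simp add: lower_ram_def)
      have ram: "ereal ((y + 1) / real 3) \<le> val2bar (\<tau> a - a)" if "a \<in> Q\<omega>\<theta>" "0 \<le> val2bar a" for a
        using t that unfolding lower_ram_iff[OF theta_ram_index] by blast
      \<comment> \<open>\<open>\<omega> ^ 2 - \<omega>\<close> is a unit, so an embedding that moves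
        \<open>\<omega>\<close> cannot belong to this group.\<close>
      have "\<not> ereal ((y + 1) / 3) \<le> 0" using y by (simp add: zero_ereal_def)
      then have w: "\<tau> \<omega> = \<omega>"
        using omega_embedding_values[OF \<omega> te L(1,4,5)] ram[OF L(5)] val_omega[OF \<omega>] val_omega_diff(1)[OF \<omega>]
        by auto
      have "poly [:2, 0, 0, 1:] (\<tau> \<theta>) = 0"
      proof -
        have "[:2, 0, 0, 1:] \<in> polys_over Q2"
          using Q2_subring by (intro pCons_in_polys_over zero_in_polys_over subring_0 subring_1 subring_numeral)
        then show ?thesis
          using embedding_root[OF Q2_subring order.refl L(1,4) te L(3)] theta_poly(4) by blast
      qed
      then have "\<tau> \<theta> = \<theta> \<or> \<tau> \<theta> = \<omega> * \<theta> \<or> \<tau> \<theta> = \<omega>\<^sup>2 * \<theta>" unfolding theta_factor by auto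
      moreover have "\<not> ereal ((y + 1) / 3) \<le> ereal (1 / 3)" using y by simp
      ultimately have "\<tau> \<theta> = \<theta>" using ram[OF L(3)] val_theta theta_diff_val by auto
      then show ?thesis
        using w by (intro embedding_eq_idI[OF Q2_subring order.refl L(1,4) te theta_adjoin]) auto
    qed
    then show ?thesis using id_in_lower_ram[OF theta_ram_index L(1,4)] by blast
  qed
  have "max_upper_break Q2 Q\<omega>\<theta> = ereal (0 + 1)"
  proof (rule max_upper_break_eq[OF theta_ram_index L(1,4)])
    show "Q\<omega>\<theta> \<noteq> Q2"
    proof
      assume "Q\<omega>\<theta> = Q2"
      then have "\<sigma> \<theta> = \<theta>" using embedding_base[OF Q2_subring order.refl L(1,4) \<sigma>'] L(3) by simp
      then show False using \<sigma>(2) \<open>\<omega> * \<theta> \<noteq> \<theta>\<close> by simp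
    qed
    show "lower_ram Q2 Q\<omega>\<theta> 0 \<noteq> {restrict id Q\<omega>\<theta>}" using low ne by blast
  qed (use high in auto)
  then show ?thesis by simp
qed

text \<open>\<open>ram_index Q2 F = 1\<close> is a definite description, informative only once the
  value group of \<open>F\<close> is known. This group lies between the integers and their thirds,
  so it is one of the two, and the larger one would give index 3.\<close>

lemma theta_intermediate_ram_index:
  assumes F: "is_subring F" "Q2 \<subseteq> F" "F \<subseteq> Q\<omega>\<theta>" "ram_index Q2 F = 1"
  shows "has_ram_index F 1"
proof -
  have val: "\<exists>n::int. val2bar x = ereal (of_int n / 3)" if x: "x \<in> F" "x \<noteq> 0" for x
  proof -
    have "val2bar x \<in> range (\<lambda>n::int. ereal (of_int n / real 3))"
      using theta_ram_index x F(3) unfolding has_ram_index_def by blast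
    then show ?thesis by auto
  qed
  show ?thesis
  proof (cases "\<exists>x\<in>F. x \<noteq> 0 \<and> (\<exists>m::int. val2bar x = ereal (of_int m / 3) \<and> \<not> 3 dvd m)")
    case True
    then obtain x m where x: "x \<in> F" "x \<noteq> 0" "val2bar x = ereal (of_int m / 3)" "\<not> 3 dvd (m::int)" by blast
    define k where "k = m div 3"
    have "m mod 3 = 1 \<or> m mod 3 = 2" using x(4) by presburger
    moreover have "m = 3 * k + m mod 3" by (simp add: k_def)
    ultimately have m: "m = 3 * k + 1 \<or> m = 3 * k + 2" by auto
    have two: "to_ac (2 powi j :: q2) \<in> F" "to_ac (2 powi j :: q2) \<noteq> 0"
      "val2bar (to_ac (2 powi j)) = ereal (of_int j)" for j
      using F(2) by (auto simp: W.val_to_ac val2_2_powi)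
    have "\<exists>p\<in>F. val2bar p = ereal (1 / real 3)"
      using m
    proof
      assume "m = 3 * k + 1"
      then have "val2bar (x / to_ac (2 powi k)) = ereal (1 / real 3)"
        unfolding W.val_divide[OF two(2)] two(3) x(3) by simp
      moreover have "x / to_ac (2 powi k) \<in> F" by (rule subring_divide[OF F(1,2) x(1) two(1)])
      ultimately show ?thesis by blast
    next
      assume "m = 3 * k + 2"
      then have "val2bar (to_ac (2 powi (k + 1)) / x) = ereal (1 / real 3)"
        unfolding W.val_divide[OF x(2)] two(3) x(3) by simp
      moreover have "to_ac (2 powi (k + 1)) / x \<in> F" by (rule subring_divide[OF F(1,2) two(1) x(1)])
      ultimately show ?thesis by blast
    qed
    then have "has_ram_index F 3" using has_ram_indexI[OF F(1,2), of 3] val by auto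
    then show ?thesis using ram_index_eq F(4) by fastforce
  next
    case False
    show ?thesis
    proof (rule has_ram_indexI[OF F(1,2)])
      show "to_ac 2 \<in> F" using F(2) by blast
      show "val2bar (to_ac 2) = ereal (1 / real 1)" using val2bar_2 by simp
      fix x assume x: "x \<in> F" "x \<noteq> 0"
      then obtain n :: int where n: "val2bar x = ereal (of_int n / 3)" using val by blast
      then have "3 dvd n" using False x by blast
      then obtain j where "n = 3 * j" by (auto elim: dvdE)
      then show "\<exists>n::int. val2bar x = ereal (of_int n / real 1)" using n by auto
    qed simp
  qed
qed

text \<open>In \<open>y = a + b \<theta> + c \<theta> ^ 2\<close> a nonzero \<open>y - a\<close> has
  valuation outside the integers, while \<open>F\<close> has integer valuations only. For this,
  \<open>y - a\<close> is scaled to valuation 0; its coefficients are then integral with vanishing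
  constant term, so its valuation is at least \<open>1/3\<close>.\<close>

lemma theta_unramified_subset:
  assumes F: "is_subring F" "adjoin_elem Q2 \<omega> \<subseteq> F" "F \<subseteq> Q\<omega>\<theta>" "ram_index Q2 F = 1"
  shows "F \<subseteq> adjoin_elem Q2 \<omega>"
proof
  let ?K = "adjoin_elem Q2 \<omega>"
  note K = omega_subring(1,2)[OF \<omega>]
  have QF: "Q2 \<subseteq> F" using K F(2) by blast
  have F1: "has_ram_index F 1" by (rule theta_intermediate_ram_index[OF F(1) QF F(3,4)])
  fix y assume y: "y \<in> F"
  have yL: "y \<in> Q\<omega>\<theta>" using y F(3) by blast
  have "0 < Polynomial.degree [:2, 0, 0, 1 :: q2bar:]" by simp
  from adjoin_elem_reduced[OF K(1) theta_poly(1,2) this theta_poly(4) yL, unfolded theta_poly(3)]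
  obtain r where r: "r \<in> polys_over ?K" "Polynomial.degree r < 3" "y = poly r \<theta>" by blast
  define a where "a = Polynomial.coeff r 0"
  have aK: "a \<in> ?K" using r(1) by (simp add: a_def polys_over_def)
  have "y - a = 0"
  proof (rule ccontr)
    assume ne: "y - a \<noteq> 0"
    have "y - a \<in> F" using y aK F(1,2) by (auto intro: subring_diff)
    then obtain k :: int where k: "val2bar (y - a) = ereal (of_int k)"
      using has_ram_index_int[OF F1 _ ne] by blast
    define c where "c = to_ac (2 powi (- k) :: q2)"
    have c: "c \<in> ?K" "val2bar c = ereal (of_int (- k))"
      using K(2) by (auto simp: c_def W.val_to_ac val2_2_powi simp del: to_ac_inverse)
    define s where "s = Polynomial.smult c (r - [:a:])"
    have coeff: "Polynomial.coeff s i = (if i = 0 then 0 else c * Polynomial.coeff r i)" for i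
      by (simp add: s_def a_def coeff_pCons split: nat.splits)
    have sK: "s \<in> polys_over ?K"
      using r(1) c(1) K(1) by (auto simp: polys_over_def coeff intro: subring_mult subring_0)
    have sd: "Polynomial.degree s < 3"
    proof -
      have "Polynomial.degree (r - [:a:]) \<le> 2" using r(2) by (intro degree_diff_le) auto
      then show ?thesis using degree_smult_le[of c "r - [:a:]"] by (simp add: s_def)
    qed
    have ps: "poly s \<theta> = c * (y - a)" by (simp add: s_def r(3))
    then have "val2bar (poly s \<theta>) = 0" using c(2) k by (simp add: W.val_mult)
    then have bound: "0 \<le> val2bar (Polynomial.coeff s i) + ereal (real i / real 3)" for i
      using uniformizer_expansion(1)[OF theta_setting sK sd, of i] by simp
    have pos: "0 \<le> val2bar (Polynomial.coeff s i)" if "i < 3" for i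
    proof (cases "Polynomial.coeff s i = 0")
      case False
      then obtain m :: int where m: "val2bar (Polynomial.coeff s i) = ereal (of_int m)"
        using has_ram_index_int[OF omega_ram_index[OF \<omega>]] sK by (auto simp: polys_over_def)
      have "real i / real 3 < 1" using that by simp
      then have "- 1 < real_of_int m" using bound[of i] m by simp
      then show ?thesis using m by simp
    qed simp
    have "poly s \<theta> = (\<Sum>i\<le>Polynomial.degree s. Polynomial.coeff s i * \<theta> ^ i)" by (simp add: poly_altdef)
    also have "ereal (1 / 3) \<le> val2bar \<dots>"
    proof (rule W.val_sum_ge)
      fix i assume "i \<in> {..Polynomial.degree s}"
      then have i: "i < 3" using sd by auto
      show "ereal (1 / 3) \<le> val2bar (Polynomial.coeff s i * \<theta> ^ i)"
      proof (cases "i = 0")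
        case True
        then show ?thesis by (simp add: coeff)
      next
        case False
        then have "ereal (1 / 3) \<le> ereal (real i) * val2bar \<theta>" using val_theta by simp
        then have "0 + ereal (1 / 3) \<le> val2bar (Polynomial.coeff s i) + ereal (real i) * val2bar \<theta>"
          using pos[OF i] by (intro add_mono)
        then show ?thesis by (simp add: W.val_mult W.val_power)
      qed
    qed
    finally show False using \<open>val2bar (poly s \<theta>) = 0\<close> by (simp add: zero_ereal_def)
  qed
  then show "y \<in> ?K" using aK by simp
qed

lemma theta_max_unramified:
  assumes "max_unramified_subext Q2 Q\<omega>\<theta> F"
  shows "F = adjoin_elem Q2 \<omega>"
proof
  have F: "is_subring F" "F \<subseteq> Q\<omega>\<theta>" "ram_index Q2 F = 1"
    using assms unfolding max_unramified_subext_def unramified_ext_def by (auto intro: subfield_is_subring)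
  show KF: "adjoin_elem Q2 \<omega> \<subseteq> F"
    using assms unramified_adjoin_elem[OF omega_ram_index[OF \<omega>]] theta_subring(2)
    unfolding max_unramified_subext_def by blast
  show "F \<subseteq> adjoin_elem Q2 \<omega>" by (rule theta_unramified_subset[OF F(1) KF F(2,3)])
qed

end

subsection \<open>The resolvent cubic\<close>

text \<open>The 2-torsion cubic in the depressed coordinate \<open>z = 12 x + b2\<close>, with
  \<open>a = c4\<close> and \<open>b = c6\<close>.\<close>

definition cubic_roots :: "q2 \<Rightarrow> q2 \<Rightarrow> q2bar set" where
  "cubic_roots a b = {z. z ^ 3 = 3 * to_ac a * z + 2 * to_ac b}"

lemma cubic_roots_split:
  assumes "z1 \<in> cubic_roots a b"
  obtains z2 z3 where "cubic_roots a b = {z1, z2, z3}" "z2 + z3 = - z1" "z2 * z3 = z1\<^sup>2 - 3 * to_ac a"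
proof -
  obtain z2 where z2: "poly [:z1\<^sup>2 - 3 * to_ac a, z1, 1:] z2 = 0"
    by (rule exists_root[of "[:z1\<^sup>2 - 3 * to_ac a, z1, 1:]"]) simp_all
  define z3 where "z3 = - z1 - z2"
  have p: "z2 * z3 = z1\<^sup>2 - 3 * to_ac a"
    using z2 by (simp add: z3_def algebra_simps eq_neg_iff_add_eq_0)
  have "z \<in> cubic_roots a b \<longleftrightarrow> (z - z1) * ((z - z2) * (z - z3)) = 0" for z
  proof -
    have "(z - z1) * ((z - z2) * (z - z3)) = (z - z1) * (z\<^sup>2 - (z2 + z3) * z + z2 * z3)"
      by (simp add: algebra_simps power2_eq_square)
    also have "\<dots> = (z - z1) * (z\<^sup>2 + z1 * z + (z1\<^sup>2 - 3 * to_ac a))"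
      unfolding p by (simp add: z3_def)
    also have "\<dots> = (z ^ 3 - 3 * to_ac a * z) - (z1 ^ 3 - 3 * to_ac a * z1)"
      by (simp add: algebra_simps power2_eq_square power3_eq_cube)
    also have "z1 ^ 3 - 3 * to_ac a * z1 = 2 * to_ac b" using assms by (simp add: cubic_roots_def)
    finally have e: "(z - z1) * ((z - z2) * (z - z3)) = z ^ 3 - 3 * to_ac a * z - 2 * to_ac b" .
    show ?thesis unfolding e cubic_roots_def by (simp add: diff_diff_eq)
  qed
  then have "cubic_roots a b = {z1, z2, z3}" by auto
  then show ?thesis using that p by (simp add: z3_def)
qed

lemma cubic_roots_nonempty: obtains z where "z \<in> cubic_roots a b"
proof -
  obtain z where "poly [:- (2 * to_ac b), - (3 * to_ac a), 0, 1:] z = 0"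
    by (rule exists_root[of "[:- (2 * to_ac b), - (3 * to_ac a), 0, 1:]"]) simp_all
  then have "z \<in> cubic_roots a b" by (simp add: cubic_roots_def power3_eq_cube algebra_simps)
  then show ?thesis using that by blast
qed

text \<open>The squared expression is a third of the product of the root differences, since
  \<open>(z1 - z2) * (z1 - z3) = 3 * (z1 ^ 2 - a)\<close>.\<close>

lemma cubic_roots_discriminant:
  fixes a b :: "'a::field"
  assumes "z1 ^ 3 = 3 * a * z1 + 2 * b" "z2 + z3 = - z1" "z2 * z3 = z1\<^sup>2 - 3 * a"
  shows "((z2 - z3) * (z1\<^sup>2 - a))\<^sup>2 = 12 * (a ^ 3 - b\<^sup>2)"
proof -
  have "(z2 - z3)\<^sup>2 = (z2 + z3)\<^sup>2 - 4 * (z2 * z3)" by (simp add: power2_eq_square algebra_simps)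
  also have "\<dots> = 12 * a - 3 * z1\<^sup>2" unfolding assms(2,3) by (simp add: algebra_simps)
  finally have "((z2 - z3) * (z1\<^sup>2 - a))\<^sup>2 = (12 * a - 3 * z1\<^sup>2) * (z1\<^sup>2 - a)\<^sup>2"
    by (simp add: power_mult_distrib)
  also have "\<dots> = 12 * a ^ 3 - 3 * (z1 ^ 3 - 3 * a * z1)\<^sup>2"
    by (simp add: power2_eq_square power3_eq_cube algebra_simps)
  also have "z1 ^ 3 - 3 * a * z1 = 2 * b" using assms(1) by simp
  finally show ?thesis by (simp add: power_mult_distrib algebra_simps)
qed

lemma square_eq_imp_mem:
  assumes "is_subring S" "x\<^sup>2 = y\<^sup>2" "y \<in> S"
  shows "x \<in> (S :: 'a::idom set)"
  using assms subring_uminus[OF assms(1,3)] by (auto simp: power2_eq_iff)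

lemma half_mem:
  assumes "is_subring S" "Q2 \<subseteq> S" "x \<in> S"
  shows "x / numeral n \<in> S"
  using subring_divide[OF assms subring_numeral[OF assms(1)]] .

text \<open>For a rational root \<open>z1\<close> the factor \<open>z1 ^ 2 - a\<close> is rational,
  so \<open>z2 - z3\<close> is a rational multiple of \<open>\<delta>\<close>, and
  \<open>z2 + z3 = - z1\<close> does the rest. The factor 144 comes from
  \<open>12 * 1728 = 144 ^ 2\<close>.\<close>

lemma cubic_roots_reducible:
  assumes root: "to_ac z0 \<in> cubic_roots a b" and \<Delta>: "a ^ 3 - b\<^sup>2 = 1728 * \<Delta>" "\<Delta> \<noteq> 0"
    and \<delta>: "\<delta>\<^sup>2 = to_ac \<Delta>"
  shows "adjoin Q2 (cubic_roots a b) = adjoin Q2 {\<delta>}"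
proof -
  let ?z = "to_ac z0"
  obtain z2 z3 where z: "cubic_roots a b = {?z, z2, z3}" "z2 + z3 = - ?z" "z2 * z3 = ?z\<^sup>2 - 3 * to_ac a"
    using cubic_roots_split[OF root] .
  define c where "c = z0\<^sup>2 - a"
  have "((z2 - z3) * (?z\<^sup>2 - to_ac a))\<^sup>2 = 12 * (to_ac a ^ 3 - (to_ac b)\<^sup>2)"
    using root z by (intro cubic_roots_discriminant) (simp_all add: cubic_roots_def)
  also have "to_ac a ^ 3 - (to_ac b)\<^sup>2 = to_ac (a ^ 3 - b\<^sup>2)" by simp
  also have "12 * \<dots> = (144 * \<delta>)\<^sup>2" unfolding \<Delta>(1) by (simp add: power_mult_distrib \<delta>)
  finally have sq: "((z2 - z3) * to_ac c)\<^sup>2 = (144 * \<delta>)\<^sup>2" by (simp add: c_def)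
  have "\<delta> \<noteq> 0" using \<delta> \<Delta>(2) by auto
  then have c: "c \<noteq> 0" using sq by auto
  show ?thesis
  proof (rule adjoin_cong)
    let ?A = "adjoin Q2 {\<delta>}"
    note A = adjoin_is_subring[of Q2 "{\<delta>}"] adjoin_upper(1)[of Q2 "{\<delta>}"]
    have "144 * \<delta> \<in> ?A"
      by (intro subring_mult[OF A(1)] subring_numeral[OF A(1)] adjoin_memI(1)) simp
    then have "(z2 - z3) * to_ac c \<in> ?A" by (rule square_eq_imp_mem[OF A(1) sq])
    then have "(z2 - z3) * to_ac c / to_ac c \<in> ?A"
      by (rule subring_divide[OF A]) (rule adjoin_memI(2)[OF to_ac_Q2])
    then have d: "z2 - z3 \<in> ?A" using c by simp
    have z0: "- ?z \<in> ?A" "?z \<in> ?A"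
      by (intro subring_uminus[OF A(1)] adjoin_memI(2)[OF to_ac_Q2])+
    have h2: "(- ?z + (z2 - z3)) / 2 \<in> ?A"
      by (rule half_mem[OF A], rule subring_add[OF A(1) z0(1) d])
    have h3: "(- ?z - (z2 - z3)) / 2 \<in> ?A"
      by (rule half_mem[OF A], rule subring_diff[OF A(1) z0(1) d])
    have e: "z2 = (- ?z + (z2 - z3)) / 2" "z3 = (- ?z - (z2 - z3)) / 2"
      unfolding z(2) [symmetric] by simp_all
    have "z2 \<in> ?A" "z3 \<in> ?A"
      using h2 h3 unfolding e [symmetric] .
    then show "cubic_roots a b \<subseteq> ?A" using z0 unfolding z(1) by auto
  next
    let ?A = "adjoin Q2 (cubic_roots a b)"
    note A = adjoin_is_subring[of Q2 "cubic_roots a b"] adjoin_upper(1)[of Q2 "cubic_roots a b"]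
    have "z2 \<in> ?A" "z3 \<in> ?A" by (rule adjoin_memI(1), simp add: z(1))+
    then have "(z2 - z3) * to_ac c \<in> ?A"
      by (intro subring_mult[OF A(1)] subring_diff[OF A(1)] adjoin_memI(2)[OF to_ac_Q2])
    then have "144 * \<delta> \<in> ?A" by (rule square_eq_imp_mem[OF A(1) sq[symmetric]])
    then have "144 * \<delta> / 144 \<in> ?A" by (rule half_mem[OF A])
    then show "{\<delta>} \<subseteq> ?A" by simp
  qed
qed

lemma val_bound_root:
  assumes "x ^ 3 = p * x + q" "0 \<le> val2bar p" "0 \<le> val2bar q"
  shows "0 \<le> val2bar x"
proof (rule ccontr)
  assume "\<not> 0 \<le> val2bar x"
  then have neg: "val2bar x < 0" by simp
  have "val2bar x \<le> val2bar p + val2bar x" using assms(2) by (metis add_0 add_right_mono)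
  moreover have "val2bar x \<le> val2bar q" using neg assms(3) by simp
  ultimately have "val2bar x \<le> val2bar (x ^ 3)"
    unfolding assms(1) by (intro W.val_add_ge) (simp_all add: W.val_mult)
  then show False using neg by (cases "val2bar x") (auto simp: W.val_power)
qed

section \<open>Cubics that are irreducible modulo 2\<close>

context
  fixes c d :: zadic2 and r r' r'' :: q2bar
  assumes c: "\<not> 2 dvd c" and d: "\<not> 2 dvd d"
    and r: "r ^ 3 = 3 * emb c * r + emb d" and r'r'': "r' + r'' = - r" "r' * r'' = r\<^sup>2 - 3 * emb c"
begin

lemma unram_cubic_integral: "0 \<le> val2bar r"
proof (rule val_bound_root[OF r])
  show "0 \<le> val2bar (3 * emb c)" using val_emb_nonneg[of "3 * c"] by simp
qed (rule val_emb_nonneg)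

text \<open>Modulo 2 the equation is \<open>r ^ 3 = r + 1\<close>, which defines the field with 8
  elements. There \<open>r + 1 = r ^ 3\<close>, \<open>r ^ 2 + 1 = (r + 1) ^ 2\<close> and
  \<open>r * (r ^ 2 + r + 1) = r ^ 2 + 1\<close>; these identities are lifted with multiples of 2 as
  error terms.\<close>

lemma unram_cubic_units:
  "val2bar r = 0" "val2bar (r + 1) = 0" "val2bar (r\<^sup>2 + 1) = 0" "val2bar (r\<^sup>2 + r + 1) = 0"
proof -
  have r2: "0 \<le> val2bar (r\<^sup>2)" using unram_cubic_integral by (rule W.val_power_ge)
  have "r * (r\<^sup>2 - 3 * emb c) = emb d"
    using r by (simp add: power2_eq_square power3_eq_cube algebra_simps)
  then have "val2bar (r * (r\<^sup>2 - 3 * emb c)) = 0" using val_emb_unit[OF d] by simp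
  moreover have "0 \<le> val2bar (r\<^sup>2 - 3 * emb c)"
    using r2 val_emb_nonneg[of "3 * c"] by (intro W.val_diff_ge) simp_all
  ultimately show r0: "val2bar r = 0" using val_mult_zero(1) unram_cubic_integral by blast
  have "2 dvd 3 * c - 1" "2 dvd d - 1" using c d by (simp_all add: zadic2_even_simps)
  then obtain c' d' where c'd': "3 * c = 1 + 2 * c'" "d = 1 + 2 * d'"
    by (metis add.commute diff_add_cancel dvdE)
  have "3 * emb c = emb (3 * c)" by simp
  then have r3: "r ^ 3 = r + 1 + 2 * (emb c' * r + emb d')"
    unfolding r by (simp only: c'd') (simp add: algebra_simps)
  have pos: "0 < val2bar (2 * (emb c' * r + emb d'))"
    using r0 by (intro val_even_pos W.val_add_ge) (simp_all add: W.val_mult val_emb_nonneg)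
  have "r + 1 = r ^ 3 + - (2 * (emb c' * r + emb d'))" using r3 by simp
  moreover have "val2bar (r ^ 3) = 0" using r0 by (simp add: W.val_power)
  ultimately show r1: "val2bar (r + 1) = 0" using val_perturb pos by (metis W.val_minus)
  have "r\<^sup>2 + 1 = (r + 1)\<^sup>2 + - (2 * r)" by (simp add: power2_eq_square algebra_simps)
  moreover have "0 < val2bar (2 * r)" using r0 by (intro val_even_pos) simp
  moreover have "val2bar ((r + 1)\<^sup>2) = 0" using r1 by (simp add: val_square)
  ultimately show r21: "val2bar (r\<^sup>2 + 1) = 0" using val_perturb by (metis W.val_minus)
  have "r * (r\<^sup>2 + r + 1) = (r\<^sup>2 + 1) + 2 * (r + (emb c' * r + emb d'))"
    using r3 by (simp add: power2_eq_square power3_eq_cube algebra_simps)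
  moreover have "0 < val2bar (2 * (r + (emb c' * r + emb d')))"
    using r0 by (intro val_even_pos W.val_add_ge) (simp_all add: W.val_mult val_emb_nonneg)
  ultimately have "val2bar (r * (r\<^sup>2 + r + 1)) = 0" using val_perturb[OF r21] by simp
  then show "val2bar (r\<^sup>2 + r + 1) = 0" using r0 by (simp add: W.val_mult)
qed

definition cubic_poly :: "q2bar poly" where
  "cubic_poly = [:- emb d, - (3 * emb c), 0, 1:]"

lemma cubic_poly:
  shows "cubic_poly \<in> polys_over Q2" "Polynomial.lead_coeff cubic_poly = 1"
    "0 < Polynomial.degree cubic_poly" "poly cubic_poly r = 0"
proof -
  note S = subring_0[OF Q2_subring] subring_1[OF Q2_subring] subring_uminus[OF Q2_subring]
    subring_mult[OF Q2_subring] subring_numeral[OF Q2_subring]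
  show "cubic_poly \<in> polys_over Q2"
    unfolding cubic_poly_def by (intro pCons_in_polys_over zero_in_polys_over[OF Q2_subring] S emb_Q2)
qed (use r in \<open>auto simp: cubic_poly_def power3_eq_cube algebra_simps\<close>)

text \<open>Reducing the coefficients to 0 or 1 leaves the seven nonzero binary combinations of
  \<open>1, r, r ^ 2\<close>, all units by \<open>unram_cubic_units\<close>.\<close>

lemma cubic_unit:
  assumes "\<exists>i<Polynomial.degree cubic_poly. \<not> 2 dvd z i"
  shows "val2bar (\<Sum>i<Polynomial.degree cubic_poly. emb (z i) * r ^ i) = 0"
proof -
  have deg: "Polynomial.degree cubic_poly = 3" by (simp add: cubic_poly_def)
  have "\<exists>b y. z i = b + 2 * y \<and> (b = 0 \<and> 2 dvd z i \<or> b = 1 \<and> \<not> 2 dvd z i)" for i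
  proof (cases "2 dvd z i")
    case True
    then show ?thesis by (auto elim!: dvdE)
  next
    case False
    then have "2 dvd z i - 1" using zadic2_parity by blast
    then obtain y where "z i - 1 = 2 * y" by (auto elim: dvdE)
    then have "z i = 1 + 2 * y" by (simp add: algebra_simps)
    then show ?thesis using False by blast
  qed
  then obtain b y where zby: "\<And>i. z i = b i + 2 * y i"
    "\<And>i. b i = 0 \<and> 2 dvd z i \<or> b i = 1 \<and> \<not> 2 dvd z i" by metis
  have r0: "val2bar r = 0" and r2: "val2bar (r\<^sup>2) = 0"
    using unram_cubic_units(1) by (simp_all add: val_square)
  have rr1: "val2bar (r\<^sup>2 + r) = 0"
  proof -
    have "r\<^sup>2 + r = r * (r + 1)" by (simp add: power2_eq_square algebra_simps)
    then show ?thesis using unram_cubic_units(1,2) by (simp add: W.val_mult)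
  qed
  have "b 0 = 1 \<or> b 1 = 1 \<or> b 2 = 1" using assms zby(2) by (auto simp: deg numeral_3_eq_3 less_Suc_eq numeral_2_eq_2)
  then have "val2bar (emb (b 0) + emb (b 1) * r + emb (b 2) * r\<^sup>2) = 0"
    using zby(2)[of 0] zby(2)[of 1] zby(2)[of 2] r0 r2 rr1 unram_cubic_units
    by (auto simp: add_ac)
  moreover have "0 < val2bar (2 * (emb (y 0) + emb (y 1) * r + emb (y 2) * r\<^sup>2))"
    using r0 r2 by (intro val_even_pos W.val_add_ge) (simp_all add: W.val_mult val_emb_nonneg)
  ultimately have "val2bar ((emb (b 0) + emb (b 1) * r + emb (b 2) * r\<^sup>2)
      + 2 * (emb (y 0) + emb (y 1) * r + emb (y 2) * r\<^sup>2)) = 0" by (rule val_perturb)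
  moreover have "(\<Sum>i<Polynomial.degree cubic_poly. emb (z i) * r ^ i)
      = (emb (b 0) + emb (b 1) * r + emb (b 2) * r\<^sup>2)
      + 2 * (emb (y 0) + emb (y 1) * r + emb (y 2) * r\<^sup>2)"
    unfolding deg zby(1) by (simp add: numeral_3_eq_3 numeral_2_eq_2 algebra_simps)
  ultimately show ?thesis by simp
qed

lemma unram_cubic_ram_index: "has_ram_index (adjoin_elem Q2 r) 1"
  by (rule unramified_extension_ram_index[OF cubic_poly cubic_unit])

lemma unram_cubic_factor: "poly cubic_poly t = (t - r) * ((t - r') * (t - r''))"
proof -
  have "(t - r) * ((t - r') * (t - r'')) = (t - r) * (t\<^sup>2 - (r' + r'') * t + r' * r'')"
    by (simp add: power2_eq_square algebra_simps)
  also have "\<dots> = t ^ 3 - 3 * emb c * t - (r ^ 3 - 3 * emb c * r)"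
    unfolding r'r'' by (simp add: power2_eq_square power3_eq_cube algebra_simps)
  also have "r ^ 3 - 3 * emb c * r = emb d" using r by simp
  finally show ?thesis by (simp add: cubic_poly_def power3_eq_cube algebra_simps)
qed

text \<open>The roots differ by units, since \<open>(r - r') (r - r'')\<close> is the derivative at \<open>r\<close>.\<close>

lemma unram_cubic_separable: "val2bar (r' - r) = 0" "val2bar (r'' - r) = 0"
proof -
  have int: "0 \<le> val2bar r'" "0 \<le> val2bar r''"
  proof -
    have "poly cubic_poly r' = 0" "poly cubic_poly r'' = 0" unfolding unram_cubic_factor by simp_all
    then have "r' ^ 3 = 3 * emb c * r' + emb d" "r'' ^ 3 = 3 * emb c * r'' + emb d"
      by (simp_all add: cubic_poly_def power3_eq_cube algebra_simps)
    moreover have "0 \<le> val2bar (3 * emb c)" using val_emb_nonneg[of "3 * c"] by simp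
    ultimately show "0 \<le> val2bar r'" "0 \<le> val2bar r''" using val_bound_root val_emb_nonneg by blast+
  qed
  have "(r' - r) * (r'' - r) = r' * r'' - r * (r' + r'') + r * r" by (simp add: algebra_simps)
  also have "\<dots> = 3 * (r\<^sup>2 - emb c)" unfolding r'r'' by (simp add: power2_eq_square algebra_simps)
  also have "r\<^sup>2 - emb c = (r\<^sup>2 + 1) + - emb (c + 1)" by simp
  finally have e: "(r' - r) * (r'' - r) = 3 * ((r\<^sup>2 + 1) + - emb (c + 1))" .
  have "2 dvd c + 1" using c by (simp add: zadic2_even_simps)
  then have "0 < val2bar (- emb (c + 1))" using val_emb_pos W.val_minus by metis
  then have "val2bar ((r\<^sup>2 + 1) + - emb (c + 1)) = 0" by (rule val_perturb[OF unram_cubic_units(3)])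
  moreover have "val2bar (3 :: q2bar) = 0"
    using val_emb_unit[of 3] by (simp add: zadic2_even_numeral)
  ultimately have "val2bar ((r' - r) * (r'' - r)) = 0" unfolding e W.val_mult by simp
  moreover have "0 \<le> val2bar (r' - r)" "0 \<le> val2bar (r'' - r)"
    using int unram_cubic_integral by (auto intro: W.val_diff_ge)
  ultimately show "val2bar (r' - r) = 0" "val2bar (r'' - r) = 0" using val_mult_zero by blast+
qed

lemma unram_cubic_break: "max_upper_break Q2 (adjoin_elem Q2 r) = 0"
proof -
  let ?L = "adjoin_elem Q2 r"
  have L: "is_subring ?L" "Q2 \<subseteq> ?L" "r \<in> ?L"
    using adjoin_elem_subring adjoin_elem_base adjoin_elem_self Q2_subring by blast+
  have "poly cubic_poly r' = 0" unfolding unram_cubic_factor by simp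
  then obtain \<sigma> where \<sigma>: "\<sigma> \<in> embeddings Q2 ?L" "\<sigma> r = r'"
    using unramified_embedding[OF cubic_poly cubic_unit] by blast
  have "r' \<noteq> r" using unram_cubic_separable by auto
  show ?thesis
  proof (rule unramified_break[OF L(1,2) unram_cubic_ram_index])
    show "?L = adjoin Q2 {r}" by (rule adjoin_elem_eq_adjoin[OF Q2_subring order.refl])
    show "\<sigma> \<noteq> restrict id ?L" using \<sigma>(2) L(3) \<open>r' \<noteq> r\<close> by auto
    fix \<tau> x assume t: "\<tau> \<in> embeddings Q2 ?L" "x \<in> {r}" "\<tau> x \<noteq> x"
    have "poly cubic_poly (\<tau> r) = 0"
      using embedding_root[OF Q2_subring order.refl L(1,2) t(1) L(3) cubic_poly(1)] cubic_poly(4) by blast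
    then have "\<tau> r = r' \<or> \<tau> r = r''" using t(2,3) unfolding unram_cubic_factor by auto
    then show "val2bar (\<tau> x - x) = 0" using t(2) unram_cubic_separable by auto
  qed (use \<sigma>(1) unram_cubic_integral in auto)
qed

text \<open>The extension is cyclic: \<open>27 (4 c ^ 3 - d\<^sup>2)\<close> is congruent to \<open>1\<close> modulo \<open>8\<close>, so the
  discriminant is a square.\<close>

lemma unram_cubic_roots_mem: "r' \<in> adjoin_elem Q2 r" "r'' \<in> adjoin_elem Q2 r"
proof -
  let ?L = "adjoin_elem Q2 r"
  have L: "is_subring ?L" "Q2 \<subseteq> ?L" "r \<in> ?L"
    using adjoin_elem_subring adjoin_elem_base adjoin_elem_self Q2_subring by blast+
  have eL: "emb x \<in> ?L" for x by (rule subsetD[OF L(2) emb_Q2])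
  obtain c' where c': "c = 1 + 2 * c'" using c zadic2_parity by (metis add.commute diff_add_cancel dvdE)
  obtain d' where d': "d = 1 + 2 * d'" using d zadic2_parity by (metis add.commute diff_add_cancel dvdE)
  \<comment> \<open>\<open>d ^ 2 = 1 + 4 d' (d' + 1)\<close> is 1 modulo 8 and
    \<open>4 c ^ 3\<close> is 4 modulo 8, which leaves \<open>27 * (4 - 1) = 81\<close>, that is 1
    modulo 8.\<close>
  have "2 dvd d' * (d' + 1)" by (simp add: zadic2_even_simps)
  then obtain t where t: "d' * (d' + 1) = 2 * t" by (auto elim: dvdE)
  have "27 * (4 * c ^ 3 - d\<^sup>2) - 1
      = 8 * (10 + 27 * (3 * c' + 6 * c'\<^sup>2 + 4 * c' ^ 3)) - 27 * (4 * (d' * (d' + 1)))"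
    unfolding c' d' by (simp add: power2_eq_square power3_eq_cube algebra_simps)
  also have "\<dots> = 8 * (10 + 27 * (3 * c' + 6 * c'\<^sup>2 + 4 * c' ^ 3) - 27 * t)"
    unfolding t by (simp add: algebra_simps)
  finally have e8: "27 * (4 * c ^ 3 - d\<^sup>2) - 1 = 8 * (10 + 27 * (3 * c' + 6 * c'\<^sup>2 + 4 * c' ^ 3) - 27 * t)" .
  have "8 dvd 27 * (4 * c ^ 3 - d\<^sup>2) - 1" unfolding e8 by (rule dvd_triv_left)
  then obtain s where s: "27 * (4 * c ^ 3 - d\<^sup>2) = (1 + 4 * s)\<^sup>2" by (rule zadic2_square_1_mod_8)
  \<comment> \<open>The discriminant formula with \<open>b = d / 2\<close>; the factor 9 clears
    denominators, as \<open>9 * 12 * (c ^ 3 - d ^ 2 / 4) = 27 * (4 c ^ 3 - d ^ 2)\<close>.\<close>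
  have "((r' - r'') * (r\<^sup>2 - emb c))\<^sup>2 = 12 * (emb c ^ 3 - (emb d / 2)\<^sup>2)"
    using r r'r'' by (intro cubic_roots_discriminant) simp_all
  also have "9 * \<dots> = emb (27 * (4 * c ^ 3 - d\<^sup>2))" by (simp add: power_divide algebra_simps)
  finally have "(3 * ((r' - r'') * (r\<^sup>2 - emb c)))\<^sup>2 = (emb (1 + 4 * s))\<^sup>2"
    unfolding s by (simp add: power_mult_distrib)
  then have "3 * ((r' - r'') * (r\<^sup>2 - emb c)) \<in> ?L"
    by (rule square_eq_imp_mem[OF L(1)]) (rule eL)
  moreover have rc: "r\<^sup>2 - emb c \<in> ?L" "r\<^sup>2 - emb c \<noteq> 0"
  proof -
    show "r\<^sup>2 - emb c \<in> ?L"
      by (intro subring_diff[OF L(1)] subring_power[OF L(1)] L(3) eL)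
    have "2 dvd c + 1" using c by (simp add: zadic2_even_simps)
    then have "0 < val2bar (- emb (c + 1))" using val_emb_pos W.val_minus by metis
    then have "val2bar ((r\<^sup>2 + 1) + - emb (c + 1)) = 0" by (rule val_perturb[OF unram_cubic_units(3)])
    then show "r\<^sup>2 - emb c \<noteq> 0" by auto
  qed
  ultimately have "3 * ((r' - r'') * (r\<^sup>2 - emb c)) / (r\<^sup>2 - emb c) / 3 \<in> ?L"
    by (intro half_mem[OF L(1,2)] subring_divide[OF L(1,2)])
  then have diff: "r' - r'' \<in> ?L" using rc by simp
  have mr: "- r \<in> ?L" by (rule subring_uminus[OF L(1,3)])
  have h: "(- r + (r' - r'')) / 2 \<in> ?L"
    by (rule half_mem[OF L(1,2)], rule subring_add[OF L(1) mr diff])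
  have h': "(- r - (r' - r'')) / 2 \<in> ?L"
    by (rule half_mem[OF L(1,2)], rule subring_diff[OF L(1) mr diff])
  have e: "r' = (- r + (r' - r'')) / 2" "r'' = (- r - (r' - r'')) / 2"
    unfolding r'r''(1) [symmetric] by simp_all
  show "r' \<in> ?L" "r'' \<in> ?L"
    using h h' unfolding e [symmetric] .
qed

end

text \<open>Cardano's formula. The two cube roots \<open>A\<close> and \<open>B\<close> are rational multiples of powers of a cube
  root of \<open>-2\<close>.\<close>

lemma cubic_roots_tame:
  fixes a b s t :: q2 and m :: nat
  assumes disc: "b\<^sup>2 - a ^ 3 = (b * s)\<^sup>2" and cube: "b * (1 + s) = 2 ^ m * t ^ 3"
    and nz: "b \<noteq> 0" "s \<noteq> 0" "t \<noteq> 0" and m: "m mod 3 \<noteq> 0"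
  obtains \<omega> \<theta> where "\<omega>\<^sup>2 + \<omega> + 1 = 0" "\<theta> ^ 3 = - 2" "adjoin Q2 (cubic_roots a b) = adjoin Q2 {\<omega>, \<theta>}"
proof -
  obtain \<omega> :: q2bar where "poly [:1, 1, 1:] \<omega> = 0" by (rule exists_root[of "[:1, 1, 1:]"]) simp_all
  then have \<omega>: "\<omega>\<^sup>2 + \<omega> + 1 = 0" by (simp add: power2_eq_square algebra_simps)
  obtain \<theta> :: q2bar where "poly [:2, 0, 0, 1:] \<theta> = 0" by (rule exists_root[of "[:2, 0, 0, 1:]"]) simp_all
  then have \<theta>: "\<theta> ^ 3 = - 2" by (simp add: power3_eq_cube algebra_simps eq_neg_iff_add_eq_0)
  define v where "v = \<omega>\<^sup>2"
  have sum: "\<omega> + v = - 1" and prod: "\<omega> * v = 1"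
    using omega_sum[OF \<omega>] omega_prod[OF \<omega>] by (simp_all add: v_def)
  have sq: "\<omega> * \<omega> + v * v = - 1"
  proof -
    have "\<omega> * \<omega> + v * v = (\<omega> + v) * (\<omega> + v) - 2 * (\<omega> * v)" by (simp add: algebra_simps)
    then show ?thesis by (simp add: sum prod)
  qed
  define k where "k = m div 3"
  have mk: "m = 3 * k + 1 \<or> m = 3 * k + 2" using m unfolding k_def by presburger
  define e where "e = to_ac (2 ^ k * t)"
  have e: "e \<noteq> 0" "e \<in> Q2" "e ^ 3 = to_ac (2 ^ (3 * k) * t ^ 3)"
    using nz(3) by (simp_all add: e_def power_mult_distrib power_mult mult.commute del: to_ac_mult to_ac_power flip: to_ac_power)
  \<comment> \<open>As \<open>\<theta> ^ 3 = - 2\<close>, the exponent \<open>3 k + 1\<close> needs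
    a minus sign, while for \<open>3 k + 2\<close> the square of \<open>\<theta>\<close> has cube
    4.\<close>
  define A where "A = (if m = 3 * k + 1 then - e * \<theta> else e * \<theta>\<^sup>2)"
  have \<theta>0: "\<theta> \<noteq> 0" using \<theta> by auto
  have A0: "A \<noteq> 0" using e(1) \<theta>0 by (simp add: A_def)
  have A3: "A ^ 3 = to_ac (b * (1 + s))"
  proof (cases "m = 3 * k + 1")
    case True
    then have "A ^ 3 = - (e ^ 3) * \<theta> ^ 3" by (simp add: A_def power_mult_distrib)
    then show ?thesis unfolding cube e(3) \<theta> by (simp add: True)
  next
    case False
    then have "A ^ 3 = e ^ 3 * (\<theta> ^ 3)\<^sup>2" by (simp add: A_def power_mult_distrib flip: power_mult)
    moreover have "m = 3 * k + 2" using mk False by simp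
    ultimately show ?thesis unfolding cube e(3) \<theta> by (simp add: power_add)
  qed
  define B where "B = to_ac a / A"
  have AB: "A * B = to_ac a" using A0 by (simp add: B_def)
  have "A ^ 3 * B ^ 3 = to_ac (a ^ 3)" using AB by (simp flip: power_mult_distrib)
  also have "a ^ 3 = b * (1 + s) * (b * (1 - s))" using disc by (simp add: power2_eq_square algebra_simps)
  also have "to_ac \<dots> = A ^ 3 * to_ac (b * (1 - s))" unfolding A3 by (rule to_ac_mult)
  finally have B3: "B ^ 3 = to_ac (b * (1 - s))" using A0 by simp
  have AB3: "A ^ 3 + B ^ 3 = 2 * to_ac b" unfolding A3 B3 by (simp add: algebra_simps)
  define z1 z2 z3 where "z1 = A + B" and "z2 = \<omega> * A + v * B" and "z3 = v * A + \<omega> * B"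
  have s23: "z2 + z3 = - z1"
  proof -
    have "z2 + z3 = (\<omega> + v) * (A + B)" by (simp add: z2_def z3_def algebra_simps)
    then show ?thesis by (simp add: sum z1_def)
  qed
  have p23: "z2 * z3 = z1\<^sup>2 - 3 * to_ac a"
  proof -
    have "z2 * z3 = \<omega> * v * (A * A + B * B) + (\<omega> * \<omega> + v * v) * (A * B)"
      by (simp add: z2_def z3_def algebra_simps)
    then show ?thesis unfolding sq prod by (simp add: z1_def power2_eq_square algebra_simps flip: AB)
  qed
  have z1: "z1 ^ 3 = 3 * to_ac a * z1 + 2 * to_ac b"
    unfolding AB [symmetric] AB3 [symmetric]
    by (simp add: z1_def power3_eq_cube algebra_simps)
  have roots: "cubic_roots a b = {z1, z2, z3}"
  proof -
    obtain y2 y3 where y: "cubic_roots a b = {z1, y2, y3}" "y2 + y3 = - z1" "y2 * y3 = z1\<^sup>2 - 3 * to_ac a"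
      by (rule cubic_roots_split[of z1 a b]) (use z1 in \<open>simp add: cubic_roots_def\<close>)
    have "(z2 - y2) * (z2 - y3) = z2 * z2 - (y2 + y3) * z2 + y2 * y3" by (simp add: algebra_simps)
    also have "\<dots> = z2 * z2 - (z2 + z3) * z2 + z2 * z3" unfolding y(2,3) s23 p23 ..
    also have "\<dots> = 0" by (simp add: algebra_simps)
    finally have "z2 = y2 \<or> z2 = y3" by simp
    moreover have "z2 + z3 = y2 + y3" using s23 y(2) by simp
    ultimately have "z2 = y2 \<and> z3 = y3 \<or> z2 = y3 \<and> z3 = y2" by (metis add.commute add_left_cancel)
    then show ?thesis unfolding y(1) by blast
  qed
  have "adjoin Q2 (cubic_roots a b) = adjoin Q2 {\<omega>, \<theta>}"
  proof (rule adjoin_cong)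
    let ?S = "adjoin Q2 {\<omega>, \<theta>}"
    note S = adjoin_is_subring[of Q2 "{\<omega>, \<theta>}"] adjoin_upper(1)[of Q2 "{\<omega>, \<theta>}"]
    have in_S: "\<omega> \<in> ?S" "\<theta> \<in> ?S" "e \<in> ?S" "to_ac a \<in> ?S"
      using e(2) by (auto intro: adjoin_memI)
    then have "v \<in> ?S" unfolding v_def by (intro subring_power[OF S(1)])
    moreover have AS: "A \<in> ?S"
      unfolding A_def using in_S by (simp add: subring_mult[OF S(1)] subring_uminus[OF S(1)] subring_power[OF S(1)])
    moreover have "B \<in> ?S" unfolding B_def by (rule subring_divide[OF S in_S(4) AS])
    ultimately show "cubic_roots a b \<subseteq> ?S"
      unfolding roots z1_def z2_def z3_def using in_S(1)
      by (simp add: subring_mult[OF S(1)] subring_add[OF S(1)])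
  next
    let ?S = "adjoin Q2 (cubic_roots a b)"
    note S = adjoin_is_subring[of Q2 "cubic_roots a b"] adjoin_upper(1)[of Q2 "cubic_roots a b"]
    have z: "z1 \<in> ?S" "z2 \<in> ?S" "z3 \<in> ?S" by (rule adjoin_memI(1), simp add: roots)+
    have Q: "to_ac x \<in> ?S" for x by (rule adjoin_memI(2)[OF to_ac_Q2])
    \<comment> \<open>The discriminant provides the square root of \<open>-3\<close>:
      \<open>D\<close> is, up to sign, a rational multiple of \<open>2 \<omega> + 1\<close>.\<close>
    define D where "D = (z2 - z3) * (z1\<^sup>2 - to_ac a)"
    have "D\<^sup>2 = 12 * (to_ac a ^ 3 - (to_ac b)\<^sup>2)"
      unfolding D_def using z1 s23 p23 by (rule cubic_roots_discriminant)
    also have "\<dots> = - 12 * to_ac (b\<^sup>2 - a ^ 3)" by simp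
    also have "\<dots> = - 3 * (2 * to_ac (b * s))\<^sup>2" unfolding disc by (simp add: power_mult_distrib)
    also have "- 3 = (2 * \<omega> + 1)\<^sup>2"
    proof -
      have "(2 * \<omega> + 1)\<^sup>2 = 4 * (\<omega>\<^sup>2 + \<omega> + 1) - 3" by (simp add: power2_eq_square algebra_simps)
      then show ?thesis by (simp add: \<omega>)
    qed
    finally have "((2 * \<omega> + 1) * (2 * to_ac (b * s)))\<^sup>2 = D\<^sup>2" by (simp only: power_mult_distrib)
    moreover have "D \<in> ?S"
      unfolding D_def by (intro subring_mult[OF S(1)] subring_diff[OF S(1)] subring_power[OF S(1)] z Q)
    ultimately have "(2 * \<omega> + 1) * (2 * to_ac (b * s)) \<in> ?S" by (rule square_eq_imp_mem[OF S(1)])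
    then have "(2 * \<omega> + 1) * (2 * to_ac (b * s)) / (2 * to_ac (b * s)) \<in> ?S"
      by (rule subring_divide[OF S]) (intro subring_mult[OF S(1)] subring_numeral[OF S(1)] Q)
    then have "2 * \<omega> + 1 \<in> ?S" using nz by simp
    then have "(2 * \<omega> + 1 - 1) / 2 \<in> ?S"
      by (intro half_mem[OF S] subring_diff[OF S(1)] subring_1[OF S(1)])
    then have \<omega>S: "\<omega> \<in> ?S" by simp
    then have vS: "v \<in> ?S" unfolding v_def by (rule subring_power[OF S(1)])
    \<comment> \<open>The Lagrange resolvent isolates \<open>A\<close>: the coefficient of
      \<open>B\<close> is \<open>1 + \<omega> ^ 2 + v ^ 2 = 0\<close>.\<close>
    have "z1 + v * z2 + \<omega> * z3 = (1 + 2 * (\<omega> * v)) * A + (1 + (\<omega> * \<omega> + v * v)) * B"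
      by (simp add: z1_def z2_def z3_def algebra_simps)
    then have "z1 + v * z2 + \<omega> * z3 = 3 * A" unfolding sq prod by simp
    moreover have "(z1 + v * z2 + \<omega> * z3) / 3 \<in> ?S"
      using \<omega>S vS z by (intro half_mem[OF S] subring_add[OF S(1)] subring_mult[OF S(1)])
    ultimately have AS: "A \<in> ?S" by simp
    have eS: "e \<in> ?S" using e(2) by (rule adjoin_memI(2))
    have Ae: "A / e \<in> ?S" by (rule subring_divide[OF S AS eS])
    have "\<theta> \<in> ?S"
    proof (cases "m = 3 * k + 1")
      case True
      then have "\<theta> = - (A / e)" using e(1) by (simp add: A_def)
      then show ?thesis using subring_uminus[OF S(1) Ae] by simp
    next
      case False
      then have "A / e = \<theta>\<^sup>2" using e(1) by (simp add: A_def)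
      moreover have "\<theta> = - 2 / \<theta>\<^sup>2" using \<theta> \<theta>0 by (simp add: field_simps power2_eq_square power3_eq_cube)
      moreover have "- 2 / (A / e) \<in> ?S"
        by (rule subring_divide[OF S _ Ae]) (intro subring_uminus[OF S(1)] subring_numeral[OF S(1)])
      ultimately show ?thesis by simp
    qed
    then show "{\<omega>, \<theta>} \<subseteq> ?S" using \<omega>S by simp
  qed
  then show ?thesis using that \<omega> \<theta> by blast
qed

lemma power2_unit_unique:
  fixes u v :: zadic2
  assumes "\<not> 2 dvd u" "\<not> 2 dvd v" "2 ^ m * u = 2 ^ n * v"
  shows "m = n" "u = v"
proof -
  have *: "n \<le> m" if "\<not> 2 dvd u" "2 ^ m * u = 2 ^ n * v" for m n and u v :: zadic2
  proof (rule ccontr)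
    assume "\<not> n \<le> m"
    then obtain k where "n = m + Suc k" using less_imp_Suc_add[of m n] by auto
    then have "2 ^ m * u = 2 ^ m * (2 ^ Suc k * v)" using that(2) by (simp add: power_add algebra_simps)
    then have "u = 2 * (2 ^ k * v)" by simp
    then show False using that(1) by (metis dvd_triv_left)
  qed
  show "m = n" using *[OF assms(1,3)] *[OF assms(2) assms(3)[symmetric]] by simp
  then show "u = v" using assms(3) by simp
qed

lemma power2_dvd_unit_iff:
  assumes "\<not> 2 dvd (u :: zadic2)"
  shows "2 ^ m dvd 2 ^ p * u \<longleftrightarrow> m \<le> p"
proof
  assume d: "2 ^ m dvd 2 ^ p * u"
  show "m \<le> p"
  proof (rule ccontr)
    assume "\<not> m \<le> p"
    then have "2 ^ Suc p dvd 2 ^ p * u" using d by (metis le_imp_power_dvd dvd_trans not_less_eq_eq)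
    then obtain x where "2 ^ p * u = 2 ^ Suc p * x" by (auto elim: dvdE)
    then have "u = 2 * x" by simp
    then show False using assms by (metis dvd_triv_left)
  qed
qed (simp add: le_imp_power_dvd)

lemma zadic2_decompose':
  assumes "(x :: zadic2) \<noteq> 0"
  obtains n u where "\<not> 2 dvd u" "x = 2 ^ n * u"
  using zadic2_decompose[OF assms] zadic2_unit_iff by metis

text \<open>The order of a cube is a multiple of three, so \<open>j\<close> may be as large as
  \<open>m / 3\<close> rounded up; this is what \<open>m + 2\<close> expresses.\<close>

lemma power2_dvd_cube:
  assumes "2 ^ m dvd (x :: zadic2) ^ 3" "3 * j \<le> m + 2"
  shows "2 ^ j dvd x"
proof (cases "x = 0")
  case False
  then obtain p u where u: "\<not> 2 dvd u" "x = 2 ^ p * u" by (rule zadic2_decompose')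
  have "x ^ 3 = 2 ^ (3 * p) * u ^ 3" by (simp add: u(2) power_mult_distrib power_mult mult.commute flip: power_mult)
  moreover have "\<not> 2 dvd u ^ 3" using u(1) by (simp add: zadic2_even_power)
  ultimately have "m \<le> 3 * p" using assms(1) power2_dvd_unit_iff by metis
  then have "j \<le> p" using assms(2) by simp
  then show ?thesis by (simp add: u(2) le_imp_power_dvd)
qed simp

section \<open>The two shapes of the Newton polygon\<close>

context
  fixes C4 C6 d :: zadic2 and n :: nat
  assumes disc: "C4 ^ 3 - C6\<^sup>2 = 1728 * (2 ^ n * d)" and d: "\<not> 2 dvd d"
begin

text \<open>The broken Newton polygon case: with \<open>Z = - (2 C6 / 3 C4) T\<close> the cubic becomes
  \<open>T = 1 - e T ^ 3\<close> with \<open>e\<close> even.\<close>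

lemma broken_polygon_root:
  assumes "\<not> 2 ^ (8 + n) dvd C4 ^ 3"
  obtains z where "to_ac z \<in> cubic_roots (to_fract C4) (to_fract C6)"
proof (cases "C6 = 0")
  case True
  then have "to_ac 0 \<in> cubic_roots (to_fract C4) (to_fract C6)" by (simp add: cubic_roots_def)
  then show ?thesis by (rule that)
next
  case False
  then obtain q w where w: "\<not> 2 dvd w" "C6 = 2 ^ q * w" by (rule zadic2_decompose')
  have C40: "C4 \<noteq> 0" using assms by auto
  then obtain p u where u: "\<not> 2 dvd u" "C4 = 2 ^ p * u" by (rule zadic2_decompose')
  have C43: "C4 ^ 3 = 2 ^ (3 * p) * u ^ 3" and C62: "C6\<^sup>2 = 2 ^ (2 * q) * w\<^sup>2"
    by (simp_all add: u(2) w(2) power_mult_distrib flip: power_mult)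
      (simp_all add: mult.commute)
  have odd: "\<not> 2 dvd u ^ 3" "\<not> 2 dvd w\<^sup>2" using u(1) w(1) by (simp_all add: zadic2_even_power)
  have "3 * p < 8 + n" using assms power2_dvd_unit_iff[OF odd(1)] unfolding C43 by (metis not_le)
  \<comment> \<open>\<open>3 p \<le> 7 + n\<close> makes \<open>C4 ^ 3\<close> and
    \<open>1728 \<Delta>\<close> multiples of \<open>2 ^ (3 p - 1)\<close>, hence also
    \<open>C6 ^ 2\<close>. So \<open>4 C6 ^ 2\<close> has order at least \<open>3 p + 1\<close>,
    which makes \<open>e\<close> even.\<close>
  define m where "m = 3 * p - 1"
  have "2 ^ m dvd C4 ^ 3" unfolding C43 by (simp add: m_def le_imp_power_dvd)
  moreover have "2 ^ m dvd 1728 * (2 ^ n * d)"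
  proof -
    have "1728 * (2 ^ n * d) = 2 ^ (6 + n) * (27 * d)" by (simp add: power_add)
    moreover have "(2 :: zadic2) ^ m dvd 2 ^ (6 + n)" using \<open>3 * p < 8 + n\<close> by (intro le_imp_power_dvd) (simp add: m_def)
    ultimately show ?thesis by (metis dvd_mult2)
  qed
  ultimately have "2 ^ m dvd C4 ^ 3 - 1728 * (2 ^ n * d)" by (rule dvd_diff)
  also have "C4 ^ 3 - 1728 * (2 ^ n * d) = C6\<^sup>2" using disc by (simp add: algebra_simps)
  finally have "m \<le> 2 * q" unfolding C62 power2_dvd_unit_iff[OF odd(2)] .
  then obtain l where l: "2 * q + 2 = 3 * p + Suc l" unfolding m_def
    by (metis add_Suc_right add_le_cancel_right diff_add_inverse2 le_diff_conv le_iff_add less_eq_Suc_le add_2_eq_Suc' Suc_le_mono add_Suc plus_1_eq_Suc add.commute)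
  have "\<not> 2 dvd 27 * u ^ 3" using odd(1) by (simp add: zadic2_even_simps)
  then obtain y where y: "27 * u ^ 3 * y = 1" using zadic2_unit_iff by (metis dvdE)
  \<comment> \<open>This is \<open>- 4 C6 ^ 2 / (27 C4 ^ 3)\<close>, written with the inverse
    \<open>y\<close> of the odd part of the denominator.\<close>
  define e where "e = - (2 ^ Suc l * w\<^sup>2 * y)"
  have e: "e * (27 * C4 ^ 3) = - (4 * C6\<^sup>2)"
  proof -
    have "e * (27 * C4 ^ 3) = - (2 ^ (3 * p + Suc l) * w\<^sup>2 * (27 * u ^ 3 * y))"
      unfolding C43 e_def by (simp add: power_add algebra_simps)
    also have "\<dots> = - (2 ^ (2 * q + 2) * w\<^sup>2)" unfolding y l by simp
    also have "\<dots> = - (4 * C6\<^sup>2)" unfolding C62 by (simp add: power_add)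
    finally show ?thesis .
  qed
  have e2: "2 dvd e" by (simp add: e_def)
  obtain T where T: "1 - e * T ^ 3 = T"
  proof (rule zadic2_contraction_fixpoint[of "\<lambda>T. 1 - e * T ^ 3"])
    fix x y :: zadic2 and n
    assume xy: "2 ^ n dvd x - y"
    have "2 ^ Suc n dvd e * - (x\<^sup>2 + x * y + y\<^sup>2) * (x - y)"
      by (rule zadic2_contraction_mult[OF xy dvd_mult2[OF e2]])
    also have "e * - (x\<^sup>2 + x * y + y\<^sup>2) * (x - y) = 1 - e * x ^ 3 - (1 - e * y ^ 3)"
      by (simp add: algebra_simps power2_eq_square power3_eq_cube)
    finally show "2 ^ Suc n dvd 1 - e * x ^ 3 - (1 - e * y ^ 3)" .
  qed
  define a b t where "a = to_fract C4" and "b = to_fract C6" and "t = to_fract T"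
  have a0: "a \<noteq> 0" using C40 by (simp add: a_def)
  have eq: "to_fract e * (27 * a ^ 3) = - (4 * b\<^sup>2)"
    using arg_cong[OF e, of to_fract] by (simp add: a_def b_def)
  have tq: "1 - to_fract e * t ^ 3 = t" using arg_cong[OF T, of to_fract] by (simp add: t_def)
  define z where "z = - (2 * b * t) / (3 * a)"
  have za: "3 * a * z = - (2 * b * t)" using a0 by (simp add: z_def)
  have "27 * a ^ 3 * z ^ 3 = (3 * a * z) ^ 3" by (simp add: power_mult_distrib)
  also have "\<dots> = 2 * b * t ^ 3 * - (4 * b\<^sup>2)" unfolding za by (simp add: power_mult_distrib power2_eq_square power3_eq_cube)
  also have "\<dots> = 27 * a ^ 3 * (2 * b * (to_fract e * t ^ 3))" unfolding eq [symmetric] by (simp add: algebra_simps)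
  finally have "z ^ 3 = 2 * b * (to_fract e * t ^ 3)" using a0 by simp
  also have "to_fract e * t ^ 3 = 1 - t" using tq by (simp add: algebra_simps)
  also have "2 * b * (1 - t) = 3 * a * z + 2 * b" unfolding za by (simp add: algebra_simps)
  finally have "to_ac (z ^ 3) = to_ac (3 * a * z + 2 * b)" by (rule arg_cong)
  then have "to_ac z \<in> cubic_roots a b" by (simp add: cubic_roots_def)
  then show ?thesis using that by (simp add: a_def b_def)
qed

context
  assumes straight: "2 ^ (8 + n) dvd C4 ^ 3"
begin

text \<open>\<open>1728 \<Delta>\<close> has order exactly \<open>6 + n\<close> and
  \<open>C4 ^ 3\<close> at least two more, so \<open>C6 ^ 2 = 2 ^ (6 + n) * (4 x - 27 d)\<close>
  with odd second factor. As the left side is a square, \<open>n\<close> is even and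
  \<open>4 x - 27 d = w ^ 2\<close>; modulo 4 this reads \<open>d = 1\<close>.\<close>

lemma straight_polygon_c6:
  obtains q w where "C6 = 2 ^ q * w" "\<not> 2 dvd w" "2 * q = 6 + n" "4 dvd d - 1"
proof -
  obtain x where x: "C4 ^ 3 = 2 ^ (8 + n) * x" using straight by (auto elim: dvdE)
  have "C6\<^sup>2 = 2 ^ (8 + n) * x - 1728 * (2 ^ n * d)" using disc x by (simp add: algebra_simps)
  then have C62: "C6\<^sup>2 = 2 ^ (6 + n) * (4 * x - 27 * d)" by (simp add: power_add algebra_simps)
  have odd: "\<not> 2 dvd 4 * x - 27 * d" using d by (simp add: zadic2_even_simps)
  then have "4 * x - 27 * d \<noteq> 0" by (metis dvd_0_right)
  then have "C6 \<noteq> 0" using C62 by auto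
  then obtain q w where w: "\<not> 2 dvd w" "C6 = 2 ^ q * w" by (rule zadic2_decompose')
  have "\<not> 2 dvd w\<^sup>2" using w(1) by (simp add: zadic2_even_power)
  moreover have "2 ^ (2 * q) * w\<^sup>2 = 2 ^ (6 + n) * (4 * x - 27 * d)"
    unfolding C62 [symmetric] w(2) by (simp add: power_mult_distrib mult.commute flip: power_mult)
  ultimately have q: "2 * q = 6 + n" "w\<^sup>2 = 4 * x - 27 * d" using power2_unit_unique odd by blast+
  obtain w' where w': "w = 1 + 2 * w'" using w(1) zadic2_parity by (metis add.commute diff_add_cancel dvdE)
  have "d - 1 = 4 * (7 * d - x + w' + w'\<^sup>2)"
    using q(2) unfolding w' by (simp add: power2_eq_square algebra_simps)
  then have "4 dvd d - 1" by (metis dvd_triv_left)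
  then show ?thesis using that w q(1) by blast
qed

text \<open>For \<open>q + 1\<close> prime to 3, divisibility of the cube \<open>C4 ^ 3\<close> by
  \<open>2 ^ (2 q + 2)\<close> improves to \<open>2 ^ (2 q + 3)\<close>. So
  \<open>C4 ^ 3 / C6 ^ 2\<close> is a multiple of 8, and one minus it is a square: the square root
  in Cardano's formula is rational.\<close>

lemma straight_polygon_tame:
  assumes q: "C6 = 2 ^ q * w" "\<not> 2 dvd w" "2 * q = 6 + n" "(q + 1) mod 3 \<noteq> 0"
  obtains \<omega> \<theta> where "\<omega>\<^sup>2 + \<omega> + 1 = 0" "\<theta> ^ 3 = - 2"
    "adjoin Q2 (cubic_roots (to_fract C4) (to_fract C6)) = adjoin Q2 {\<omega>, \<theta>}"
proof -
  have st: "2 ^ (2 * q + 2) dvd C4 ^ 3" using straight q(3) by (simp add: algebra_simps)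
  \<comment> \<open>\<open>(2 q + 2) / 3\<close> rounded up.\<close>
  define j where "j = (2 * q + 4) div 3"
  have j: "3 * j \<le> 2 * q + 2 + 2" "2 * q + 3 \<le> 3 * j" using q(4) unfolding j_def by presburger+
  have "2 ^ j dvd C4" using st j(1) by (rule power2_dvd_cube)
  then have "2 ^ (3 * j) dvd C4 ^ 3" by (metis dvd_power_same mult.commute power_mult)
  then have "2 ^ (2 * q + 3) dvd C4 ^ 3" using j(2) by (meson dvd_trans le_imp_power_dvd)
  then obtain x where x: "C4 ^ 3 = 2 ^ (2 * q + 3) * x" by (auto elim: dvdE)
  obtain y where y: "w\<^sup>2 * y = 1"
    using q(2) zadic2_unit_iff[of "w\<^sup>2"] by (metis dvdE zadic2_even_power)
  have "8 dvd (1 - 8 * (x * y)) - 1" by simp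
  then obtain s where s: "1 - 8 * (x * y) = (1 + 4 * s)\<^sup>2" by (rule zadic2_square_1_mod_8)
  have disc': "C6\<^sup>2 - C4 ^ 3 = (C6 * (1 + 4 * s))\<^sup>2"
  proof -
    have C62: "C6\<^sup>2 = 2 ^ (2 * q) * w\<^sup>2" unfolding q(1) by (simp add: power_mult_distrib mult.commute flip: power_mult)
    have "C4 ^ 3 = 2 ^ (2 * q) * (w\<^sup>2 * y) * (8 * x)" unfolding x y by (simp add: power_add)
    then have "C6\<^sup>2 - C4 ^ 3 = C6\<^sup>2 * (1 - 8 * (x * y))" unfolding C62 by (simp add: algebra_simps)
    then show ?thesis unfolding s by (simp add: power_mult_distrib)
  qed
  \<comment> \<open>\<open>C6 * (1 + (1 + 4 s)) = 2 ^ (q + 1) * w * (1 + 2 s)\<close>, and the odd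
    factor is a cube; \<open>q + 1\<close> becomes the exponent \<open>m\<close> of
    \<open>cubic_roots_tame\<close>.\<close>
  have "\<not> 2 dvd w * (1 + 2 * s)" using q(2) by (simp add: zadic2_even_simps)
  then obtain t where t: "\<not> 2 dvd t" "w * (1 + 2 * s) = t ^ 3" by (rule zadic2_unit_cube)
  have cube: "C6 * (1 + (1 + 4 * s)) = 2 ^ (q + 1) * t ^ 3"
    unfolding q(1) t(2) [symmetric] by (simp add: algebra_simps)
  have "1 + 4 * s \<noteq> 0" using zadic2_even_simps by (metis dvd_0_right)
  have t0: "t \<noteq> 0" using t(1) by auto
  have C60: "C6 \<noteq> 0" using q(1,2) by auto
  show ?thesis
  proof (rule cubic_roots_tame[of "to_fract C6" "to_fract C4" "to_fract (1 + 4 * s)" "q + 1" "to_fract t"])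
    show "(to_fract C6)\<^sup>2 - to_fract C4 ^ 3 = (to_fract C6 * to_fract (1 + 4 * s))\<^sup>2"
      using arg_cong[OF disc', of to_fract] by simp
    show "to_fract C6 * (1 + to_fract (1 + 4 * s)) = 2 ^ (q + 1) * to_fract t ^ 3"
      using arg_cong[OF cube, of to_fract] by simp
    show "to_fract C6 \<noteq> 0" "to_fract (1 + 4 * s) \<noteq> 0" "to_fract t \<noteq> 0"
      using C60 t0 \<open>1 + 4 * s \<noteq> 0\<close> by (simp_all only: to_fract_eq_0_iff not_False_eq_True)
  qed (use q(4) that in auto)
qed

text \<open>As \<open>2 C6\<close> has order \<open>q + 1 = 3 k\<close>, the substitution
  \<open>z = 2 ^ k x\<close> gives \<open>x ^ 3 = 3 c x + w\<close> with \<open>w\<close> odd. For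
  even \<open>c\<close> this is \<open>x ^ 3 = 1\<close> modulo 2, whose simple root 1 lifts; for
  odd \<open>c\<close> it is \<open>x ^ 3 = x + 1\<close>, irreducible modulo 2.\<close>

lemma straight_polygon_unramified:
  assumes q: "C6 = 2 ^ q * w" "\<not> 2 dvd w" "2 * q = 6 + n" "q + 1 = 3 * k"
  obtains (reducible) z where "to_ac z \<in> cubic_roots (to_fract C4) (to_fract C6)"
    | (cyclic) r where "adjoin Q2 (cubic_roots (to_fract C4) (to_fract C6)) = adjoin_elem Q2 r"
        "has_ram_index (adjoin_elem Q2 r) 1" "max_upper_break Q2 (adjoin_elem Q2 r) = 0"
proof -
  have "2 ^ (2 * q + 2) dvd C4 ^ 3" using straight q(3) by (simp add: algebra_simps)
  then have "2 ^ (2 * k) dvd C4" by (rule power2_dvd_cube) (use q(4) in simp)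
  then obtain c where c: "C4 = 2 ^ (2 * k) * c" by (auto elim: dvdE)
  have C6: "2 * C6 = 2 ^ (3 * k) * w" unfolding q(1) q(4) [symmetric] by simp
  define g where "g = to_ac (2 ^ k :: q2)"
  have g0: "g \<noteq> 0" "g \<in> Q2" by (simp_all add: g_def del: to_ac_power)
  have a: "to_ac (to_fract C4) = g\<^sup>2 * emb c"
    unfolding c by (simp add: g_def power_mult mult.commute flip: power_mult)
  have b: "2 * to_ac (to_fract C6) = g ^ 3 * emb w"
  proof -
    have "2 * to_ac (to_fract C6) = to_ac (to_fract (2 * C6))" by simp
    then show ?thesis unfolding C6 by (simp add: g_def mult.commute flip: power_mult)
  qed
  have scale: "g * x \<in> cubic_roots (to_fract C4) (to_fract C6) \<longleftrightarrow> x ^ 3 = 3 * emb c * x + emb w" for x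
  proof -
    have "(g * x) ^ 3 = g ^ 3 * x ^ 3" by (simp add: power_mult_distrib)
    moreover have "3 * to_ac (to_fract C4) * (g * x) + 2 * to_ac (to_fract C6) = g ^ 3 * (3 * emb c * x + emb w)"
      unfolding a b by (simp add: power2_eq_square power3_eq_cube algebra_simps)
    ultimately show ?thesis using g0(1) by (simp add: cubic_roots_def)
  qed
  show ?thesis
  proof (cases "2 dvd c")
    case True
    have "2 dvd 3 * c + w - 1" using True q(2) by (simp add: zadic2_even_simps)
    then obtain \<kappa> where \<kappa>: "3 * c + w - 1 = 2 * \<kappa>" by (auto elim: dvdE)
    \<comment> \<open>The equation for the root \<open>1 + 2 x\<close>, divided by 2, with one copy
      of \<open>x\<close> isolated; \<open>c\<close> even makes it a contraction.\<close>
    define F where "F x = \<kappa> - 2 * x - 6 * x\<^sup>2 - 4 * x ^ 3 + 3 * c * x" for x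
    obtain x where x: "F x = x"
    proof (rule zadic2_contraction_fixpoint[of F])
      fix x y :: zadic2 and n
      assume xy: "2 ^ n dvd x - y"
      have "2 dvd 3 * c - 2 * (1 + 3 * (x + y) + 2 * (x\<^sup>2 + x * y + y\<^sup>2))"
        using True by (simp only: zadic2_even_diff zadic2_even_mult simp_thms dvd_refl)
      then have "2 ^ Suc n dvd (3 * c - 2 * (1 + 3 * (x + y) + 2 * (x\<^sup>2 + x * y + y\<^sup>2))) * (x - y)"
        by (rule zadic2_contraction_mult[OF xy])
      also have "(3 * c - 2 * (1 + 3 * (x + y) + 2 * (x\<^sup>2 + x * y + y\<^sup>2))) * (x - y) = F x - F y"
        by (simp add: F_def algebra_simps power2_eq_square power3_eq_cube)
      finally show "2 ^ Suc n dvd F x - F y" .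
    qed
    have \<kappa>x: "\<kappa> = 3 * x + 6 * x\<^sup>2 + 4 * x ^ 3 - 3 * c * x" using x by (simp add: F_def algebra_simps)
    have w: "w = 1 + 2 * \<kappa> - 3 * c" using \<kappa> by (simp add: algebra_simps)
    have "(1 + 2 * x) ^ 3 = 3 * c * (1 + 2 * x) + w"
      unfolding w \<kappa>x by (simp add: power2_eq_square power3_eq_cube algebra_simps)
    from arg_cong[OF this, of emb]
    have "emb (1 + 2 * x) ^ 3 = 3 * emb c * emb (1 + 2 * x) + emb w" by simp
    then have "g * emb (1 + 2 * x) \<in> cubic_roots (to_fract C4) (to_fract C6)" unfolding scale .
    then have "to_ac (2 ^ k * to_fract (1 + 2 * x)) \<in> cubic_roots (to_fract C4) (to_fract C6)"
      by (simp only: g_def to_ac_mult)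
    then show ?thesis by (rule reducible)
  next
    case False
    let ?R = "cubic_roots (to_fract C4) (to_fract C6)"
    obtain z1 where z1: "z1 \<in> ?R" by (rule cubic_roots_nonempty)
    obtain z2 z3 where z: "?R = {z1, z2, z3}" "z2 + z3 = - z1" "z2 * z3 = z1\<^sup>2 - 3 * to_ac (to_fract C4)"
      using cubic_roots_split[OF z1] .
    define r r' r'' where "r = z1 / g" and "r' = z2 / g" and "r'' = z3 / g"
    have zr: "z1 = g * r" "z2 = g * r'" "z3 = g * r''" using g0(1) by (simp_all add: r_def r'_def r''_def)
    have r: "r ^ 3 = 3 * emb c * r + emb w" using z1 unfolding zr scale .
    have s: "r' + r'' = - r"
    proof -
      have "g * (r' + r'') = g * (- r)" using z(2) unfolding zr by (simp add: algebra_simps)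
      then show ?thesis using g0(1) by (simp only: mult_cancel_left simp_thms)
    qed
    have p: "r' * r'' = r\<^sup>2 - 3 * emb c"
    proof -
      have "g\<^sup>2 * (r' * r'') = g\<^sup>2 * (r\<^sup>2 - 3 * emb c)"
        using z(3) unfolding zr a by (simp add: power2_eq_square algebra_simps)
      then show ?thesis using g0(1) by simp
    qed
    let ?L = "adjoin_elem Q2 r"
    have L: "is_subring ?L" "Q2 \<subseteq> ?L" "r \<in> ?L"
      using adjoin_elem_subring adjoin_elem_base adjoin_elem_self Q2_subring by blast+
    have gL: "g \<in> ?L" by (rule subsetD[OF L(2) g0(2)])
    have "z1 \<in> ?L" "z2 \<in> ?L" "z3 \<in> ?L"
      unfolding zr using L(3) unram_cubic_roots_mem[OF False q(2) r s p]
      by (auto intro: subring_mult[OF L(1) gL])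
    then have "adjoin Q2 ?R \<subseteq> ?L" unfolding z(1) using L by (intro adjoin_least) auto
    moreover have "?L \<subseteq> adjoin Q2 ?R"
    proof (rule adjoin_elem_least[OF adjoin_is_subring adjoin_upper(1)])
      have "z1 \<in> adjoin Q2 ?R" using z1 by (rule adjoin_memI(1))
      then show "r \<in> adjoin Q2 ?R"
        unfolding r_def by (rule subring_divide[OF adjoin_is_subring adjoin_upper(1) _ adjoin_memI(2)[OF g0(2)]])
    qed
    ultimately have "adjoin Q2 ?R = ?L" by blast
    then show ?thesis
      using cyclic unram_cubic_ram_index[OF False q(2) r s p] unram_cubic_break[OF False q(2) r s p] by blast
  qed
qed

end

end

subsection \<open>Weierstrass models\<close>

lemma b8_relation:
  fixes W :: "'a::comm_ring_1 weierstrass"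
  shows "4 * b8 W = b2 W * b6 W - (b4 W)\<^sup>2"
  by (simp add: b2_def b4_def b6_def b8_def power2_eq_square algebra_simps)

lemma disc_1728:
  fixes W :: "'a::comm_ring_1 weierstrass"
  shows "c4 W ^ 3 - (c6 W)\<^sup>2 = 1728 * disc W"
proof -
  have "1728 * disc W = - 432 * (b2 W)\<^sup>2 * (4 * b8 W) + 1728 * (- 8 * b4 W ^ 3 - 27 * (b6 W)\<^sup>2 + 9 * b2 W * b4 W * b6 W)"
    by (simp add: disc_def algebra_simps)
  also have "\<dots> = c4 W ^ 3 - (c6 W)\<^sup>2"
    unfolding b8_relation
    by (simp add: c4_def c6_def power2_eq_square power3_eq_cube algebra_simps)
  finally show ?thesis by simp
qed

lemma weierstrass_iso_invariants:
  assumes "weierstrass_iso W W'"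
  obtains u where "u \<noteq> 0" "u ^ 4 * c4 W' = c4 W" "u ^ 6 * c6 W' = c6 W"
proof -
  obtain u r s t where u: "u \<noteq> 0"
    and a1: "u * coeff_a1 W' = coeff_a1 W + 2 * s"
    and a2: "u ^ 2 * coeff_a2 W' = coeff_a2 W - s * coeff_a1 W + 3 * r - s ^ 2"
    and a3: "u ^ 3 * coeff_a3 W' = coeff_a3 W + r * coeff_a1 W + 2 * t"
    and a4: "u ^ 4 * coeff_a4 W' = coeff_a4 W - s * coeff_a3 W + 2 * r * coeff_a2 W
        - (t + r * s) * coeff_a1 W + 3 * r ^ 2 - 2 * s * t"
    and a6: "u ^ 6 * coeff_a6 W' = coeff_a6 W + r * coeff_a4 W + r ^ 2 * coeff_a2 W + r ^ 3
        - t * coeff_a3 W - t ^ 2 - r * t * coeff_a1 W"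
    using assms unfolding weierstrass_iso_def by blast
  have "u\<^sup>2 * b2 W' = (u * coeff_a1 W')\<^sup>2 + 4 * (u\<^sup>2 * coeff_a2 W')"
    by (simp add: b2_def power_mult_distrib algebra_simps)
  also have "\<dots> = b2 W + 12 * r"
    unfolding a1 a2 by (simp add: b2_def power2_eq_square algebra_simps)
  finally have b2: "u\<^sup>2 * b2 W' = b2 W + 12 * r" .
  have "u ^ 4 * b4 W' = 2 * (u ^ 4 * coeff_a4 W') + (u * coeff_a1 W') * (u ^ 3 * coeff_a3 W')"
    by (simp add: b4_def eval_nat_numeral algebra_simps)
  also have "\<dots> = b4 W + r * b2 W + 6 * r\<^sup>2"
    unfolding a1 a3 a4 by (simp add: b2_def b4_def power2_eq_square algebra_simps)
  finally have b4: "u ^ 4 * b4 W' = b4 W + r * b2 W + 6 * r\<^sup>2" .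
  have "u ^ 6 * b6 W' = (u ^ 3 * coeff_a3 W')\<^sup>2 + 4 * (u ^ 6 * coeff_a6 W')"
    by (simp add: b6_def power_mult_distrib algebra_simps flip: power_mult)
  also have "\<dots> = b6 W + 2 * r * b4 W + r\<^sup>2 * b2 W + 4 * r ^ 3"
    unfolding a3 a6 by (simp add: b2_def b4_def b6_def power2_eq_square power3_eq_cube algebra_simps)
  finally have b6: "u ^ 6 * b6 W' = b6 W + 2 * r * b4 W + r\<^sup>2 * b2 W + 4 * r ^ 3" .
  have "u ^ 4 * c4 W' = (u\<^sup>2 * b2 W')\<^sup>2 - 24 * (u ^ 4 * b4 W')"
    by (simp add: c4_def power_mult_distrib algebra_simps flip: power_mult)
  also have "\<dots> = c4 W" unfolding b2 b4 by (simp add: c4_def power2_eq_square algebra_simps)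
  finally have c4: "u ^ 4 * c4 W' = c4 W" .
  have "u ^ 6 * c6 W' = - ((u\<^sup>2 * b2 W') ^ 3) + 36 * (u\<^sup>2 * b2 W') * (u ^ 4 * b4 W') - 216 * (u ^ 6 * b6 W')"
    by (simp add: c6_def power_mult_distrib eval_nat_numeral algebra_simps)
  also have "\<dots> = c6 W" unfolding b2 b4 b6 by (simp add: c6_def power2_eq_square power3_eq_cube algebra_simps)
  finally have "u ^ 6 * c6 W' = c6 W" .
  then show ?thesis using that u c4 by blast
qed

text \<open>Completes the square and the cube. The scale \<open>u\<close> stays free because
  minimality is tested with twice the scale of the given model.\<close>

lemma weierstrass_iso_short:
  fixes W :: "'a::field_char_0 weierstrass"
  assumes "u \<noteq> 0"
  shows "weierstrass_iso W (Weierstrass 0 0 0 (- c4 W / (48 * u ^ 4)) (- c6 W / (864 * u ^ 6)))"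
proof -
  define s where "s = - coeff_a1 W / 2"
  define r where "r = - b2 W / 12"
  define t where "t = - (coeff_a3 W + r * coeff_a1 W) / 2"
  have a1: "coeff_a1 W = - 2 * s" and a3: "coeff_a3 W = 2 * r * s - 2 * t" by (simp_all add: s_def t_def field_simps)
  have a2: "coeff_a2 W = - 3 * r - s\<^sup>2"
  proof -
    have "4 * coeff_a2 W = b2 W - (coeff_a1 W)\<^sup>2" by (simp add: b2_def)
    also have "\<dots> = 4 * (- 3 * r - s\<^sup>2)" unfolding a1 by (simp add: r_def power2_eq_square)
    finally show ?thesis by (simp only: mult_cancel_left) simp
  qed
  show ?thesis
    unfolding weierstrass_iso_def
  proof (intro exI conjI)
    show "u * coeff_a1 (Weierstrass 0 0 0 (- c4 W / (48 * u ^ 4)) (- c6 W / (864 * u ^ 6))) = coeff_a1 W + 2 * s"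
      by (simp add: a1)
    show "u ^ 2 * coeff_a2 (Weierstrass 0 0 0 (- c4 W / (48 * u ^ 4)) (- c6 W / (864 * u ^ 6)))
        = coeff_a2 W - s * coeff_a1 W + 3 * r - s ^ 2"
      unfolding a1 a2 by (simp add: power2_eq_square)
    show "u ^ 3 * coeff_a3 (Weierstrass 0 0 0 (- c4 W / (48 * u ^ 4)) (- c6 W / (864 * u ^ 6)))
        = coeff_a3 W + r * coeff_a1 W + 2 * t"
      unfolding a1 a3 by simp
    have c4: "c4 W = - 48 * (coeff_a4 W - s * coeff_a3 W + 2 * r * coeff_a2 W
        - (t + r * s) * coeff_a1 W + 3 * r ^ 2 - 2 * s * t)"
      unfolding c4_def b2_def b4_def a1 a2 a3 by (simp add: power2_eq_square algebra_simps)
    show "u ^ 4 * coeff_a4 (Weierstrass 0 0 0 (- c4 W / (48 * u ^ 4)) (- c6 W / (864 * u ^ 6)))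
        = coeff_a4 W - s * coeff_a3 W + 2 * r * coeff_a2 W
        - (t + r * s) * coeff_a1 W + 3 * r ^ 2 - 2 * s * t"
      using assms by (simp add: c4)
    have c6: "c6 W = - 864 * (coeff_a6 W + r * coeff_a4 W + r ^ 2 * coeff_a2 W + r ^ 3
        - t * coeff_a3 W - t ^ 2 - r * t * coeff_a1 W)"
      unfolding c6_def b2_def b4_def b6_def a1 a2 a3
      by (simp add: power2_eq_square power3_eq_cube algebra_simps)
    show "u ^ 6 * coeff_a6 (Weierstrass 0 0 0 (- c4 W / (48 * u ^ 4)) (- c6 W / (864 * u ^ 6)))
        = coeff_a6 W + r * coeff_a4 W + r ^ 2 * coeff_a2 W + r ^ 3
        - t * coeff_a3 W - t ^ 2 - r * t * coeff_a1 W"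
      using assms by (simp add: c6)
  qed (rule assms)
qed

lemma map_weierstrass_invariants:
  shows "c4 (map_weierstrass to_ac E) = to_ac (c4 E)" "c6 (map_weierstrass to_ac E) = to_ac (c6 E)"
    and "b2 (map_weierstrass to_ac E) = to_ac (b2 E)"
    and "c4 (map_weierstrass to_fract M0) = to_fract (c4 M0)"
    and "c6 (map_weierstrass to_fract M0) = to_fract (c6 M0)"
    and "disc (map_weierstrass to_fract M0) = to_fract (disc M0)"
  by (simp_all add: c4_def c6_def disc_def b2_def b4_def b6_def b8_def weierstrass.map_sel)

lemma integral_weierstrass:
  assumes "\<forall>a\<in>set_weierstrass M. integral2 a"
  obtains M0 where "M = map_weierstrass to_fract M0"
proof (cases M)
  case (Weierstrass a1 a2 a3 a4 a6)
  then have "a1 \<in> range to_fract" "a2 \<in> range to_fract" "a3 \<in> range to_fract" "a4 \<in> range to_fract"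
    "a6 \<in> range to_fract"
    using assms by (auto simp: integral2_def)
  then obtain x1 x2 x3 x4 x6 where "a1 = to_fract x1" "a2 = to_fract x2" "a3 = to_fract x3"
    "a4 = to_fract x4" "a6 = to_fract x6" by (elim rangeE)
  then have "M = map_weierstrass to_fract (Weierstrass x1 x2 x3 x4 x6)" using Weierstrass by simp
  then show ?thesis by (rule that)
qed

lemma two_torsion_affine_iff:
  "Affine x y \<in> two_torsion W \<longleftrightarrow> weierstrass_eqn W x y = 0 \<and> y + y + coeff_a1 W * x + coeff_a3 W = 0"
  by (auto simp: two_torsion_def curve_points_def Let_def)

text \<open>Under the assumption, multiplication by \<open>-4\<close> turns the equation into
  \<open>4 x ^ 3 + b2 x ^ 2 + 2 b4 x + b6 = 0\<close>, and \<open>12 x + b2\<close> depresses this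
  cubic.\<close>

lemma two_torsion_cubic:
  fixes W :: "'a::field_char_0 weierstrass"
  assumes "y + y + coeff_a1 W * x + coeff_a3 W = 0"
  shows "weierstrass_eqn W x y = 0 \<longleftrightarrow> (12 * x + b2 W) ^ 3 = 3 * c4 W * (12 * x + b2 W) + 2 * c6 W"
proof -
  have "4 * weierstrass_eqn W x y = (y + y + coeff_a1 W * x + coeff_a3 W)\<^sup>2
      - (4 * x ^ 3 + b2 W * x\<^sup>2 + 2 * b4 W * x + b6 W)"
    by (simp add: weierstrass_eqn_def b2_def b4_def b6_def power2_eq_square power3_eq_cube algebra_simps)
  then have 1: "4 * weierstrass_eqn W x y = - (4 * x ^ 3 + b2 W * x\<^sup>2 + 2 * b4 W * x + b6 W)"
    unfolding assms by simp
  have "(12 * x + b2 W) ^ 3 - (3 * c4 W * (12 * x + b2 W) + 2 * c6 W)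
      = 432 * (4 * x ^ 3 + b2 W * x\<^sup>2 + 2 * b4 W * x + b6 W)"
    by (simp add: c4_def c6_def power2_eq_square power3_eq_cube algebra_simps)
  also have "\<dots> = - 432 * - (4 * x ^ 3 + b2 W * x\<^sup>2 + 2 * b4 W * x + b6 W)" by simp
  also have "\<dots> = - 1728 * weierstrass_eqn W x y" unfolding 1 [symmetric] by simp
  finally show ?thesis by (metis eq_iff_diff_eq_0 mult_eq_0_iff neg_equal_0_iff_equal zero_neq_numeral)
qed

lemma adjoin_cubic_roots_scale:
  assumes "u \<noteq> 0"
  shows "adjoin Q2 (cubic_roots (u ^ 4 * a) (u ^ 6 * b)) = adjoin Q2 (cubic_roots a b)"
proof -
  define g where "g = to_ac (u\<^sup>2)"
  have g: "g \<noteq> 0" "g \<in> Q2" using assms by (simp_all add: g_def del: to_ac_power)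
  have scale: "g * z \<in> cubic_roots (u ^ 4 * a) (u ^ 6 * b) \<longleftrightarrow> z \<in> cubic_roots a b" for z
  proof -
    have "3 * to_ac (u ^ 4 * a) * (g * z) + 2 * to_ac (u ^ 6 * b) = g ^ 3 * (3 * to_ac a * z + 2 * to_ac b)"
      by (simp add: g_def algebra_simps flip: power_mult power_add)
    then show ?thesis using g(1) by (simp add: cubic_roots_def power_mult_distrib)
  qed
  show ?thesis
  proof (rule adjoin_cong; rule subsetI)
    fix z assume z: "z \<in> cubic_roots (u ^ 4 * a) (u ^ 6 * b)"
    have "z / g \<in> cubic_roots a b" using z g(1) scale[of "z / g"] by simp
    then have "g * (z / g) \<in> adjoin Q2 (cubic_roots a b)"
      using g(2) by (intro subring_mult[OF adjoin_is_subring]) (auto intro: adjoin_memI)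
    then show "z \<in> adjoin Q2 (cubic_roots a b)" using g(1) by simp
  next
    fix z assume "z \<in> cubic_roots a b"
    then have "g * z \<in> adjoin Q2 (cubic_roots (u ^ 4 * a) (u ^ 6 * b))"
      unfolding scale [symmetric] by (rule adjoin_memI(1))
    then have "g * z / g \<in> adjoin Q2 (cubic_roots (u ^ 4 * a) (u ^ 6 * b))"
      by (rule subring_divide[OF adjoin_is_subring adjoin_upper(1) _ adjoin_memI(2)[OF g(2)]])
    then show "z \<in> adjoin Q2 (cubic_roots (u ^ 4 * a) (u ^ 6 * b))" using g(1) by simp
  qed
qed

text \<open>The ordinate is \<open>- (a1 x + a3) / 2\<close> and adds nothing to the abscissa;
  \<open>z = 12 x + b2\<close> is an affine change with rational coefficients.\<close>

lemma two_torsion_field_self: "two_torsion_field E = adjoin Q2 (cubic_roots (c4 E) (c6 E))"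
proof -
  let ?W = "map_weierstrass to_ac E"
  let ?T = "\<Union>P\<in>two_torsion ?W. set_point P"
  let ?R = "cubic_roots (c4 E) (c6 E)"
  have tors: "Affine x y \<in> two_torsion ?W \<longleftrightarrow>
      y + y + to_ac (coeff_a1 E) * x + to_ac (coeff_a3 E) = 0 \<and> 12 * x + to_ac (b2 E) \<in> ?R" for x y
    using two_torsion_cubic[of y ?W x]
    by (auto simp: two_torsion_affine_iff cubic_roots_def map_weierstrass_invariants weierstrass.map_sel)
  have "adjoin Q2 ?T = adjoin Q2 ?R"
  proof (rule adjoin_cong; rule subsetI)
    let ?A = "adjoin Q2 ?R"
    note A = adjoin_is_subring[of Q2 ?R] adjoin_upper(1)[of Q2 ?R]
    have Q: "to_ac c \<in> ?A" for c by (rule adjoin_memI(2)[OF to_ac_Q2])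
    fix v assume "v \<in> ?T"
    then obtain P where P: "P \<in> two_torsion ?W" "v \<in> set_point P" by blast
    then obtain x y where xy: "P = Affine x y" "v = x \<or> v = y" by (cases P) auto
    have t: "y + y + to_ac (coeff_a1 E) * x + to_ac (coeff_a3 E) = 0" "12 * x + to_ac (b2 E) \<in> ?R"
      using P(1) unfolding xy(1) tors by auto
    have "(12 * x + to_ac (b2 E) - to_ac (b2 E)) / 12 \<in> ?A"
      using t(2) by (intro half_mem[OF A] subring_diff[OF A(1) _ Q] adjoin_memI(1))
    then have x: "x \<in> ?A" by simp
    have "- (to_ac (coeff_a1 E) * x + to_ac (coeff_a3 E)) / 2 \<in> ?A"
      by (intro half_mem[OF A] subring_uminus[OF A(1)] subring_add[OF A(1)] subring_mult[OF A(1)] Q x)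
    also have "- (to_ac (coeff_a1 E) * x + to_ac (coeff_a3 E)) / 2 = y"
    proof -
      have "- (y + y) = to_ac (coeff_a1 E) * x + to_ac (coeff_a3 E)"
        using t(1) by (intro minus_unique) (simp only: add.assoc)
      then show ?thesis by (simp flip: \<open>- (y + y) = _\<close>)
    qed
    finally show "v \<in> ?A" using x xy(2) by blast
  next
    let ?A = "adjoin Q2 ?T"
    note A = adjoin_is_subring[of Q2 ?T] adjoin_upper(1)[of Q2 ?T]
    have Q: "to_ac c \<in> ?A" for c by (rule adjoin_memI(2)[OF to_ac_Q2])
    fix z assume z: "z \<in> ?R"
    define x where "x = (z - to_ac (b2 E)) / 12"
    define y where "y = - (to_ac (coeff_a1 E) * x + to_ac (coeff_a3 E)) / 2"
    have "Affine x y \<in> two_torsion ?W" unfolding tors using z by (simp add: x_def y_def field_simps)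
    then have "x \<in> ?T" by force
    then have "x \<in> ?A" by (rule adjoin_memI(1))
    then have "12 * x + to_ac (b2 E) \<in> ?A"
      by (intro subring_add[OF A(1)] subring_mult[OF A(1)] subring_numeral[OF A(1)] Q)
    then show "z \<in> ?A" by (simp add: x_def)
  qed
  then show ?thesis by (simp add: two_torsion_field_def)
qed

lemma two_torsion_field_model:
  assumes "weierstrass_iso E M"
  shows "two_torsion_field E = adjoin Q2 (cubic_roots (c4 M) (c6 M))"
proof -
  obtain u where u: "u \<noteq> 0" "u ^ 4 * c4 M = c4 E" "u ^ 6 * c6 M = c6 E"
    using weierstrass_iso_invariants[OF assms] .
  show ?thesis unfolding two_torsion_field_self u(2,3) [symmetric] by (rule adjoin_cubic_roots_scale[OF u(1)])
qed

text \<open>If \<open>2\<^sup>8\<close> divides \<open>c\<^sub>4\<close> and \<open>2\<^sup>1\<^sup>1\<close> divides \<open>c\<^sub>6\<close>, the short model scaled by \<open>u = 2\<close> is integral.\<close>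

lemma minimal_model_not_divisible:
  assumes min: "minimal_model E M" and c4: "c4 M = to_fract (2 ^ 8 * x)" and c6: "c6 M = to_fract (2 ^ 11 * y)"
    and "disc M \<noteq> 0"
  shows False
proof -
  have iso: "weierstrass_iso E M" using min by (simp add: minimal_model_def integral_model_def)
  obtain u where u: "u \<noteq> 0" "u ^ 4 * c4 M = c4 E" "u ^ 6 * c6 M = c6 E"
    using weierstrass_iso_invariants[OF iso] .
  \<comment> \<open>With scale \<open>2 u\<close> the extra denominators are
    \<open>48 * 2 ^ 4 = 2 ^ 8 * 3\<close> and \<open>864 * 2 ^ 6 = 2 ^ 11 * 27\<close>, whence the
    exponents 8 and 11.\<close>
  define M' where "M' = Weierstrass 0 0 0 (- c4 E / (48 * (2 * u) ^ 4)) (- c6 E / (864 * (2 * u) ^ 6))"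
  have iso': "weierstrass_iso E M'" unfolding M'_def using u(1) by (intro weierstrass_iso_short) simp
  have a4: "- c4 E / (48 * (2 * u) ^ 4) = - to_fract x / 3"
    unfolding u(2) [symmetric] c4 using u(1) by (simp add: power_mult_distrib)
  have a6: "- c6 E / (864 * (2 * u) ^ 6) = - to_fract y / 27"
    unfolding u(3) [symmetric] c6 using u(1) by (simp add: power_mult_distrib)
  have int: "integral2 (to_fract x / numeral (num.Bit1 n))" for x n
  proof -
    have "(numeral (num.Bit1 n) :: zadic2) dvd 1" by (simp add: zadic2_unit_iff zadic2_even_numeral)
    then obtain v :: zadic2 where v: "v dvd 1" "inverse (to_fract (numeral (num.Bit1 n))) = to_fract v"
      by (rule unit_to_fract_inverse)
    have "to_fract x / numeral (num.Bit1 n) = to_fract x * inverse (to_fract (numeral (num.Bit1 n)))"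
      by (simp only: to_fract_numeral divide_inverse)
    also have "\<dots> = to_fract (x * v)" unfolding v(2) by (simp only: to_fract_mult)
    finally show ?thesis unfolding integral2_def by (rule range_eqI)
  qed
  have "integral2 (- to_fract x / 3)" "integral2 (- to_fract y / 27)"
    using int[of "- x"] int[of "- y"] by simp_all
  moreover have "integral2 0" unfolding integral2_def by (rule range_eqI[of _ _ 0]) simp
  ultimately have "integral_model E M'"
    using iso' unfolding integral_model_def M'_def a4 a6 by auto
  then have le: "val2 (disc M) \<le> val2 (disc M')" using min by (simp add: minimal_model_def)
  have "c4 M = 2 ^ 4 * c4 M'" "c6 M = 2 ^ 6 * c6 M'"
    unfolding M'_def a4 a6 c4 c6 by (simp_all add: c4_def c6_def b2_def b4_def b6_def)
  then have "1728 * disc M = 2 ^ 12 * (c4 M' ^ 3 - (c6 M')\<^sup>2)"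
    unfolding disc_1728 [symmetric] by (simp add: power_mult_distrib)
  also have "\<dots> = 1728 * (2 ^ 12 * disc M')" unfolding disc_1728 by simp
  finally have d: "disc M = 2 ^ 12 * disc M'" by simp
  then have "disc M' \<noteq> 0" using assms(4) by auto
  then obtain r where "val2 (disc M') = ereal r" by (rule val2.val_finite)
  then show False using le unfolding d val2_mult val2_2_power by simp
qed

lemma bit_alg_closure_2: "(2 :: bit alg_closure) = 0"
proof -
  have "(2 :: bit alg_closure) = to_ac (2 :: bit)" by (rule to_ac_numeral [symmetric])
  also have "(2 :: bit) = 0" by simp
  finally show ?thesis by simp
qed

text \<open>In characteristic 2 the square in the cuspidal equation has no term linear in
  \<open>y\<close>, so the Weierstrass equation has none; comparing \<open>y = 1\<close> with
  \<open>y = 0\<close> shows it.\<close>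

lemma has_cusp_char_2:
  fixes W :: "bit alg_closure weierstrass"
  assumes "has_cusp W"
  shows "coeff_a1 W = 0" "coeff_a3 W = 0"
proof -
  obtain x0 y0 \<alpha> where cusp: "\<And>x y. weierstrass_eqn W x y = ((y - y0) - \<alpha> * (x - x0)) ^ 2 - (x - x0) ^ 3"
    using assms unfolding has_cusp_def by blast
  have "coeff_a1 W * x + coeff_a3 W = 0" for x
  proof -
    have "weierstrass_eqn W x 1 - weierstrass_eqn W x 0 = 1 + (coeff_a1 W * x + coeff_a3 W)"
      by (simp add: weierstrass_eqn_def algebra_simps)
    moreover have "weierstrass_eqn W x 1 - weierstrass_eqn W x 0 = 1 + 2 * (- y0 - \<alpha> * (x - x0))"
      unfolding cusp by (simp add: power2_eq_square algebra_simps)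
    ultimately show ?thesis by (simp add: bit_alg_closure_2)
  qed
  from this[of 0] this[of 1] show "coeff_a1 W = 0" "coeff_a3 W = 0" by simp_all
qed

text \<open>A cusp makes \<open>a1\<close> and \<open>a3\<close> even, so 4, 2 and 4 divide
  \<open>b2\<close>, \<open>b4\<close> and \<open>b6\<close>, and 16 divides each term of the
  discriminant. The cusp belongs to some minimal model; minimality carries the bound over to
  \<open>M\<close>.\<close>

lemma additive_reduction_disc:
  assumes "additive_reduction E" "minimal_model E M"
  shows "ereal 4 \<le> val2 (disc M)"
proof -
  obtain N where N: "minimal_model E N" "has_cusp (map_weierstrass (to_ac \<circ> reduction2) N)"
    using assms(1) unfolding additive_reduction_def by blast
  obtain N0 where N0: "N = map_weierstrass to_fract N0"
    using N(1) integral_weierstrass by (auto simp: minimal_model_def integral_model_def)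
  have even: "2 dvd x" if "to_ac (reduction2 (to_fract x)) = (0 :: bit alg_closure)" for x
  proof -
    have "cong2 (to_fract x) 0 2" using that by (auto simp: reduction2_def split: if_splits)
    then obtain z where "to_fract x = to_fract (2 * z)" by (auto simp: cong2_def)
    then have "x = 2 * z" by (simp only: to_fract_eq_iff)
    then show ?thesis by simp
  qed
  have "2 dvd coeff_a1 N0" "2 dvd coeff_a3 N0"
    using has_cusp_char_2[OF N(2)] by (auto simp: N0 weierstrass.map_sel intro!: even)
  then obtain x y where xy: "coeff_a1 N0 = 2 * x" "coeff_a3 N0 = 2 * y" by (auto elim!: dvdE)
  have b2: "b2 N0 = 4 * (x\<^sup>2 + coeff_a2 N0)" and b4: "b4 N0 = 2 * (coeff_a4 N0 + 2 * x * y)"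
    and b6: "b6 N0 = 4 * (y\<^sup>2 + coeff_a6 N0)"
    by (simp_all add: b2_def b4_def b6_def xy power2_eq_square algebra_simps)
  have "disc N0 = 2 ^ 4 * (- (x\<^sup>2 + coeff_a2 N0)\<^sup>2 * b8 N0 - 4 * (coeff_a4 N0 + 2 * x * y) ^ 3
      - 27 * (y\<^sup>2 + coeff_a6 N0)\<^sup>2 + 18 * (x\<^sup>2 + coeff_a2 N0) * (coeff_a4 N0 + 2 * x * y) * (y\<^sup>2 + coeff_a6 N0))"
    unfolding disc_def b2 b4 b6 by (simp add: power2_eq_square power3_eq_cube algebra_simps)
  then have "2 ^ 4 dvd disc N0" by (metis dvd_triv_left)
  then have "ereal (real 4) \<le> val2 (disc N)"
    unfolding N0 map_weierstrass_invariants val2_to_fract_ge_iff .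
  also have "val2 (disc N) \<le> val2 (disc M)"
    using N(1) assms(2) by (simp add: minimal_model_def)
  finally show ?thesis by simp
qed

section \<open>The square class of the discriminant\<close>

lemma adjoin_scaled:
  assumes "g \<noteq> 0" "g \<in> Q2"
  shows "adjoin Q2 {g * x} = adjoin Q2 {x}"
proof (rule adjoin_cong)
  show "{g * x} \<subseteq> adjoin Q2 {x}"
    using assms(2) by (auto intro!: subring_mult[OF adjoin_is_subring] intro: adjoin_memI)
  have "g * x / g \<in> adjoin Q2 {g * x}"
    by (rule subring_divide[OF adjoin_is_subring adjoin_upper(1) adjoin_memI(1) adjoin_memI(2)[OF assms(2)]]) simp
  then show "{x} \<subseteq> adjoin Q2 {g * x}" using assms(1) by simp
qed

text \<open>An odd \<open>d\<close> is determined modulo squares by its residue modulo 8. The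
  representative satisfies \<open>m d = 1\<close> modulo 8 and is chosen so that the radicand,
  \<open>m\<close> or \<open>2 m\<close>, is literally one from \<open>ram_quadratic_sqrt\<close>,
  or else 1 or \<open>-3\<close>.\<close>

lemma sqrt_square_class:
  assumes d: "\<not> 2 dvd d" and \<delta>: "\<delta>\<^sup>2 = to_ac (2 ^ n * to_fract d)"
  obtains \<beta> and m :: int where "adjoin Q2 {\<delta>} = adjoin Q2 {\<beta>}" "\<beta>\<^sup>2 = of_int (2 ^ (n mod 2) * m)"
    "m = 1 \<and> 8 dvd d - 1 \<or> m = - 5 \<and> 8 dvd d - 3 \<or> m = - 3 \<and> 8 dvd d - 5 \<or> m = - 1 \<and> 8 dvd d - 7"
proof -
  have "\<exists>m::int. 8 dvd d * of_int m - 1 \<and> odd m \<and>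
      (m = 1 \<and> 8 dvd d - 1 \<or> m = - 5 \<and> 8 dvd d - 3 \<or> m = - 3 \<and> 8 dvd d - 5 \<or> m = - 1 \<and> 8 dvd d - 7)"
    using zadic2_unit_mod_8[OF d]
  proof (elim disjE)
    assume "8 dvd d - 1"
    then show ?thesis by (intro exI[of _ 1]) simp
  next
    assume a: "8 dvd d - 3"
    have "d * of_int (- 5) - 1 = - 5 * (d - 3) - 8 * 2" by (simp add: algebra_simps)
    then have "8 dvd d * of_int (- 5) - 1" using a by (metis dvd_diff dvd_mult dvd_triv_left)
    then show ?thesis using a by (intro exI[of _ "- 5"]) simp
  next
    assume a: "8 dvd d - 5"
    have "d * of_int (- 3) - 1 = - 3 * (d - 5) - 8 * 2" by (simp add: algebra_simps)
    then have "8 dvd d * of_int (- 3) - 1" using a by (metis dvd_diff dvd_mult dvd_triv_left)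
    then show ?thesis using a by (intro exI[of _ "- 3"]) simp
  next
    assume a: "8 dvd d - 7"
    have "d * of_int (- 1) - 1 = - 1 * (d - 7) - 8 * 1" by (simp add: algebra_simps)
    then have "8 dvd d * of_int (- 1) - 1" using a by (metis dvd_diff dvd_mult dvd_triv_left)
    then show ?thesis using a by (intro exI[of _ "- 1"]) simp
  qed
  then obtain m :: int where m: "8 dvd d * of_int m - 1" "odd m"
    "m = 1 \<and> 8 dvd d - 1 \<or> m = - 5 \<and> 8 dvd d - 3 \<or> m = - 3 \<and> 8 dvd d - 5 \<or> m = - 1 \<and> 8 dvd d - 7"
    by blast
  obtain s where s: "d * of_int m = (1 + 4 * s)\<^sup>2" using m(1) by (rule zadic2_square_1_mod_8)
  define t where "t = 1 + 4 * s"
  have t0: "t \<noteq> 0"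
    unfolding t_def using zadic2_even_simps by (metis dvd_0_right)
  have m0: "m \<noteq> 0" using m(2) by auto
  define k where "k = n div 2"
  \<comment> \<open>With \<open>d m = t ^ 2\<close>, this rational \<open>g\<close> satisfies
    \<open>2 ^ n d = g ^ 2 * 2 ^ (n mod 2) * m\<close>.\<close>
  define g where "g = to_ac (2 ^ k * to_fract t / of_int m)"
  define \<beta> where "\<beta> = \<delta> / g"
  have g: "g \<noteq> 0" "g \<in> Q2"
  proof -
    show "g \<noteq> 0" using t0 m0 by (simp add: g_def)
    show "g \<in> Q2" unfolding g_def by (rule to_ac_Q2)
  qed
  have "\<beta>\<^sup>2 = to_ac (2 ^ n * to_fract d) / g\<^sup>2" by (simp add: \<beta>_def power_divide \<delta>)
  also have "\<dots> = to_ac (2 ^ n * to_fract d * (of_int m)\<^sup>2 / (2 ^ (2 * k) * to_fract (t\<^sup>2)))"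
    by (simp add: g_def power_divide power_mult_distrib mult.commute[of k] flip: power_mult)
  also have "(2 :: q2) ^ n = 2 ^ (2 * k) * 2 ^ (n mod 2)"
    unfolding k_def by (simp flip: power_add)
  also have "t\<^sup>2 = d * of_int m" by (simp add: s t_def)
  also have "2 ^ (2 * k) * 2 ^ (n mod 2) * to_fract d * (of_int m)\<^sup>2 / (2 ^ (2 * k) * to_fract (d * of_int m))
      = (of_int (2 ^ (n mod 2) * m) :: q2)"
    using m0 d by (auto simp: to_fract_of_int power2_eq_square)
  finally have b2: "\<beta>\<^sup>2 = of_int (2 ^ (n mod 2) * m)" by (simp only: to_ac_of_int)
  have "\<delta> = g * \<beta>" using g(1) by (simp add: \<beta>_def)
  then have "adjoin Q2 {\<delta>} = adjoin Q2 {\<beta>}" using adjoin_scaled[OF g] by simp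
  then show ?thesis using that b2 m(3) by blast
qed

lemma unramified_conclusion:
  assumes "has_ram_index (adjoin_elem Q2 x) 1" "max_unramified_subext Q2 (adjoin_elem Q2 x) F"
  shows "adjoin_elem Q2 x = F"
  using assms(2) unramified_adjoin_elem[OF assms(1)] unfolding max_unramified_subext_def by blast

text \<open>A square root of \<open>-3\<close> generates the cube roots of unity through
  \<open>\<omega> = (\<beta> - 1) / 2\<close>. A square root of 1 gives \<open>L = Q2\<close>, where
  the break is 0 by its own clause.\<close>

lemma sqrt_unramified:
  assumes \<beta>: "\<beta>\<^sup>2 = 1 \<or> \<beta>\<^sup>2 = - 3" and F: "max_unramified_subext Q2 (adjoin Q2 {\<beta>}) F"
  shows "adjoin Q2 {\<beta>} = F \<and> max_upper_break Q2 (adjoin Q2 {\<beta>}) = 0"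
  using \<beta>
proof
  assume "\<beta>\<^sup>2 = 1"
  then have "\<beta> = 1 \<or> \<beta> = - 1" by (simp add: power2_eq_1_iff)
  then have "\<beta> \<in> Q2" using subring_1[OF Q2_subring] subring_uminus[OF Q2_subring] by blast
  then have "adjoin Q2 {\<beta>} = Q2"
    using adjoin_least[OF Q2_subring order.refl order.refl, of "{\<beta>}"] adjoin_upper(1)[of Q2 "{\<beta>}"] by blast
  moreover have "Q2 \<subseteq> F" "F \<subseteq> adjoin Q2 {\<beta>}"
    using F unfolding max_unramified_subext_def unramified_ext_def by blast+
  ultimately show ?thesis by (simp add: max_upper_break_def)
next
  assume \<beta>: "\<beta>\<^sup>2 = - 3"
  define \<omega> where "\<omega> = (\<beta> - 1) / 2"
  have "4 * (\<omega>\<^sup>2 + \<omega> + 1) = \<beta>\<^sup>2 + 3" by (simp add: \<omega>_def field_simps power2_eq_square)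
  then have "4 * (\<omega>\<^sup>2 + \<omega> + 1) = 0" using \<beta> by (simp only: \<beta>) simp
  then have \<omega>: "\<omega>\<^sup>2 + \<omega> + 1 = 0" by (simp only: mult_eq_0_iff) simp
  have "2 * \<omega> = \<beta> - 1" by (simp add: \<omega>_def)
  have "adjoin Q2 {\<beta>} = adjoin Q2 {2 * \<omega>}"
    using adjoin_sqrt_shift[of "2 * \<omega>" 1 \<beta>] subring_1[OF Q2_subring] by (simp add: \<open>2 * \<omega> = \<beta> - 1\<close>)
  also have "\<dots> = adjoin Q2 {\<omega>}" using numeral_Q2 by (intro adjoin_scaled) auto
  finally have L: "adjoin Q2 {\<beta>} = adjoin_elem Q2 \<omega>"
    by (simp add: adjoin_elem_eq_adjoin[OF Q2_subring order.refl])
  show ?thesis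
    using unramified_conclusion[OF omega_ram_index[OF \<omega>]] F omega_break[OF \<omega>] unfolding L by blast
qed

subsection \<open>The 2-torsion field\<close>

lemma val_ereal_le_iff: "8 + val2 (to_fract (2 ^ n * d)) \<le> 3 * val2 (to_fract x) \<longleftrightarrow> 2 ^ (8 + n) dvd x ^ 3"
  if "\<not> 2 dvd d"
proof -
  have "val2 (to_fract (2 ^ n * d)) = ereal (real n)"
    using val2_eqI[of d _ "int n"] that by (simp add: zadic2_unit_iff)
  moreover have "3 * val2 (to_fract x) = val2 (to_fract (x ^ 3))"
    using val2.val_power[of "to_fract x" 3] by simp
  ultimately show ?thesis
    using val2_to_fract_ge_iff[of "8 + n" "x ^ 3"] by simp
qed

theorem theorem2p19:
  fixes E M :: "q2 weierstrass" and D :: q2 and L F :: "q2bar set"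
  assumes "elliptic E" and "additive_reduction E" and "val2 (j_invariant E) \<ge> 0"
    and "minimal_model E M"
    and "disc M = 2 powi ord2 (disc M) * D"
    and "L = two_torsion_field E"
    and "max_unramified_subext Q2 L F"
  shows "(odd (ord2 (disc M)) \<longrightarrow>
            (\<exists>i\<in>{3, 4, 5, 6}. L = compositum F (ram_quadratic i)) \<and> max_upper_break Q2 L = 3) \<and>
         (even (ord2 (disc M)) \<longrightarrow>
            (cong2 D (-1) 4 \<longrightarrow>
               (\<exists>i\<in>{1, 2}. L = compositum F (ram_quadratic i)) \<and> max_upper_break Q2 L = 2) \<and>
            (ord2 (disc M) \<in> {6, 8, 12, 14} \<and> 3 * val2 (c4 M) \<ge> 8 + val2 (disc M) \<longrightarrow>
               iso_rupture L F [1, 0, 0, 2] \<and> max_upper_break Q2 L = 1) \<and>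
            (\<not> cong2 D (-1) 4 \<and>
             \<not> (ord2 (disc M) \<in> {6, 8, 12, 14} \<and> 3 * val2 (c4 M) \<ge> 8 + val2 (disc M)) \<longrightarrow>
               L = F \<and> max_upper_break Q2 L = 0))"
proof -
  have iso: "weierstrass_iso E M" and int: "\<forall>a\<in>set_weierstrass M. integral2 a"
    using assms(4) by (auto simp: minimal_model_def integral_model_def)
  obtain M0 where M0: "M = map_weierstrass to_fract M0" using integral_weierstrass[OF int] .
  define C4 C6 where "C4 = c4 M0" and "C6 = c6 M0"
  have M: "c4 M = to_fract C4" "c6 M = to_fract C6" "disc M = to_fract (disc M0)"
    by (simp_all add: M0 map_weierstrass_invariants C4_def C6_def)
  \<comment> \<open>Ellipticity is given for \<open>E\<close>; the identity
    \<open>c4 ^ 3 - c6 ^ 2 = 1728 \<Delta>\<close> and the weights of \<open>c4\<close> and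
    \<open>c6\<close> carry it to \<open>M\<close>.\<close>
  have disc0: "disc M \<noteq> 0"
  proof
    assume "disc M = 0"
    then have "c4 M ^ 3 = (c6 M)\<^sup>2" using disc_1728[of M] by simp
    moreover obtain u where "u ^ 4 * c4 M = c4 E" "u ^ 6 * c6 M = c6 E"
      using weierstrass_iso_invariants[OF iso] by blast
    moreover have "(u ^ 4 * c4 M) ^ 3 = u ^ 12 * c4 M ^ 3" "(u ^ 6 * c6 M)\<^sup>2 = u ^ 12 * (c6 M)\<^sup>2" for u
      by (simp_all add: power_mult_distrib flip: power_mult)
    ultimately have "c4 E ^ 3 = (c6 E)\<^sup>2" by metis
    then show False using disc_1728[of E] assms(1) by (simp add: elliptic_def)
  qed
  then have "disc M0 \<noteq> 0" using M(3) by auto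
  then obtain n d where d: "\<not> 2 dvd d" and n: "disc M0 = 2 ^ n * d" by (rule zadic2_decompose')
  have ord: "ord2 (disc M) = int n"
    using ord2_eqI[of d "disc M" "int n"] d by (simp add: M(3) n zadic2_unit_iff)
  have "2 ^ n * to_fract d = 2 ^ n * D" using assms(5) unfolding ord by (simp add: M(3) n)
  then have D: "D = to_fract d" by simp
  have cong: "cong2 D (-1) 4 \<longleftrightarrow> 4 dvd d + 1"
  proof -
    have "cong2 D (-1) 4 \<longleftrightarrow> (\<exists>z. to_fract (d + 1) = to_fract (4 * z))"
      by (simp add: cong2_def D)
    then show ?thesis by (simp only: to_fract_eq_iff dvd_def)
  qed
  have cond: "8 + val2 (disc M) \<le> 3 * val2 (c4 M) \<longleftrightarrow> 2 ^ (8 + n) dvd C4 ^ 3"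
    unfolding M n by (rule val_ereal_le_iff[OF d])
  have disc: "C4 ^ 3 - C6\<^sup>2 = 1728 * (2 ^ n * d)"
    using disc_1728[of M0] by (simp add: C4_def C6_def n)
  have n4: "4 \<le> n"
  proof -
    have "val2 (disc M) = ereal (real n)" using disc0 ord by (simp add: val2_def)
    then show ?thesis using additive_reduction_disc[OF assms(2,4)] by simp
  qed
  let ?R = "cubic_roots (to_fract C4) (to_fract C6)"
  have L: "L = adjoin Q2 ?R"
    unfolding assms(6) two_torsion_field_model[OF iso] M ..
  have Lsub: "is_subring L" "Q2 \<subseteq> L" unfolding L by (rule adjoin_is_subring adjoin_upper)+
  have FL: "F \<subseteq> L" using assms(7) by (simp add: max_unramified_subext_def)
  obtain \<delta> where "poly [:- to_ac (disc M), 0, 1:] \<delta> = 0"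
    by (rule exists_root[of "[:- to_ac (disc M), 0, 1:]"]) simp_all
  then have "\<delta>\<^sup>2 = to_ac (disc M)" by (simp add: power2_eq_square)
  then obtain \<beta> m where \<beta>: "adjoin Q2 {\<delta>} = adjoin Q2 {\<beta>}" "\<beta>\<^sup>2 = of_int (2 ^ (n mod 2) * m)"
    "m = 1 \<and> 8 dvd d - 1 \<or> m = - 5 \<and> 8 dvd d - 3 \<or> m = - 3 \<and> 8 dvd d - 5 \<or> m = - 1 \<and> 8 dvd d - 7"
    using sqrt_square_class[OF d, of \<delta> n] by (auto simp: M(3) n)
  have red: "L = adjoin Q2 {\<beta>}" if "to_ac z \<in> ?R" for z
    unfolding L \<beta>(1) [symmetric] using that
  proof (rule cubic_roots_reducible)
    show "to_fract C4 ^ 3 - (to_fract C6)\<^sup>2 = 1728 * disc M" "disc M \<noteq> 0"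
      using disc_1728[of M] disc0 by (simp_all add: M)
  qed fact
  \<comment> \<open>Since \<open>F \<subseteq> L\<close>, the compositum is settled as soon as
    \<open>L_i = L\<close>.\<close>
  have comp: "L = compositum F (ram_quadratic i)" if "ram_quadratic i = L" for i
    using compositum_subset_left[OF Lsub FL] that by simp
  have m4: "m = 1 \<or> m = - 3 \<longleftrightarrow> 4 dvd d - 1" "m = - 1 \<or> m = - 5 \<longleftrightarrow> 4 dvd d + 1"
  proof -
    have "8 dvd d - 1 \<Longrightarrow> 4 dvd d - 1" "8 dvd d - 5 \<Longrightarrow> 4 dvd d - 1"
      "8 dvd d - 3 \<Longrightarrow> 4 dvd d + 1" "8 dvd d - 7 \<Longrightarrow> 4 dvd d + 1"
    proof -
      have *: "4 dvd x + 4 * y" if "8 dvd x" for x y :: zadic2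
      proof -
        have "(4 :: zadic2) dvd 8" by (rule dvdI[of _ _ 2]) simp
        then have "4 dvd x" using that by (rule dvd_trans)
        then show ?thesis by (intro dvd_add dvd_triv_left)
      qed
      show "8 dvd d - 1 \<Longrightarrow> 4 dvd d - 1" using *[of "d - 1" 0] by simp
      show "8 dvd d - 5 \<Longrightarrow> 4 dvd d - 1" using *[of "d - 5" 1] by (simp add: add.commute)
      show "8 dvd d - 3 \<Longrightarrow> 4 dvd d + 1" using *[of "d - 3" 1] by (simp add: add.commute)
      show "8 dvd d - 7 \<Longrightarrow> 4 dvd d + 1" using *[of "d - 7" 2] by (simp add: add.commute)
    qed
    moreover have "\<not> (4 dvd d - 1 \<and> 4 dvd d + 1)"
    proof
      assume "4 dvd d - 1 \<and> 4 dvd d + 1"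
      then have "4 dvd (d + 1) - (d - 1)" using dvd_diff by blast
      then have "2 ^ 2 dvd 2 ^ 1 * (1 :: zadic2)" by simp
      then show False unfolding power2_dvd_unit_iff[OF zadic2_not_2_dvd_1] by simp
    qed
    ultimately show "m = 1 \<or> m = - 3 \<longleftrightarrow> 4 dvd d - 1" "m = - 1 \<or> m = - 5 \<longleftrightarrow> 4 dvd d + 1"
      using \<beta>(3) by auto
  qed
  show ?thesis
  proof (cases "2 ^ (8 + n) dvd C4 ^ 3")
    case False
    then obtain z where "to_ac z \<in> ?R" using broken_polygon_root[OF disc d] by blast
    then have L\<beta>: "L = adjoin Q2 {\<beta>}" by (rule red)
    have case1: "(\<exists>i\<in>{3, 4, 5, 6}. L = compositum F (ram_quadratic i)) \<and> max_upper_break Q2 L = 3" if "odd n"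
    proof -
      have b: "\<beta>\<^sup>2 = 2 * of_int m" using \<beta>(2) that by (simp add: odd_iff_mod_2_eq_one)
      have v: "val2bar (2 * of_int m) = 1"
      proof -
        have "\<not> 2 dvd (of_int m :: zadic2)" using \<beta>(3) by (auto simp: zadic2_even_simps)
        from val_emb_unit[OF this] have "val2bar (of_int m) = 0" by (simp add: to_fract_of_int)
        then show ?thesis by (simp add: W.val_mult val2bar_2 one_ereal_def)
      qed
      have "2 * of_int m \<in> Q2" by (rule range_eqI[of _ _ "2 * of_int m"]) simp
      then have "max_upper_break Q2 L = 3" unfolding L\<beta> using v b by (rule sqrt_uniformizer_break)
      moreover have "\<exists>i\<in>{3, 4, 5, 6}. ram_quadratic i = L"
        unfolding L\<beta> using \<beta>(3) b ram_quadratic_sqrt(3-6)[of \<beta>] by auto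
      ultimately show ?thesis using comp by metis
    qed
    have case2: "(\<exists>i\<in>{1, 2}. L = compositum F (ram_quadratic i)) \<and> max_upper_break Q2 L = 2"
      if "even n" "4 dvd d + 1"
    proof -
      have b: "\<beta>\<^sup>2 = of_int m" using \<beta>(2) that(1) by (simp add: even_iff_mod_2_eq_zero)
      have m: "m = - 1 \<or> m = - 5" using m4(2) that(2) by blast
      have "4 dvd (of_int m :: zadic2) + 1" using m by auto
      moreover have "\<beta>\<^sup>2 = emb (of_int m)" by (simp add: b to_fract_of_int)
      ultimately have "max_upper_break Q2 L = 2" unfolding L\<beta> by (rule sqrt_minus_unit_break)
      moreover have "\<exists>i\<in>{1, 2}. ram_quadratic i = L"
        unfolding L\<beta> using m b ram_quadratic_sqrt(1,2)[of \<beta>] by auto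
      ultimately show ?thesis using comp by metis
    qed
    have case3: "L = F \<and> max_upper_break Q2 L = 0" if "even n" "\<not> 4 dvd d + 1"
    proof -
      have b: "\<beta>\<^sup>2 = of_int m" using \<beta>(2) that(1) by (simp add: even_iff_mod_2_eq_zero)
      have "\<beta>\<^sup>2 = 1 \<or> \<beta>\<^sup>2 = - 3" using m4(2) that(2) b \<beta>(3) by auto
      then show ?thesis using sqrt_unramified assms(7) unfolding L\<beta> by blast
    qed
    show ?thesis unfolding cong cond ord even_of_nat using False case1 case2 case3 by blast
  next
    case True
    obtain q w where q: "C6 = 2 ^ q * w" "\<not> 2 dvd w" "2 * q = 6 + n" and d1: "4 dvd d - 1"
      using straight_polygon_c6[OF disc d True] .
    have "even n" using q(3) by presburger
    have nd: "\<not> 4 dvd d + 1" using m4 d1 \<beta>(3) by auto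
    \<comment> \<open>For \<open>n \<ge> 16\<close> one has \<open>q \<ge> 11\<close>, and
      \<open>2 ^ 24\<close> divides \<open>C4 ^ 3\<close>: just enough for an integral model with
      smaller discriminant.\<close>
    have n16: "n < 16"
    proof (rule ccontr)
      assume "\<not> n < 16"
      then have "(2 :: zadic2) ^ 24 dvd 2 ^ (8 + n)" "(2 :: zadic2) ^ 11 dvd 2 ^ q"
        using q(3) by (intro le_imp_power_dvd; simp)+
      then have "2 ^ 24 dvd C4 ^ 3" "2 ^ 11 dvd C6" using True q(1) dvd_trans by (blast, auto)
      then have "2 ^ 8 dvd C4" "2 ^ 11 dvd C6" using power2_dvd_cube[of 24 C4 8] by simp_all
      then obtain x y where "C4 = 2 ^ 8 * x" "C6 = 2 ^ 11 * y" by (auto elim!: dvdE)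
      then show False using minimal_model_not_divisible[OF assms(4) _ _ disc0, of x y] by (simp add: M(1,2))
    qed
    have "n = 4 \<or> n = 6 \<or> n = 8 \<or> n = 10 \<or> n = 12 \<or> n = 14"
      using n4 n16 \<open>even n\<close> by presburger
    then consider (unramified) "n = 4 \<or> n = 10" | (tame) "n \<in> {6, 8, 12, 14}" by auto
    then show ?thesis
    proof cases
      case unramified
      \<comment> \<open>\<open>q = 3 + n / 2\<close>, so \<open>q + 1\<close> is 6 or 9.\<close>
      obtain k where k: "q + 1 = 3 * k" using unramified q(3) that[of 2] that[of 3] by auto
      have "L = F \<and> max_upper_break Q2 L = 0"
      proof (rule straight_polygon_unramified[OF disc d True q k])
        fix z assume "to_ac z \<in> ?R"
        then have L\<beta>: "L = adjoin Q2 {\<beta>}" by (rule red)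
        have b: "\<beta>\<^sup>2 = of_int m" using \<beta>(2) \<open>even n\<close> by (simp add: even_iff_mod_2_eq_zero)
        have "\<beta>\<^sup>2 = 1 \<or> \<beta>\<^sup>2 = - 3" using m4(1) d1 b by auto
        then show ?thesis using sqrt_unramified assms(7) unfolding L\<beta> by blast
      next
        fix r assume r: "adjoin Q2 ?R = adjoin_elem Q2 r" "has_ram_index (adjoin_elem Q2 r) 1"
          "max_upper_break Q2 (adjoin_elem Q2 r) = 0"
        have "L = adjoin_elem Q2 r" unfolding L by (rule r(1))
        then show ?thesis using unramified_conclusion[OF r(2)] assms(7) r(3) by blast
      qed
      moreover have "int n \<notin> {6, 8, 12, 14}" using unramified by auto
      ultimately show ?thesis unfolding cong cond ord even_of_nat using nd \<open>even n\<close> by blast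
    next
      case tame
      \<comment> \<open>Here \<open>q + 1\<close> is 7, 8, 10 or 11.\<close>
      have "(q + 1) mod 3 \<noteq> 0" using tame q(3) by auto
      then obtain \<omega> \<theta> where \<omega>: "\<omega>\<^sup>2 + \<omega> + 1 = 0" and \<theta>: "\<theta> ^ 3 = - 2" and "adjoin Q2 ?R = adjoin Q2 {\<omega>, \<theta>}"
        using straight_polygon_tame[OF disc d True q(1,2,3)] by blast
      then have L\<theta>: "L = adjoin_elem (adjoin_elem Q2 \<omega>) \<theta>"
        unfolding L theta_adjoin[OF \<omega> \<theta>] by simp
      have F: "F = adjoin_elem Q2 \<omega>" using theta_max_unramified[OF \<omega> \<theta>] assms(7) unfolding L\<theta> by blast
      have "iso_rupture L F [1, 0, 0, 2]" "max_upper_break Q2 L = 1"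
        unfolding L\<theta> F by (rule theta_iso_rupture[OF \<omega> \<theta>] theta_break[OF \<omega> \<theta>])+
      moreover have "int n \<in> {6, 8, 12, 14}" using tame by auto
      ultimately show ?thesis unfolding cong cond ord using nd True \<open>even n\<close> by simp
    qed
  qed
qed

end
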